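(* Consider the queueing control problem with one fast server of rate $\mu_1$, two identical slow servers of rate $\mu_2$, $0<\mu_2<\mu_1$, and Poisson arrivals of rate $\lambda>0$, described in the context. (i) Discounted cost. For every discount rate $\alpha>0$ there is a stationary policy that is optimal under the discounted-cost criterion and has the following threshold structure. Consider a decision time, and let $q$ denote the number of queued jobs when the slow-server decision is made (i.e. after the fast server, if it was idle, has been given a queued job if there is one); only $q\ge 1$ needs to be considered, since with $q=0$ there is nothing to assign to the slow servers. - Fast server: whenever the fast server is idle at a decision time and the queue is nonempty, it is assigned one queued job. - Slow servers: there exist thresholds $q_{\mathrm L},q_{\mathrm H}\in\mathbb{Z}_+\cup\{\infty\}$ with $0\le q_{\mathrm L}\le q_{\mathrm H}\le\infty$ (convention $\infty-1=\infty$), not depending on the state, such that: (a) when both slow servers are idle, the number of jobs assigned to them is $$\begin{cases}0,& q<q_{\mathrm L},\\ 1,& q_{\mathrm L}\le q<q_{\mathrm H},\\ \min\{2,q\},& q\ge q_{\mathrm H};\end{cases}$$ (b) when exactly one slow server is idle, one job is assigned to it if $q\ge q_{\mathrm H}-1$, and none otherwise. (ii) Average cost. If $\lambda<\mu_1+2\mu_2$, there is an average-cost optimal policy with the same structure (for some thresholds $0\le q_{\mathrm L}\le q_{\mathrm H}\le\infty$).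
   Context: Model. Jobs arrive to a single infinite-capacity queue according to a Poisson process of rate $\lambda$. There are three servers: server 1 (fast) has i.i.d. $\mathrm{Exp}(\mu_1)$ service times; servers 2 and 3 (slow, identical) have i.i.d. $\mathrm{Exp}(\mu_2)$ service times; arrivals and service times are mutually independent. The state is $\bar s=(q,z,y)\in\mathbb{Z}_+\times\{0,1\}\times\{0,1,2\}$, where $q$ is the number of queued jobs, $z$ the number of jobs at the fast server, and $y$ the number of jobs at the slow servers. Each server holds at most one job. Decisions. Decision times are the instants right after a job arrival (the arriving job has joined the queue) or a job departure. At a decision time the controller may move any number of queued jobs to idle servers (at most one per idle server), or none. Assignments are nonpreemptive: a job assigned to a server stays there until its service is completed. An admissible policy chooses these assignments in a nonanticipating way (possibly depending on the history). A stationary policy chooses them as a function of the current state only. Costs. Let $(Q(t),Z(t),Y(t))$ be the post-decision state at time $t$; the initial state $\bar s$ is a post-decision state and the first decision is made after the first event. The discounted cost of a policy $\pi$ with discount rate $\alpha>0$ is $\mathbb{E}\big[\int_0^\infty e^{-\alpha t}(Q(t)+Z(t)+Y(t))\,dt \,\big|\, \text{initial state } \bar s\big]$. The average cost is $\limsup_{T\to\infty}\frac1T\mathbb{E}\big[\int_0^T (Q(t)+Z(t)+Y(t))\,dt\,\big|\,\text{initial state }\bar s\big]$. A policy is optimal for a criterion if it minimizes the corresponding cost over all admissible policies, for every initial state. *)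

theory Defs
  imports "HOL-Probability.Probability"
begin

section \<open>States, events and clocks\<close>

text \<open>A state \<open>(q, z, y)\<close> counts the jobs in the queue, at the fast server and at the slow servers.\<close>

type_synonym state = "nat \<times> nat \<times> nat"

definition states :: "state set" where
  "states = UNIV \<times> {0, 1} \<times> {0, 1, 2}"

fun jobs :: "state \<Rightarrow> nat" where
  "jobs (q, z, y) = q + z + y"

datatype server = Fast | Slow1 | Slow2

text \<open>Each event is triggered by its own clock: the arrival clock runs for the current interarrival
  time, the clock of \<open>Departure i\<close> runs for the current service time of server \<open>i\<close>.\<close>

datatype event = Arrival | Departure server

fun rate :: "real \<Rightarrow> real \<Rightarrow> real \<Rightarrow> event \<Rightarrow> real" where
  "rate lam mu1 mu2 Arrival = lam"
| "rate lam mu1 mu2 (Departure Fast) = mu1"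
| "rate lam mu1 mu2 (Departure Slow1) = mu2"
| "rate lam mu1 mu2 (Departure Slow2) = mu2"

text \<open>Under \<open>sample_space\<close>, a sample point is a pair \<open>(u, \<omega>)\<close>. The value \<open>\<omega> (Arrival, k)\<close> is the \<open>k\<close>-th
  interarrival time, \<open>\<omega> (Departure i, k)\<close> is the \<open>k\<close>-th service time of server \<open>i\<close>, and \<open>u\<close> is an
  independent uniform seed that policies may use for randomisation. All of these are independent.\<close>

definition sample_space :: "real \<Rightarrow> real \<Rightarrow> real \<Rightarrow> (real \<times> (event \<times> nat \<Rightarrow> real)) measure" where
  "sample_space lam mu1 mu2 =
     uniform_measure lborel {0..1}
     \<Otimes>\<^sub>M (\<Pi>\<^sub>M p\<in>UNIV. density lborel (\<lambda>x. ennreal (exponential_density (rate lam mu1 mu2 (fst p)) x)))"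


section \<open>Policies\<close>

text \<open>A history lists, for every event so far in chronological order, its time, the event itself, and
  the state right after the event but before the decision. A policy maps the seed, the initial
  state and a nonempty history (whose last entry is the current event) to the pair \<open>(a, b)\<close> of
  numbers of queued jobs moved to the fast server and to the slow servers.\<close>

type_synonym history = "(real \<times> event \<times> state) list"
type_synonym policy = "real \<Rightarrow> state \<Rightarrow> history \<Rightarrow> nat \<times> nat"

fun feasible :: "state \<Rightarrow> (nat \<times> nat) set" where
  "feasible (q, z, y) = {(a, b). z + a \<le> 1 \<and> y + b \<le> 2 \<and> a + b \<le> q}"

text \<open>The second condition is joint measurability in the seed and the event times, for each of the
  countably many patterns of events and states; without it, the expected costs make no sense.\<close>

definition admissible :: "policy \<Rightarrow> bool" where
  "admissible \<pi> \<longleftrightarrow>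
     (\<forall>u s0 h t e s. s \<in> states \<longrightarrow> \<pi> u s0 (h @ [(t, e, s)]) \<in> feasible s) \<and>
     (\<forall>s0 ds. (\<lambda>(u, \<tau>). \<pi> u s0 (map (\<lambda>k. (\<tau> k, ds ! k)) [0..<length ds]))
        \<in> measurable (borel \<Otimes>\<^sub>M (\<Pi>\<^sub>M k\<in>(UNIV :: nat set). borel)) (count_space UNIV))"

definition stationary_policy :: "(state \<Rightarrow> nat \<times> nat) \<Rightarrow> policy" where
  "stationary_policy d = (\<lambda>u s0 h. d (snd (snd (last h))))"


section \<open>Dynamics\<close>

text \<open>A configuration is the full, partly unobservable, post-decision description of the system at
  an event time: \<open>due e\<close> is the time at which the clock of \<open>e\<close> rings (meaningful only while that
  clock runs) and \<open>started e\<close> is the number of times it has been started.\<close>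

record config =
  clock :: real
  queue :: nat
  busy :: "server set"
  due :: "event \<Rightarrow> real"
  started :: "event \<Rightarrow> nat"
  past :: history

definition occupancy :: "nat \<Rightarrow> server set \<Rightarrow> state" where
  "occupancy q B = (q, card (B \<inter> {Fast}), card (B \<inter> {Slow1, Slow2}))"

text \<open>The slow servers are identical, so a policy only decides how many of them receive a job; idle
  ones are used in the order \<open>Slow1\<close>, \<open>Slow2\<close>.\<close>

fun assigned :: "server set \<Rightarrow> nat \<times> nat \<Rightarrow> server set" where
  "assigned B (a, b) =
     set (take a (filter (\<lambda>i. i \<notin> B) [Fast])) \<union> set (take b (filter (\<lambda>i. i \<notin> B) [Slow1, Slow2]))"

definition start :: "(event \<times> nat \<Rightarrow> real) \<Rightarrow> event set \<Rightarrow> config \<Rightarrow> config" where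
  "start \<omega> E c = c\<lparr>
     due := (\<lambda>e. if e \<in> E then clock c + \<omega> (e, started c e) else due c e),
     started := (\<lambda>e. if e \<in> E then Suc (started c e) else started c e)\<rparr>"

text \<open>Jobs in service at time 0 have their full service time ahead of them; by memorylessness this is
  no restriction.\<close>

fun initial :: "(event \<times> nat \<Rightarrow> real) \<Rightarrow> state \<Rightarrow> config" where
  "initial \<omega> (q, z, y) =
     (let B = assigned {} (z, y) in
      start \<omega> (insert Arrival (Departure ` B))
        \<lparr>clock = 0, queue = q, busy = B, due = (\<lambda>_. 0), started = (\<lambda>_. 0), past = []\<rparr>)"

definition next_event :: "config \<Rightarrow> event" where
  "next_event c = arg_min_on (due c) (insert Arrival (Departure ` busy c))"

definition step :: "policy \<Rightarrow> real \<Rightarrow> state \<Rightarrow> (event \<times> nat \<Rightarrow> real) \<Rightarrow> config \<Rightarrow> config" where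
  "step \<pi> u s0 \<omega> c =
     (let e = next_event c;
          t = due c e;
          q = (if e = Arrival then Suc (queue c) else queue c);
          B = {i \<in> busy c. e \<noteq> Departure i};
          h = past c @ [(t, e, occupancy q B)];
          (a, b) = \<pi> u s0 h;
          I = assigned B (a, b)
      in start \<omega> ((if e = Arrival then {Arrival} else {}) \<union> Departure ` I)
           (c\<lparr>clock := t, queue := q - (a + b), busy := B \<union> I, past := h\<rparr>))"

definition config_after ::
    "policy \<Rightarrow> state \<Rightarrow> real \<times> (event \<times> nat \<Rightarrow> real) \<Rightarrow> nat \<Rightarrow> config" where
  "config_after \<pi> s0 x n = (case x of (u, \<omega>) \<Rightarrow> (step \<pi> u s0 \<omega> ^^ n) (initial \<omega> s0))"

definition num_events ::
    "policy \<Rightarrow> state \<Rightarrow> real \<times> (event \<times> nat \<Rightarrow> real) \<Rightarrow> real \<Rightarrow> nat" where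
  "num_events \<pi> s0 x t = card {n. clock (config_after \<pi> s0 x (Suc n)) \<le> t}"

text \<open>The post-decision state \<open>(Q(t), Z(t), Y(t))\<close>.\<close>

definition state_at ::
    "policy \<Rightarrow> state \<Rightarrow> real \<times> (event \<times> nat \<Rightarrow> real) \<Rightarrow> real \<Rightarrow> state" where
  "state_at \<pi> s0 x t =
     (let c = config_after \<pi> s0 x (num_events \<pi> s0 x t) in occupancy (queue c) (busy c))"


section \<open>Costs and optimality\<close>

definition discounted_cost :: "real \<Rightarrow> real \<Rightarrow> real \<Rightarrow> real \<Rightarrow> policy \<Rightarrow> state \<Rightarrow> ennreal" where
  "discounted_cost lam mu1 mu2 \<alpha> \<pi> s0 =
     (\<integral>\<^sup>+ x. (\<integral>\<^sup>+ t\<in>{0..}. ennreal (exp (- \<alpha> * t) * real (jobs (state_at \<pi> s0 x t))) \<partial>lborel)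
        \<partial>sample_space lam mu1 mu2)"

definition average_cost :: "real \<Rightarrow> real \<Rightarrow> real \<Rightarrow> policy \<Rightarrow> state \<Rightarrow> ennreal" where
  "average_cost lam mu1 mu2 \<pi> s0 =
     Limsup at_top (\<lambda>T :: real.
       (\<integral>\<^sup>+ x. (\<integral>\<^sup>+ t\<in>{0..T}. ennreal (real (jobs (state_at \<pi> s0 x t))) \<partial>lborel)
          \<partial>sample_space lam mu1 mu2) / ennreal T)"

definition optimal :: "(policy \<Rightarrow> state \<Rightarrow> ennreal) \<Rightarrow> policy \<Rightarrow> bool" where
  "optimal cost \<pi> \<longleftrightarrow> admissible \<pi> \<and> (\<forall>\<pi>' s0. admissible \<pi>' \<longrightarrow> s0 \<in> states \<longrightarrow> cost \<pi> s0 \<le> cost \<pi>' s0)"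


section \<open>Threshold structure\<close>

text \<open>Here \<open>n\<close> is the queue length before the decision and \<open>q\<close> the queue length when the slow-server
  decision is made. Note that \<open>\<infinity> - 1 = \<infinity>\<close> in \<open>enat\<close>; the truncation \<open>0 - 1 = 0\<close> is harmless
  as \<open>q \<ge> 1\<close>. No rule is needed if both slow servers are busy: feasibility forces \<open>b = 0\<close>.\<close>

definition threshold_structure :: "(state \<Rightarrow> nat \<times> nat) \<Rightarrow> enat \<Rightarrow> enat \<Rightarrow> bool" where
  "threshold_structure d qL qH \<longleftrightarrow> qL \<le> qH \<and>
     (\<forall>n z y. (n, z, y) \<in> states \<longrightarrow>
        (let (a, b) = d (n, z, y); q = n - a in
          (z = 0 \<and> n \<ge> 1 \<longrightarrow> a = 1) \<and>
          (y = 0 \<and> q \<ge> 1 \<longrightarrow>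
             b = (if enat q < qL then 0 else if enat q < qH then 1 else min 2 q)) \<and>
          (y = 1 \<and> q \<ge> 1 \<longrightarrow> b = (if enat q \<ge> qH - 1 then 1 else 0))))"

end

theory Submission
  imports Defs
begin

text \<open>
  Let \<open>x\<close> be the number of jobs in the queue and at the fast server and \<open>y\<close> the number at the slow
  servers. Relax the control problem: after every event of the uniformised chain, fictitious events included,
  any of the \<open>x\<close> jobs may be moved to idle slow servers. Value iteration for the relaxed problem
  preserves a system of inequalities (\<open>regular\<close>) that yields a threshold rule and shows that
  the relaxation is never exploited. Hence its value is a lower bound for every admissible policy and is
  attained by the threshold rule. For the average cost one lets the discount rate vanish: the
  relative values are nonnegative and bounded by the cost of emptying the system with all servers busy, so
  they converge along a subsequence; an Abelian argument gives the lower bound.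

  The link with the clock model is memorylessness: if the residual times of the running clocks are
  independent and exponential, they are so again after the next event. This gives a one-step
  recursion for the expected cost of the first \<open>n\<close> events under an arbitrary admissible policy.
\<close>

text \<open>What shapes the proof is that the actual state also records whether the fast server
  idles while jobs wait. Lumping queue and fast server into \<open>x\<close> forgets this, at the
  price of three gifts to the controller: the fast server works whenever \<open>x > 0\<close>,
  fictitious events are decision times too, and a job in fast service may be withdrawn. The lower
  bound survives because value iteration is monotone in \<open>x\<close> and increases with the
  number of steps. The gifts are worthless for the threshold rule: it idles the fast server only
  when the queue is empty, its post-decision state is already a fixed point of the minimisation, and
  the last two inequalities of \<open>regular\<close> keep a single lumped job at the fast server.
  The inequalities must be closed under both halves of the iteration, \<open>relocate\<close> and
  \<open>bellman_sum\<close>. Comparing a slow with a fast assignment in every state is not stable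
  under the second half; so only the instance \<open>x = 0\<close> belongs to
  \<open>regular\<close>, and the rest (\<open>swap_le\<close>) is regained from each minimisation.
  The instance \<open>x = 0\<close> is where \<open>mu2 < mu1\<close> enters.\<close>

section \<open>The relaxed control problem\<close>

text \<open>The best of all ways of moving jobs to idle slow servers. As a relaxation, even the job at the
  fast server may be moved.\<close>

fun relocate :: "(nat \<Rightarrow> nat \<Rightarrow> real) \<Rightarrow> nat \<Rightarrow> nat \<Rightarrow> real" where
  "relocate w 0 y = w 0 y"
| "relocate w (Suc x) y = (if y < 2 then min (w (Suc x) y) (relocate w x (Suc y)) else w (Suc x) y)"

text \<open>Uniformisation: idle servers produce fictitious events. For the fast server this is the truncation
  \<open>x - 1 = 0\<close> at \<open>x = 0\<close>.\<close>

definition bellman_sum :: "real \<Rightarrow> real \<Rightarrow> real \<Rightarrow> (nat \<Rightarrow> nat \<Rightarrow> real) \<Rightarrow> nat \<Rightarrow> nat \<Rightarrow> real" where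
  "bellman_sum lam mu1 mu2 v x y =
     real x + real y + lam * v (Suc x) y + mu1 * v (x - 1) y
     + mu2 * (real y * v x (y - 1) + (2 - real y) * v x y)"

text \<open>\<open>x\<close> counts the jobs in the queue and at the fast server, \<open>y\<close> those at the slow servers. Besides
  monotonicity in \<open>x\<close> and \<open>y\<close>, the inequalities say in this order: supermodularity; the gain
  \<open>v (x + 1) y - v x (y + 1)\<close> of a move to a slow server increases with \<open>x\<close>; a second move gains no more
  than the first one; convexity in \<open>y\<close>; the only job is best served by the fast server.\<close>

definition regular :: "(nat \<Rightarrow> nat \<Rightarrow> real) \<Rightarrow> bool" where
  "regular v \<longleftrightarrow> (\<forall>x.
     v x 0 \<le> v (Suc x) 0 \<and> v x 1 \<le> v (Suc x) 1 \<and> v x 2 \<le> v (Suc x) 2 \<and>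
     v x 0 \<le> v x 1 \<and> v x 1 \<le> v x 2 \<and>
     v (Suc x) 0 + v x 1 \<le> v x 0 + v (Suc x) 1 \<and>
     v (Suc x) 1 + v x 2 \<le> v x 1 + v (Suc x) 2 \<and>
     v (Suc x) 0 + v (Suc x) 1 \<le> v (Suc (Suc x)) 0 + v x 1 \<and>
     v (Suc x) 1 + v (Suc x) 2 \<le> v (Suc (Suc x)) 1 + v x 2 \<and>
     2 * v (Suc x) 1 \<le> v (Suc (Suc x)) 0 + v x 2 \<and>
     2 * v x 1 \<le> v x 0 + v x 2) \<and>
     v (Suc 0) 0 \<le> v 0 1 \<and> v (Suc 0) 1 \<le> v 0 2"

text \<open>Automatic after \<open>relocate\<close>, because the move was one of the options, but
  false in general for the Bellman sum, where a move may strictly gain. Hence it is kept apart from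
  \<open>regular\<close>.\<close>

definition swap_le :: "(nat \<Rightarrow> nat \<Rightarrow> real) \<Rightarrow> bool" where
  "swap_le v \<longleftrightarrow> (\<forall>x. v (Suc x) 0 \<le> v x 1 \<and> v (Suc x) 1 \<le> v x 2)"

lemma relocate_2: "relocate w x 2 = w x 2"
  by (cases x) auto

lemma relocate_1: "relocate w (Suc x) 1 = min (w (Suc x) 1) (w x 2)"
  using relocate_2[of w x] by (simp add: numeral_2_eq_2)

lemma relocate_0: "relocate w (Suc 0) 0 = min (w (Suc 0) 0) (w 0 1)"
  "relocate w (Suc (Suc x)) 0 = min (w (Suc (Suc x)) 0) (min (w (Suc x) 1) (w x 2))"
  using relocate_1[of w x] by simp_all

lemma regularI:
  assumes "\<And>x. v x 0 \<le> v (Suc x) 0"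
    "\<And>x. v x 1 \<le> v (Suc x) 1"
    "\<And>x. v x 2 \<le> v (Suc x) 2"
    "\<And>x. v x 0 \<le> v x 1"
    "\<And>x. v x 1 \<le> v x 2"
    "\<And>x. v (Suc x) 0 + v x 1 \<le> v x 0 + v (Suc x) 1"
    "\<And>x. v (Suc x) 1 + v x 2 \<le> v x 1 + v (Suc x) 2"
    "\<And>x. v (Suc x) 0 + v (Suc x) 1 \<le> v (Suc (Suc x)) 0 + v x 1"
    "\<And>x. v (Suc x) 1 + v (Suc x) 2 \<le> v (Suc (Suc x)) 1 + v x 2"
    "\<And>x. 2 * v (Suc x) 1 \<le> v (Suc (Suc x)) 0 + v x 2"
    "\<And>x. 2 * v x 1 \<le> v x 0 + v x 2"
    "v (Suc 0) 0 \<le> v 0 1" "v (Suc 0) 1 \<le> v 0 2"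
  shows "regular v"
  unfolding regular_def by (intro conjI allI assms)

lemma regularD:
  assumes "regular v"
  shows "v x 0 \<le> v (Suc x) 0"
    "v x 1 \<le> v (Suc x) 1"
    "v x 2 \<le> v (Suc x) 2"
    "v x 0 \<le> v x 1"
    "v x 1 \<le> v x 2"
    "v (Suc x) 0 + v x 1 \<le> v x 0 + v (Suc x) 1"
    "v (Suc x) 1 + v x 2 \<le> v x 1 + v (Suc x) 2"
    "v (Suc x) 0 + v (Suc x) 1 \<le> v (Suc (Suc x)) 0 + v x 1"
    "v (Suc x) 1 + v (Suc x) 2 \<le> v (Suc (Suc x)) 1 + v x 2"
    "2 * v (Suc x) 1 \<le> v (Suc (Suc x)) 0 + v x 2"
    "2 * v x 1 \<le> v x 0 + v x 2"
    "v (Suc 0) 0 \<le> v 0 1" "v (Suc 0) 1 \<le> v 0 2"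
  by (use assms in \<open>simp only: regular_def\<close>)+

text \<open>Supermodularity and monotonicity of the gain add up to convexity in \<open>x\<close>,
  which is therefore not listed in \<open>regular\<close>. For \<open>y = 2\<close> supermodularity
  is taken at \<open>Suc x\<close>.\<close>

lemma regular_convex:
  assumes "regular v"
  shows "2 * v (Suc x) 0 \<le> v x 0 + v (Suc (Suc x)) 0"
    "2 * v (Suc x) 1 \<le> v x 1 + v (Suc (Suc x)) 1"
    "2 * v (Suc x) 2 \<le> v x 2 + v (Suc (Suc x)) 2"
  using regularD(6-9)[OF assms, of x] regularD(7)[OF assms, of "Suc x"] by linarith+

declare relocate.simps(2) [simp del] One_nat_def [simp del]

lemma swap_le_relocate: "swap_le (relocate w)"
  unfolding swap_le_def using relocate_2[of w] by (auto simp: relocate.simps(2) One_nat_def numeral_2_eq_2)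

lemma relocate_le:
  "relocate w x 0 \<le> w x 0" "relocate w (Suc x) 0 \<le> w x 1" "relocate w (Suc (Suc x)) 0 \<le> w x 2"
  "relocate w x 1 \<le> w x 1" "relocate w (Suc x) 1 \<le> w x 2"
proof -
  show 1: "relocate w x 1 \<le> w x 1" "relocate w (Suc x) 1 \<le> w x 2" for x
    using relocate_1[of w x] relocate_1[of w "x - 1"] by (cases x; simp)+
  have "relocate w (Suc x) 0 = min (w (Suc x) 0) (relocate w x 1)" for x
    by (simp add: relocate.simps(2) One_nat_def)
  then show "relocate w x 0 \<le> w x 0" "relocate w (Suc x) 0 \<le> w x 1" "relocate w (Suc (Suc x)) 0 \<le> w x 2"
    using 1[of x] 1[of "Suc x"] by (cases x; simp)+
qed

text \<open>These case rules name the minimiser of a term on the right of an inequality;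
  \<open>relocate_le\<close> supplies the competing moves on its left.\<close>

lemma relocate_1_cases:
  obtains "relocate w x 1 = w x 1" | z where "x = Suc z" "relocate w x 1 = w z 2"
proof (cases x)
  case (Suc z)
  then show thesis using relocate_1[of w z] that by (metis min_def)
qed (use that in simp)

lemma relocate_0_cases:
  obtains "relocate w x 0 = w x 0" | z where "x = Suc z" "relocate w x 0 = w z 1"
  | z where "x = Suc (Suc z)" "relocate w x 0 = w z 2"
proof (cases x)
  case (Suc z)
  show thesis
  proof (cases "relocate w x 0 = w x 0")
    case False
    then have "relocate w x 0 = relocate w z 1"
      unfolding Suc by (simp add: relocate.simps(2) One_nat_def min_def split: if_splits)
    then show thesis
      using that Suc by (cases rule: relocate_1_cases[of w z]) auto
  qed (use that in simp)
qed (use that in simp)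

text \<open>An interchange argument. Fix the minimisers on the right-hand side and bound the
  left-hand side by feasible moves ending in nearby states. Either the same two states appear on
  both sides, or the inequalities for \<open>w\<close> compare them.\<close>

lemma regular_relocate:
  assumes w: "regular w"
  shows "regular (relocate w)"
proof -
  note mx = regularD(1-3)[OF w] and my = regularD(4,5)[OF w] and sm = regularD(6,7)[OF w]
    and sc = regularD(8,9)[OF w] and ad = regularD(10)[OF w] and cy = regularD(11)[OF w]
  note cx = regular_convex[OF w]
  note le = relocate_le[of w]
  have "relocate w x 0 \<le> relocate w (Suc x) 0" for x
  proof (cases rule: relocate_0_cases[of w "Suc x"])
    case (2 z)
    then show ?thesis using my(1)[of z] le(1)[of z] by simp
  next
    case (3 z)
    then show ?thesis using my(2)[of z] le(2)[of z] by simp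
  qed (use mx(1)[of x] le(1)[of x] in simp)
  moreover have "relocate w x 1 \<le> relocate w (Suc x) 1" for x
    by (cases rule: relocate_1_cases[of w "Suc x"])
      (use mx(2)[of x] my(2)[of x] le(4)[of x] in auto)
  moreover have "relocate w x 2 \<le> relocate w (Suc x) 2" for x
    using mx(3)[of x] by (simp add: relocate_2)
  moreover have "relocate w x 0 \<le> relocate w x 1" for x
  proof (cases rule: relocate_1_cases[of w x])
    case (2 z)
    then show ?thesis using my(2)[of z] le(2)[of z] by simp
  qed (use my(1)[of x] le(1)[of x] in simp)
  moreover have "relocate w x 1 \<le> relocate w x 2" for x
    using my(2)[of x] le(4)[of x] by (simp add: relocate_2)
  moreover have "relocate w (Suc x) 0 + relocate w x 1 \<le> relocate w x 0 + relocate w (Suc x) 1" for x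
  proof (cases rule: relocate_1_cases[of w "Suc x"])
    case 1
    show ?thesis
    proof (cases rule: relocate_0_cases[of w x])
      \<comment> \<open>Two moves from \<open>(x, 0)\<close> against none from
        \<open>(Suc x, 1)\<close>: no single inequality joins the four states. Monotonicity of the
        gain at \<open>Suc z\<close> and convexity at \<open>z\<close> share
        \<open>w (Suc (Suc z)) 2\<close>, which cancels in their sum.\<close>
      case (3 z)
      then show ?thesis
        using 1 le(3)[of "Suc z"] le(4)[of x] sc(2)[of "Suc z"] cx(3)[of z] by simp
    next
      case (2 z)
      then show ?thesis
        using 1 le(2)[of "Suc z"] le(4)[of x] cx(2)[of z] by simp
    qed (use 1 le(1)[of "Suc x"] le(4)[of x] sm(1)[of x] in simp)
  next
    case (2 a)
    show ?thesis
    proof (cases rule: relocate_0_cases[of w x])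
      case 1
      then show ?thesis using 2 le(2)[of x] le(4)[of x] cy[of x] by simp
    next
      case (2 z)
      then show ?thesis using \<open>Suc x = Suc a\<close> \<open>relocate w (Suc x) 1 = w a 2\<close>
          le(2)[of x] le(5)[of z] sm(2)[of z] by simp
    next
      case (3 z)
      then show ?thesis using \<open>Suc x = Suc a\<close> \<open>relocate w (Suc x) 1 = w a 2\<close>
          le(3)[of "Suc z"] le(5)[of "Suc z"] cx(3)[of z] by simp
    qed
  qed
  moreover have "relocate w (Suc x) 1 + relocate w x 2 \<le> relocate w x 1 + relocate w (Suc x) 2" for x
  proof (cases rule: relocate_1_cases[of w x])
    case 1
    then show ?thesis using sm(2)[of x] le(4)[of "Suc x"] by (simp add: relocate_2)
  next
    case (2 z)
    then show ?thesis using cx(3)[of z] le(5)[of x] by (simp add: relocate_2)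
  qed
  moreover have "relocate w (Suc x) 0 + relocate w (Suc x) 1
      \<le> relocate w (Suc (Suc x)) 0 + relocate w x 1" for x
  proof (cases rule: relocate_1_cases[of w x])
    case 1
    then show ?thesis
      by (cases rule: relocate_0_cases[of w "Suc (Suc x)"])
        (use le(1)[of "Suc x"] le(2)[of x] le(4)[of "Suc x"] le(5)[of x] sc(1)[of x] in auto)
  next
    case (2 z)
    show ?thesis
    proof (cases rule: relocate_0_cases[of w "Suc (Suc x)"])
      \<comment> \<open>No move at the larger state but one at \<open>(x, 1)\<close>: the bound on
        second moves \<open>ad\<close> and monotonicity of the gain are added, and
        \<open>w x 2\<close> cancels.\<close>
      case 1
      then show ?thesis
        using 2 le(2)[of x] le(4)[of "Suc x"] ad[of x] sc(2)[of z] by simp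
    qed (use 2 le(3)[of z] le(4)[of "Suc x"] le(5)[of x] in auto)
  qed
  moreover have "relocate w (Suc x) 1 + relocate w (Suc x) 2
      \<le> relocate w (Suc (Suc x)) 1 + relocate w x 2" for x
    by (cases rule: relocate_1_cases[of w "Suc (Suc x)"])
      (use sc(2)[of x] le(4)[of "Suc x"] le(5)[of x] in \<open>auto simp: relocate_2\<close>)
  moreover have "2 * relocate w (Suc x) 1 \<le> relocate w (Suc (Suc x)) 0 + relocate w x 2" for x
    by (cases rule: relocate_0_cases[of w "Suc (Suc x)"])
      (use ad[of x] le(4)[of "Suc x"] le(5)[of x] in \<open>auto simp: relocate_2\<close>)
  moreover have "2 * relocate w x 1 \<le> relocate w x 0 + relocate w x 2" for x
  proof (cases rule: relocate_0_cases[of w x])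
    case 1
    then show ?thesis using cy[of x] le(4)[of x] by (simp add: relocate_2)
  next
    case (2 z)
    then show ?thesis using sm(2)[of z] le(4)[of x] le(5)[of z] by (simp add: relocate_2)
  next
    case (3 z)
    then show ?thesis using cx(3)[of z] le(5)[of "Suc z"] by (simp add: relocate_2)
  qed
  moreover have "relocate w (Suc 0) 0 \<le> relocate w 0 1" "relocate w (Suc 0) 1 \<le> relocate w 0 2"
    using swap_le_relocate[of w] unfolding swap_le_def by blast+
  ultimately show ?thesis
    by (rule regularI)
qed

text \<open>The arrival and fast-service terms inherit each inequality at a shifted
  \<open>x\<close>, and the slow-service term is a combination of inequalities already available.
  Only the truncation \<open>x - 1\<close> at \<open>x = 0\<close> and the last two inequalities
  need special care.\<close>

lemma regular_bellman_sum:
  assumes v: "regular v" and s: "swap_le v" and "0 < lam" "0 < mu2" "mu2 < mu1"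
  shows "regular (bellman_sum lam mu1 mu2 v)"
proof -
  let ?f = "bellman_sum lam mu1 mu2 v"
  have R: "0 \<le> v (Suc x) 0 - v x 0" "0 \<le> v (Suc x) 1 - v x 1" "0 \<le> v (Suc x) 2 - v x 2"
     "0 \<le> v x 1 - v x 0" "0 \<le> v x 2 - v x 1"
     "0 \<le> v x 0 + v (Suc x) 1 - v (Suc x) 0 - v x 1"
     "0 \<le> v x 1 + v (Suc x) 2 - v (Suc x) 1 - v x 2"
     "0 \<le> v (Suc (Suc x)) 0 + v x 1 - v (Suc x) 0 - v (Suc x) 1"
     "0 \<le> v (Suc (Suc x)) 1 + v x 2 - v (Suc x) 1 - v (Suc x) 2"
     "0 \<le> v (Suc (Suc x)) 0 + v x 2 - 2 * v (Suc x) 1"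
     "0 \<le> v x 0 + v x 2 - 2 * v x 1" for x
    using regularD(1-11)[OF v, of x] by linarith+
  have S: "0 \<le> v x 1 - v (Suc x) 0" "0 \<le> v x 2 - v (Suc x) 1" for x
    using s unfolding swap_le_def by auto
  have C: "0 \<le> v x 0 + v (Suc (Suc x)) 0 - 2 * v (Suc x) 0"
     "0 \<le> v x 1 + v (Suc (Suc x)) 1 - 2 * v (Suc x) 1"
     "0 \<le> v x 2 + v (Suc (Suc x)) 2 - 2 * v (Suc x) 2" for x
    using regular_convex[OF v, of x] by auto
  have E: "?f x 0 = real x + lam * v (Suc x) 0 + mu1 * v (x - 1) 0 + mu2 * (2 * v x 0)"
    "?f x 1 = real x + 1 + lam * v (Suc x) 1 + mu1 * v (x - 1) 1 + mu2 * (v x 0 + v x 1)"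
    "?f x 2 = real x + 2 + lam * v (Suc x) 2 + mu1 * v (x - 1) 2 + mu2 * (2 * v x 1)" for x
    by (simp_all add: bellman_sum_def One_nat_def)
  \<comment> \<open>Multiplying every known inequality by each rate beforehand makes the goals
    linear in the products.\<close>
  have P: "0 \<le> lam * a" "0 \<le> mu1 * a" "0 \<le> mu2 * a" if "0 \<le> a" for a
    using that assms by auto
  note PA = R[THEN P(1)] C[THEN P(1)]
  note PM = R[THEN P(2)] C[THEN P(2)]
  note PS = R[THEN P(3)] C[THEN P(3)]
  have "?f x 0 \<le> ?f (Suc x) 0" for x
    by (cases x) (use PA(1)[of "Suc x"] PM(1)[of "x - 1"] PS(1)[of x]  in \<open>simp_all add: E algebra_simps\<close>)
  moreover have "?f x 1 \<le> ?f (Suc x) 1" for x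
    by (cases x) (use PA(2)[of "Suc x"] PM(2)[of "x - 1"] PS(1,2)[of x]  in \<open>simp_all add: E algebra_simps\<close>)
  moreover have "?f x 2 \<le> ?f (Suc x) 2" for x
    by (cases x) (use PA(3)[of "Suc x"] PM(3)[of "x - 1"] PS(2)[of x]  in \<open>simp_all add: E algebra_simps\<close>)
  moreover have "?f x 0 \<le> ?f x 1" for x
    by (cases x) (use PA(4)[of "Suc x"] PM(4)[of "x - 1"] PS(4)[of x] in \<open>simp_all add: E algebra_simps\<close>)
  moreover have "?f x 1 \<le> ?f x 2" for x
    by (cases x) (use PA(5)[of "Suc x"] PM(5)[of "x - 1"] PS(4)[of x]  in \<open>simp_all add: E algebra_simps\<close>)
  moreover have "?f (Suc x) 0 + ?f x 1 \<le> ?f x 0 + ?f (Suc x) 1" for x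
    by (cases x) (use PA(6)[of "Suc x"] PM(6)[of "x - 1"] PS(6)[of x]  in \<open>simp_all add: E algebra_simps\<close>)
  moreover have "?f (Suc x) 1 + ?f x 2 \<le> ?f x 1 + ?f (Suc x) 2" for x
    by (cases x) (use PA(7)[of "Suc x"] PM(7)[of "x - 1"] PS(6)[of x] PS(7)[of x]  in \<open>simp_all add: E algebra_simps\<close>)
  \<comment> \<open>Index 12 of \<open>PS\<close> is convexity in \<open>x\<close> for
    \<open>y = 0\<close> (the eleven facts of \<open>R\<close> precede those of \<open>C\<close>);
    the slow-service term needs it besides the gain inequality. At \<open>x = 0\<close> the
    truncation leaves \<open>v 0 0 \<le> v 1 0\<close> of the fast-service term.\<close>
  moreover have "?f (Suc x) 0 + ?f (Suc x) 1 \<le> ?f (Suc (Suc x)) 0 + ?f x 1" for x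
    by (cases x) (use PA(8)[of "Suc x"] PM(8)[of "x - 1"] PS(8)[of x] PS(12)[of x] PM(1)[of 0] in \<open>simp_all add: E algebra_simps\<close>)
  moreover have "?f (Suc x) 1 + ?f (Suc x) 2 \<le> ?f (Suc (Suc x)) 1 + ?f x 2" for x
    by (cases x) (use PA(9)[of "Suc x"] PM(9)[of "x - 1"] PS(8)[of x] PS(13)[of x] PM(2)[of 0] in \<open>simp_all add: E algebra_simps\<close>)
  \<comment> \<open>At \<open>x = 0\<close> the fast-service term asks for
    \<open>2 * v 0 1 \<le> v 1 0 + v 0 2\<close>: convexity in \<open>y\<close> plus monotonicity in
    \<open>x\<close>.\<close>
  moreover have "2 * ?f (Suc x) 1 \<le> ?f (Suc (Suc x)) 0 + ?f x 2" for x
    by (cases x) (use PA(10)[of "Suc x"] PM(10)[of "x - 1"] PS(8)[of x] P(2)[OF add_nonneg_nonneg[OF R(11)[of 0] R(1)[of 0]]] in \<open>simp_all add: E algebra_simps\<close>)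
  moreover have "2 * ?f x 1 \<le> ?f x 0 + ?f x 2" for x
    by (cases x) (use PA(11)[of "Suc x"] PM(11)[of "x - 1"]   in \<open>simp_all add: E algebra_simps\<close>)
  moreover have "?f (Suc 0) 0 \<le> ?f 0 1"
  proof -
    have "lam * v (Suc (Suc 0)) 0 \<le> lam * v (Suc 0) 1" using S(1)[of "Suc 0"] assms by auto
    \<comment> \<open>Lowering the rate at which the fast server completes the single job from
      \<open>mu1\<close> to \<open>mu2\<close> leaves \<open>2 * mu2 * (v 0 1 - v 1 0)\<close>,
      which \<open>swap_le\<close> makes nonnegative.\<close>
    moreover have "mu2 * (v 0 1 - v 0 0) \<le> mu1 * (v 0 1 - v 0 0)"
      using R(4)[of 0] assms by (intro mult_right_mono) auto
    moreover have "0 \<le> mu2 * (v 0 1 - v (Suc 0) 0)" using S(1)[of 0] assms by auto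
    ultimately show ?thesis unfolding E by (simp add: algebra_simps)
  qed
  moreover have "?f (Suc 0) 1 \<le> ?f 0 2"
  proof -
    have "lam * v (Suc (Suc 0)) 1 \<le> lam * v (Suc 0) 2" using S(2)[of "Suc 0"] assms by auto
    moreover have "mu2 * (v 0 2 - v 0 1) \<le> mu1 * (v 0 2 - v 0 1)"
      using R(5)[of 0] assms by (intro mult_right_mono) auto
    moreover have "0 \<le> mu2 * (v 0 2 - v (Suc 0) 1)" "0 \<le> mu2 * (v 0 1 - v (Suc 0) 0)"
      using S[of 0] assms by auto
    ultimately show ?thesis unfolding E by (simp add: algebra_simps)
  qed
  ultimately show ?thesis
    by (rule regularI)
qed

section \<open>Monotonicity and limits of the minimisation\<close>

lemma relocate_mono:
  assumes "\<And>x y. y \<le> 2 \<Longrightarrow> v x y \<le> w x y" "y \<le> 2"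
  shows "relocate v x y \<le> relocate w x y"
  using assms(2)
proof (induction x arbitrary: y)
  case (Suc x)
  then show ?case
    using assms(1)[of y "Suc x"] Suc.IH[of "Suc y"] by (auto simp: relocate.simps(2) min_le_iff_disj)
qed (simp add: assms(1))

lemma relocate_le_self: "relocate w x y \<le> w x y"
  by (cases x) (auto simp: relocate.simps(2))

text \<open>Moves compose: what can be reached after \<open>b\<close> moves could be reached before
  them.\<close>

lemma relocate_le_relocate:
  assumes "b \<le> x" "y + b \<le> 2"
  shows "relocate w x y \<le> relocate w (x - b) (y + b)"
  using assms
proof (induction b arbitrary: x y)
  case (Suc b)
  then obtain x' where x: "x = Suc x'"
    by (cases x) auto
  have "relocate w x y \<le> relocate w x' (Suc y)"
    using Suc.prems by (simp add: x relocate.simps(2))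
  also have "\<dots> \<le> relocate w (x' - b) (Suc y + b)"
    using Suc.prems by (intro Suc.IH) (auto simp: x)
  finally show ?case by (simp add: x)
qed simp

lemma relocate_le_move:
  assumes "b \<le> x" "y + b \<le> 2"
  shows "relocate w x y \<le> w (x - b) (y + b)"
  using relocate_le_relocate[OF assms, of w] relocate_le_self[of w "x - b" "y + b"] by linarith

lemma tendsto_relocate:
  assumes "\<And>x y. y \<le> 2 \<Longrightarrow> (\<lambda>n. f n x y) \<longlonglongrightarrow> w x y" "y \<le> 2"
  shows "(\<lambda>n. relocate (f n) x y) \<longlonglongrightarrow> relocate w x y"
  using assms(2)
proof (induction x arbitrary: y)
  case (Suc x)
  then show ?case
    by (cases "y < 2") (auto simp: relocate.simps(2) intro!: tendsto_min assms(1))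
qed (simp add: assms(1))

lemma relocate_add: "relocate (\<lambda>x y. w x y + c) x y = relocate w x y + c"
  by (induction x arbitrary: y) (auto simp: relocate.simps(2) min_def)

lemma regular_LIMSEQ:
  assumes lim: "\<And>x y. y \<le> 2 \<Longrightarrow> (\<lambda>n. f n x y) \<longlonglongrightarrow> w x y" and reg: "\<And>n. regular (f n)"
  shows "regular w"
proof (rule regularI)
  have le: "a \<le> b" if "\<And>n. g n \<le> h n" "g \<longlonglongrightarrow> a" "h \<longlonglongrightarrow> b" for g h :: "nat \<Rightarrow> real" and a b
    using that by (blast intro: LIMSEQ_le)
  fix x
  show "w x 0 \<le> w (Suc x) 0"
    by (rule le[where g="\<lambda>n. f n x 0" and h="\<lambda>n. f n (Suc x) 0"], rule regularD(1)[OF reg])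
      (intro tendsto_intros lim; simp)+
  show "w x 1 \<le> w (Suc x) 1"
    by (rule le[where g="\<lambda>n. f n x 1" and h="\<lambda>n. f n (Suc x) 1"], rule regularD(2)[OF reg])
      (intro tendsto_intros lim; simp)+
  show "w x 2 \<le> w (Suc x) 2"
    by (rule le[where g="\<lambda>n. f n x 2" and h="\<lambda>n. f n (Suc x) 2"], rule regularD(3)[OF reg])
      (intro tendsto_intros lim; simp)+
  show "w x 0 \<le> w x 1"
    by (rule le[where g="\<lambda>n. f n x 0" and h="\<lambda>n. f n x 1"], rule regularD(4)[OF reg])
      (intro tendsto_intros lim; simp)+
  show "w x 1 \<le> w x 2"
    by (rule le[where g="\<lambda>n. f n x 1" and h="\<lambda>n. f n x 2"], rule regularD(5)[OF reg])
      (intro tendsto_intros lim; simp)+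
  show "w (Suc x) 0 + w x 1 \<le> w x 0 + w (Suc x) 1"
    by (rule le[where g="\<lambda>n. f n (Suc x) 0 + f n x 1" and h="\<lambda>n. f n x 0 + f n (Suc x) 1"], rule regularD(6)[OF reg])
      (intro tendsto_intros lim; simp)+
  show "w (Suc x) 1 + w x 2 \<le> w x 1 + w (Suc x) 2"
    by (rule le[where g="\<lambda>n. f n (Suc x) 1 + f n x 2" and h="\<lambda>n. f n x 1 + f n (Suc x) 2"], rule regularD(7)[OF reg])
      (intro tendsto_intros lim; simp)+
  show "w (Suc x) 0 + w (Suc x) 1 \<le> w (Suc (Suc x)) 0 + w x 1"
    by (rule le[where g="\<lambda>n. f n (Suc x) 0 + f n (Suc x) 1" and h="\<lambda>n. f n (Suc (Suc x)) 0 + f n x 1"], rule regularD(8)[OF reg])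
      (intro tendsto_intros lim; simp)+
  show "w (Suc x) 1 + w (Suc x) 2 \<le> w (Suc (Suc x)) 1 + w x 2"
    by (rule le[where g="\<lambda>n. f n (Suc x) 1 + f n (Suc x) 2" and h="\<lambda>n. f n (Suc (Suc x)) 1 + f n x 2"], rule regularD(9)[OF reg])
      (intro tendsto_intros lim; simp)+
  show "2 * w (Suc x) 1 \<le> w (Suc (Suc x)) 0 + w x 2"
    by (rule le[where g="\<lambda>n. 2 * f n (Suc x) 1" and h="\<lambda>n. f n (Suc (Suc x)) 0 + f n x 2"], rule regularD(10)[OF reg])
      (intro tendsto_intros lim; simp)+
  show "2 * w x 1 \<le> w x 0 + w x 2"
    by (rule le[where g="\<lambda>n. 2 * f n x 1" and h="\<lambda>n. f n x 0 + f n x 2"], rule regularD(11)[OF reg])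
      (intro tendsto_intros lim; simp)+
  show "w (Suc 0) 0 \<le> w 0 1"
    by (rule le[where g="\<lambda>n. f n (Suc 0) 0" and h="\<lambda>n. f n 0 1"], rule regularD(12)[OF reg])
      (intro tendsto_intros lim; simp)+
  show "w (Suc 0) 1 \<le> w 0 2"
    by (rule le[where g="\<lambda>n. f n (Suc 0) 1" and h="\<lambda>n. f n 0 2"], rule regularD(13)[OF reg])
      (intro tendsto_intros lim; simp)+
qed

lemma regular_add:
  assumes "regular v"
  shows "regular (\<lambda>x y. v x y + c)"
  by (rule regularI) (use regularD[OF assms] in \<open>simp_all add: algebra_simps\<close>)

lemma regular_divide:
  assumes "regular v" "0 < (c::real)"
  shows "regular (\<lambda>x y. v x y / c)"
  by (rule regularI; use regularD[OF assms(1)] assms(2) in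
      \<open>simp only: add_divide_distrib[symmetric] times_divide_eq_right divide_le_cancel; simp add: divide_right_mono\<close>)

text \<open>Cantor's diagonal extraction; it provides one sequence of discount rates along which the
  relative values converge in all states.\<close>

lemma diagonal_convergent:
  fixes f :: "nat \<Rightarrow> nat \<Rightarrow> real"
  assumes "\<And>m. bounded (range (\<lambda>k. f k m))"
  obtains r where "strict_mono r" "\<And>m. convergent (\<lambda>k. f (r k) m)"
proof -
  interpret subseqs "\<lambda>m r. convergent (\<lambda>k. f (r k) m)"
  proof
    fix m and s :: "nat \<Rightarrow> nat" assume "strict_mono s"
    have "bounded (range (\<lambda>k. f (s k) m))"
      by (rule bounded_subset[OF assms[of m]]) auto
    then obtain l r where "strict_mono r" "((\<lambda>k. f (s k) m) \<circ> r) \<longlonglongrightarrow> l"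
      using bounded_imp_convergent_subsequence by blast
    then show "\<exists>r'. strict_mono r' \<and> convergent (\<lambda>k. f ((s \<circ> r') k) m)"
      by (auto simp: o_def convergent_def)
  qed
  have "convergent (\<lambda>k. f (diagseq k) m)" for m
  proof -
    have "convergent (\<lambda>k. f ((diagseq \<circ> ((+) (Suc m))) k) m)"
      by (rule diagseq_holds) (auto simp: o_def convergent_def dest: LIMSEQ_subseq_LIMSEQ[unfolded o_def])
    then have "convergent (\<lambda>k. f (diagseq (k + Suc m)) m)"
      by (simp add: o_def add.commute)
    then show ?thesis
      by (subst (asm) convergent_ignore_initial_segment)
  qed
  then show thesis
    using that subseq_diagseq by blast
qed

lemma regular_mono_x: "regular v \<Longrightarrow> y \<le> 2 \<Longrightarrow> v x y \<le> v (Suc x) y"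
  using regularD(1-3)[of v x] by (auto simp: le_Suc_eq numeral_2_eq_2 One_nat_def)

lemma regular_mono_y: "regular v \<Longrightarrow> y < 2 \<Longrightarrow> v x y \<le> v x (Suc y)"
  using regularD(4,5)[of v x] by (auto simp: less_Suc_eq numeral_2_eq_2 One_nat_def)

lemma regular_ge_origin:
  assumes "regular v" "y \<le> 2"
  shows "v 0 0 \<le> v x y"
proof -
  have "v 0 0 \<le> v x 0"
    using regular_mono_x[OF assms(1), of 0] by (induction x) (auto intro: order.trans)
  also have "v x 0 \<le> v x y"
    using assms(2)
  proof (induction y)
    case (Suc y)
    then show ?case using regular_mono_y[OF assms(1), of y x] by auto
  qed simp
  finally show ?thesis .
qed

section \<open>Value iteration\<close>

locale rates =
  fixes lam mu1 mu2 :: real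
  assumes lam: "0 < lam" and mu2: "0 < mu2" and mu12: "mu2 < mu1"
begin

abbreviation bsum where "bsum \<equiv> bellman_sum lam mu1 mu2"

text \<open>The uniformisation rate: the total event rate when all servers are busy.\<close>

definition Lam :: real where "Lam = lam + mu1 + 2 * mu2"

lemma mu1: "0 < mu1" and Lam_pos: "0 < Lam"
  using lam mu2 mu12 by (auto simp: Lam_def)

text \<open>These are values before a decision. The quotient inside \<open>relocate\<close> is the
  value after it: holding cost and continuation up to the next uniformised event, with
  \<open>1 / (al + Lam)\<close> the mean discounted time to that event.\<close>

primrec viter :: "real \<Rightarrow> nat \<Rightarrow> nat \<Rightarrow> nat \<Rightarrow> real" where
  "viter al 0 = (\<lambda>x y. 0)"
| "viter al (Suc n) = relocate (\<lambda>x y. bsum (viter al n) x y / (al + Lam))"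

definition val :: "real \<Rightarrow> nat \<Rightarrow> nat \<Rightarrow> real" where
  "val al x y = lim (\<lambda>n. viter al n x y)"

lemma bsum_mono:
  assumes "\<And>x y. y \<le> 2 \<Longrightarrow> v x y \<le> w x y" "y \<le> 2"
  shows "bsum v x y \<le> bsum w x y"
  unfolding bellman_sum_def using assms lam mu2 mu1
  by (intro add_mono mult_left_mono) auto

text \<open>Used for comparison functions of the number of jobs alone: a linear one in
  \<open>viter_bound\<close> and \<open>passage\<close> in \<open>val_le_passage\<close>. The
  fast-service argument stays \<open>x - 1 + y\<close> because at \<open>x = 0\<close> no job leaves
  the fast server even if \<open>y > 0\<close>.\<close>

lemma bsum_affine:
  assumes "y \<le> 2"
  shows "bsum (\<lambda>x y. c + f (x + y)) x y
    = real (x + y) + Lam * c + lam * f (Suc (x + y)) + mu1 * f (x - 1 + y)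
      + mu2 * (real y * f (x + y - 1) + (2 - real y) * f (x + y))"
  unfolding bellman_sum_def Lam_def by (cases y) (auto simp: algebra_simps)

lemma regular_viter:
  assumes "0 < al"
  shows "regular (viter al n) \<and> swap_le (viter al n)"
proof (induction n)
  case 0
  then show ?case by (auto intro!: regularI simp: swap_le_def)
next
  case (Suc n)
  then show ?case
    using assms Lam_pos lam mu2 mu12
    by (auto intro!: regular_relocate regular_divide regular_bellman_sum swap_le_relocate)
qed

lemma viter_incr:
  assumes "0 < al" "y \<le> 2"
  shows "viter al n x y \<le> viter al (Suc n) x y"
  using assms(2)
proof (induction n arbitrary: x y)
  case 0
  have "(\<lambda>x y. 0) x y \<le> relocate (\<lambda>x y. bsum (\<lambda>x y. 0) x y / (al + Lam)) x y" for x y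
  proof (induction x arbitrary: y)
    case 0
    show ?case using assms(1) Lam_pos by (simp add: bellman_sum_def)
  next
    case (Suc x)
    then show ?case using assms(1) Lam_pos by (simp add: bellman_sum_def relocate.simps(2))
  qed
  then show ?case by simp
next
  case (Suc n)
  show ?case
    unfolding viter.simps(2)[of al "Suc n"] viter.simps(2)[of al n]
    using assms Lam_pos Suc
    by (intro relocate_mono divide_right_mono bsum_mono) auto
qed

lemma viter_nonneg: "0 < al \<Longrightarrow> y \<le> 2 \<Longrightarrow> 0 \<le> viter al n x y"
proof (induction n)
  case (Suc n)
  then show ?case using viter_incr[of al y n x] by linarith
qed simp

text \<open>The right-hand side is the discounted cost of a system that starts with
  \<open>x + y\<close> jobs, receives arrivals and never completes one: the integral of
  \<open>exp (- al * t) * (x + y + lam * t)\<close>.\<close>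

lemma viter_bound:
  assumes "0 < al" "y \<le> 2"
  shows "viter al n x y \<le> real (x + y) / al + lam / al\<^sup>2"
  using assms(2)
proof (induction n arbitrary: x y)
  case 0
  then show ?case using assms(1) lam by simp
next
  case (Suc n)
  define f where "f m = real m / al" for m :: nat
  have self: "viter al (Suc n) x y \<le> bsum (viter al n) x y / (al + Lam)"
    unfolding viter.simps by (rule relocate_le_self)
  have "viter al n x y \<le> lam / al\<^sup>2 + f (x + y)" if "y \<le> 2" for x y
    using Suc.IH[OF that, of x] by (simp add: f_def)
  then have "bsum (viter al n) x y \<le> bsum (\<lambda>x y. lam / al\<^sup>2 + f (x + y)) x y"
    using Suc.prems by (intro bsum_mono)
  also have "\<dots> \<le> real (x + y) + Lam * (lam / al\<^sup>2) + lam * f (Suc (x + y)) + mu1 * f (x + y)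
      + mu2 * (real y * f (x + y) + (2 - real y) * f (x + y))"
    unfolding bsum_affine[OF Suc.prems] using lam Lam_pos mu1 mu2 assms(1) Suc.prems
    by (intro add_mono mult_left_mono) (auto simp: f_def divide_right_mono)
  also have "\<dots> = (al + Lam) * (real (x + y) / al + lam / al\<^sup>2)"
    using assms(1) by (simp add: f_def Lam_def field_simps power2_eq_square)
  finally have "bsum (viter al n) x y / (al + Lam) \<le> real (x + y) / al + lam / al\<^sup>2"
    using assms(1) Lam_pos by (subst divide_le_eq) (simp add: mult.commute)
  then show ?case
    using self by linarith
qed

lemma viter_val:
  assumes "0 < al" "y \<le> 2"
  shows "(\<lambda>n. viter al n x y) \<longlonglongrightarrow> val al x y" "viter al n x y \<le> val al x y"
proof -
  have inc: "incseq (\<lambda>n. viter al n x y)"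
    using viter_incr[OF assms] by (intro incseq_SucI)
  have "Bseq (\<lambda>n. viter al n x y)"
    unfolding Bseq_def using viter_nonneg[OF assms] viter_bound[OF assms] Lam_pos
    by (intro exI[of _ "real (x + y) / al + lam / al\<^sup>2 + 1"])
      (auto simp: add_pos_nonneg abs_of_nonneg intro!: add_nonneg_pos add_nonneg_nonneg order.trans[OF viter_bound[OF assms]] divide_nonneg_nonneg less_imp_le[OF assms(1)] less_imp_le[OF lam])
  then have "convergent (\<lambda>n. viter al n x y)"
    using inc by (intro Bseq_mono_convergent) (auto simp: incseq_def)
  then show l: "(\<lambda>n. viter al n x y) \<longlonglongrightarrow> val al x y"
    unfolding val_def by (simp add: convergent_LIMSEQ_iff)
  show "viter al n x y \<le> val al x y"
    by (rule incseq_le[OF inc l])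
qed

lemma val_nonneg: "0 < al \<Longrightarrow> y \<le> 2 \<Longrightarrow> 0 \<le> val al x y"
  using viter_val(2)[of al y 0 x] by simp

lemma tendsto_bsum:
  assumes "\<And>x y. y \<le> 2 \<Longrightarrow> (\<lambda>n. f n x y) \<longlonglongrightarrow> w x y" "y \<le> 2"
  shows "(\<lambda>n. bsum (f n) x y) \<longlonglongrightarrow> bsum w x y"
  unfolding bellman_sum_def using assms by (intro tendsto_intros) auto

lemma val_fixpoint:
  assumes "0 < al" "y \<le> 2"
  shows "val al x y = relocate (\<lambda>x y. bsum (val al) x y / (al + Lam)) x y"
proof (rule LIMSEQ_unique)
  show "(\<lambda>n. viter al (Suc n) x y) \<longlonglongrightarrow> val al x y"
    using viter_val(1)[OF assms] by (rule LIMSEQ_Suc)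
  show "(\<lambda>n. viter al (Suc n) x y) \<longlonglongrightarrow> relocate (\<lambda>x y. bsum (val al) x y / (al + Lam)) x y"
    unfolding viter.simps using assms Lam_pos
    by (intro tendsto_relocate tendsto_intros tendsto_bsum viter_val) auto
qed

lemma regular_val: "0 < al \<Longrightarrow> regular (val al)"
  using regular_LIMSEQ[of "viter al" "val al"] viter_val(1) regular_viter by blast

lemma val_swap: "0 < al \<Longrightarrow> swap_le (val al)"
  using swap_le_relocate[of "\<lambda>x y. bsum (val al) x y / (al + Lam)"]
  unfolding swap_le_def by (simp add: val_fixpoint[symmetric])

lemma regular_bsum_val: "0 < al \<Longrightarrow> regular (\<lambda>x y. bsum (val al) x y / (al + Lam))"
  using lam mu2 mu12 Lam_pos by (intro regular_divide regular_bellman_sum regular_val val_swap) auto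

end

section \<open>Threshold rules\<close>

definition slow_rule :: "enat \<Rightarrow> enat \<Rightarrow> nat \<Rightarrow> nat \<Rightarrow> nat" where
  "slow_rule qL qH q y =
     (if q = 0 then 0
      else if y = 0 then (if enat q < qL then 0 else if enat q < qH then 1 else min 2 q)
      else if y = 1 then (if enat q \<ge> qH - 1 then 1 else 0)
      else 0)"

fun threshold_rule :: "enat \<Rightarrow> enat \<Rightarrow> state \<Rightarrow> nat \<times> nat" where
  "threshold_rule qL qH (n, z, y) =
     (let a = (if z = 0 \<and> n \<ge> 1 then 1 else 0) in (a, slow_rule qL qH (n - a) y))"

lemma threshold_structure_rule:
  assumes "qL \<le> qH"
  shows "threshold_structure (threshold_rule qL qH) qL qH"
proof -
  have "let (a, b) = threshold_rule qL qH (n, z, y); q = n - a in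
          (z = 0 \<and> n \<ge> 1 \<longrightarrow> a = 1) \<and>
          (y = 0 \<and> q \<ge> 1 \<longrightarrow>
             b = (if enat q < qL then 0 else if enat q < qH then 1 else min 2 q)) \<and>
          (y = 1 \<and> q \<ge> 1 \<longrightarrow> b = (if enat q \<ge> qH - 1 then 1 else 0))" for n z y
  proof -
    define a where "a = (if z = 0 \<and> n \<ge> 1 then 1 else 0 :: nat)"
    have rule: "threshold_rule qL qH (n, z, y) = (a, slow_rule qL qH (n - a) y)"
      by (simp add: a_def)
    have "y = 0 \<and> n - a \<ge> 1 \<longrightarrow> slow_rule qL qH (n - a) y
        = (if enat (n - a) < qL then 0 else if enat (n - a) < qH then 1 else min 2 (n - a))"
      "y = 1 \<and> n - a \<ge> 1 \<longrightarrow> slow_rule qL qH (n - a) y = (if enat (n - a) \<ge> qH - 1 then 1 else 0)"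
      by (simp_all add: slow_rule_def)
    then show ?thesis
      unfolding rule Let_def prod.case by (simp add: a_def)
  qed
  then show ?thesis
    using assms unfolding threshold_structure_def by blast
qed

lemma slow_rule_le: "slow_rule qL qH q y \<le> q" "y \<le> 2 \<Longrightarrow> y + slow_rule qL qH q y \<le> 2"
  by (auto simp: slow_rule_def)

lemma threshold_rule_feasible: "s \<in> states \<Longrightarrow> threshold_rule qL qH s \<in> feasible s"
proof (cases s)
  case (fields n z y)
  assume "s \<in> states"
  then have "y \<le> 2" "z = 0 \<or> z = 1" by (auto simp: fields states_def)
  moreover define m where "m = slow_rule qL qH (if z = 0 \<and> n \<ge> 1 then n - 1 else n) y"
  moreover have "threshold_rule qL qH s = (if z = 0 \<and> n \<ge> 1 then 1 else 0, m)"
    by (simp add: fields m_def Let_def)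
  ultimately show ?thesis
    using slow_rule_le(1)[of qL qH "if z = 0 \<and> n \<ge> 1 then n - 1 else n" y]
      slow_rule_le(2)[of y qL qH "if z = 0 \<and> n \<ge> 1 then n - 1 else n"]
    by (auto simp: fields simp del: threshold_rule.simps split: if_splits)
qed

definition first_from_1 :: "(nat \<Rightarrow> bool) \<Rightarrow> enat" where
  "first_from_1 P = (if \<exists>q\<ge>1. P q then enat (LEAST q. q \<ge> 1 \<and> P q) else \<infinity>)"

lemma first_from_1_le_iff:
  assumes up: "\<And>q. q \<ge> 1 \<Longrightarrow> P q \<Longrightarrow> P (Suc q)" and "q \<ge> 1"
  shows "first_from_1 P \<le> enat q \<longleftrightarrow> P q"
proof
  assume l: "first_from_1 P \<le> enat q"
  then have ex: "\<exists>q\<ge>1. P q"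
    by (auto simp: first_from_1_def split: if_splits)
  define k where "k = (LEAST q. q \<ge> 1 \<and> P q)"
  have k: "k \<ge> 1 \<and> P k"
    unfolding k_def by (rule LeastI_ex) (rule ex)
  have "k \<le> q"
    using l ex by (simp add: first_from_1_def k_def)
  then show "P q"
  proof (induction rule: dec_induct)
    case base
    show ?case using k by blast
  next
    case (step m)
    show ?case by (rule up) (use step k in auto)
  qed
next
  assume "P q"
  then show "first_from_1 P \<le> enat q"
    using assms(2) by (auto simp: first_from_1_def intro!: Least_le)
qed

lemma first_from_1_ge_1: "1 \<le> first_from_1 P"
proof (cases "\<exists>q\<ge>1. P q")
  case True
  then have "(LEAST q. q \<ge> 1 \<and> P q) \<ge> 1"
    by (rule LeastI2_ex) auto
  then show ?thesis using True by (simp add: first_from_1_def one_enat_def)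
qed (auto simp: first_from_1_def)

text \<open>With the fast server busy and \<open>q\<close> jobs queued, \<open>P0 q\<close> says
  that a move to two idle slow servers pays, \<open>P1 q\<close> that a move to the last idle one
  pays. Both persist as \<open>q\<close> grows, by monotonicity of the gain, which makes the rule a
  threshold rule.\<close>

lemma threshold_rule_minimises:
  assumes w: "regular w"
  obtains qL qH where "qL \<le> qH"
    "\<And>n z y. (n, z, y) \<in> states \<Longrightarrow>
       relocate w (n + z) y = w (n + z - snd (threshold_rule qL qH (n, z, y))) (y + snd (threshold_rule qL qH (n, z, y)))"
proof -
  define P0 P1 where "P0 q \<longleftrightarrow> w q 1 < w (Suc q) 0" and "P1 q \<longleftrightarrow> w q 2 < w (Suc q) 1" for q
  \<comment> \<open>The second of two moves finds one job less in the queue, so it pays at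
    \<open>q\<close> iff \<open>P1 (q - 1)\<close>. This is the offset between the thresholds for
    two idle slow servers and for one.\<close>
  define qL qH where "qL = first_from_1 P0" and "qH = first_from_1 P1 + 1"
  have P0: "qL \<le> enat q \<longleftrightarrow> P0 q" if "q \<ge> 1" for q
    unfolding qL_def
  proof (rule first_from_1_le_iff[OF _ that])
    show "P0 (Suc q)" if "P0 q" for q
      using regularD(8)[OF w, of q] that by (simp add: P0_def)
  qed
  have P1: "first_from_1 P1 \<le> enat q \<longleftrightarrow> P1 q" if "q \<ge> 1" for q
  proof (rule first_from_1_le_iff[OF _ that])
    show "P1 (Suc q)" if "P1 q" for q
      using regularD(9)[OF w, of q] that by (simp add: P1_def)
  qed
  have qH1: "qH - 1 = first_from_1 P1"
    unfolding qH_def by (cases "first_from_1 P1") (auto simp: one_enat_def)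
  have qH: "qH \<le> enat (Suc q) \<longleftrightarrow> q \<ge> 1 \<and> P1 q" for q
  proof (cases "q \<ge> 1")
    case True
    have "qH \<le> enat (Suc q) \<longleftrightarrow> first_from_1 P1 \<le> enat q"
      unfolding qH_def by (cases "first_from_1 P1") (auto simp: one_enat_def)
    then show ?thesis using P1[OF True] True by simp
  next
    case False
    then show ?thesis
      using first_from_1_ge_1[of P1] unfolding qH_def
      by (cases "first_from_1 P1") (auto simp: one_enat_def)
  qed
  \<comment> \<open>The bound on second moves: if the second move pays, so does the first. This
    orders the thresholds.\<close>
  have P10: "P0 (Suc q)" if "P1 q" for q
    using regularD(10)[OF w, of q] that by (simp add: P0_def P1_def)
  have "qL \<le> qH"
  proof (cases "first_from_1 P1")
    case (enat k)
    then have "k \<ge> 1" using first_from_1_ge_1[of P1] by (simp add: one_enat_def)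
    then have "P0 (Suc k)" using P1[of k] enat P10 by simp
    then have "qL \<le> enat (Suc k)" using P0[of "Suc k"] by simp
    then show ?thesis using enat by (simp add: qH_def one_enat_def Suc_eq_plus1)
  qed (simp add: qH_def)
  moreover have "relocate w (n + z) y = w (n + z - snd (threshold_rule qL qH (n, z, y))) (y + snd (threshold_rule qL qH (n, z, y)))"
    if "(n, z, y) \<in> states" for n z y
  proof -
    define q where "q = n - (if z = 0 \<and> n \<ge> 1 then 1 else 0)"
    have b: "snd (threshold_rule qL qH (n, z, y)) = slow_rule qL qH q y"
      by (simp add: q_def Let_def)
    have y: "y = 0 \<or> y = 1 \<or> y = 2" and z: "z = 0 \<or> z = 1" using that by (auto simp: states_def)
    show ?thesis
    proof (cases q)
      \<comment> \<open>An empty queue leaves at most one lumped job, the one at the fast server.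
        The relaxation could withdraw it; the last two inequalities of \<open>regular\<close> say
        that this does not help.\<close>
      case 0
      then have "n + z = 0 \<or> n + z = Suc 0" using z by (auto simp: q_def split: if_splits)
      then have "relocate w (n + z) y = w (n + z) y"
        using y regularD(12,13)[OF w] by (auto simp: relocate_0 relocate_1 relocate_2)
      then show ?thesis unfolding b using 0 by (simp add: slow_rule_def)
    next
      case (Suc p)
      then have x: "n + z = Suc (Suc p)" using z by (auto simp: q_def split: if_splits)
      have "relocate w (Suc (Suc p)) y = w (Suc (Suc p) - slow_rule qL qH (Suc p) y) (y + slow_rule qL qH (Suc p) y)"
        using y
      proof (elim disjE)
        assume y: "y = 0"
        \<comment> \<open>With a single queued job, a second move would withdraw the job at the fast
          server.\<close>
        have "p = 0 \<Longrightarrow> w (Suc p) 1 \<le> w p 2" using regularD(13)[OF w] by simp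
        then show ?thesis
          using P0[of "Suc p"] qH[of p] P10[of p]
          by (cases p) (auto simp: y relocate_0(2) slow_rule_def P0_def P1_def min_def)
      next
        assume "y = 1"
        then show ?thesis
          using P1[of "Suc p"] by (auto simp: relocate_1 slow_rule_def qH1 P1_def min_def)
      next
        assume "y = 2"
        then show ?thesis by (auto simp: relocate_2 slow_rule_def)
      qed
      then show ?thesis unfolding b using x Suc by simp
    qed
  qed
  ultimately show thesis using that by blast
qed

declare One_nat_def [simp]

section \<open>The chain on actual states, without fictitious events\<close>

fun out_rate :: "real \<Rightarrow> real \<Rightarrow> real \<Rightarrow> state \<Rightarrow> real" where
  "out_rate lam mu1 mu2 (q, z, y) = lam + real z * mu1 + real y * mu2"

fun next_sum :: "real \<Rightarrow> real \<Rightarrow> real \<Rightarrow> (state \<Rightarrow> real) \<Rightarrow> state \<Rightarrow> real" where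
  "next_sum lam mu1 mu2 f (q, z, y) =
     lam * f (Suc q, z, y) + real z * mu1 * f (q, z - 1, y) + real y * mu2 * f (q, z, y - 1)"

fun lift_state :: "(nat \<Rightarrow> nat \<Rightarrow> real) \<Rightarrow> state \<Rightarrow> real" where
  "lift_state v (q, z, y) = v (q + z) y"

fun decide :: "state \<Rightarrow> nat \<times> nat \<Rightarrow> state" where
  "decide (q, z, y) (a, b) = (q - (a + b), z + a, y + b)"

lemma states_iff: "(q, z, y) \<in> states \<longleftrightarrow> z \<le> 1 \<and> y \<le> 2"
  by (auto simp: states_def le_Suc_eq numeral_2_eq_2)

lemma decide_states: "s \<in> states \<Longrightarrow> p \<in> feasible s \<Longrightarrow> decide s p \<in> states"
  by (cases s; cases p) (simp add: states_iff)

context rates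
begin

lemma bsum_fast_busy:
  "y \<le> 2 \<Longrightarrow> bsum v (Suc q) y = real (jobs (q, 1, y)) + next_sum lam mu1 mu2 (lift_state v) (q, 1, y)
     + (2 - real y) * mu2 * v (Suc q) y"
  by (simp add: bellman_sum_def algebra_simps)

text \<open>The term with \<open>mu1\<close> is outside \<open>next_sum\<close>: for
  \<open>q > 0\<close> it is a service that the relaxation grants to an idle fast server.\<close>

lemma bsum_fast_idle:
  "y \<le> 2 \<Longrightarrow> bsum v q y = real (jobs (q, 0, y)) + next_sum lam mu1 mu2 (lift_state v) (q, 0, y)
     + mu1 * v (q - 1) y + (2 - real y) * mu2 * v q y"
  by (simp add: bellman_sum_def algebra_simps)

text \<open>One step of the relaxation is at most one step of the actual system under any feasible
  decision. Each fictitious event continues with at most \<open>u\<close>, the relaxed value at the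
  post-decision state, because \<open>viter\<close> increases with \<open>n\<close>; for services
  granted to the idle fast server monotonicity in \<open>x\<close> is used too. So fictitious events
  can be cancelled together with their rates.\<close>

lemma viter_le_decide:
  assumes al: "0 < al" and s: "s \<in> states" "p \<in> feasible s"
  shows "(al + out_rate lam mu1 mu2 (decide s p)) * lift_state (viter al (Suc n)) s
    \<le> real (jobs (decide s p)) + next_sum lam mu1 mu2 (lift_state (viter al n)) (decide s p)"
proof -
  obtain q z y a b where sp: "s = (q, z, y)" "p = (a, b)"
    by (metis surj_pair)
  define q' z' y' where post: "q' = q - (a + b)" "z' = z + a" "y' = y + b"
  have f: "z + a \<le> 1" "y + b \<le> 2" "a + b \<le> q"
    using s by (auto simp: sp)
  have d: "decide s p = (q', z', y')"
    by (simp add: sp post)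
  have x': "q' + z' = q + z - b" and y': "y' \<le> 2"
    using f by (auto simp: post)
  define u where "u = viter al (Suc n) (q' + z') y'"
  have "lift_state (viter al (Suc n)) s \<le> u"
    unfolding u_def sp lift_state.simps viter.simps x' post(3)
    using f by (intro relocate_le_relocate) auto
  then have 1: "(al + out_rate lam mu1 mu2 (q', z', y')) * lift_state (viter al (Suc n)) s
      \<le> (al + out_rate lam mu1 mu2 (q', z', y')) * u"
    using al lam mu1 mu2 by (intro mult_left_mono) auto
  have "u \<le> bsum (viter al n) (q' + z') y' / (al + Lam)"
    unfolding u_def viter.simps by (rule relocate_le_self)
  then have 2: "(al + Lam) * u \<le> bsum (viter al n) (q' + z') y'"
    using al Lam_pos by (simp add: pos_le_divide_eq mult.commute)
  have inc: "viter al n (q' + z') y' \<le> u"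
    unfolding u_def using al y' by (rule viter_incr)
  then have 3: "(2 - real y') * mu2 * viter al n (q' + z') y' \<le> (2 - real y') * mu2 * u"
    using mu2 y' by (intro mult_left_mono) auto
  have "z' = 0 \<or> z' = 1"
    using f post by auto
  then have "(al + out_rate lam mu1 mu2 (q', z', y')) * u
      \<le> real (jobs (q', z', y')) + next_sum lam mu1 mu2 (lift_state (viter al n)) (q', z', y')"
  proof
    assume z: "z' = 0"
    have "viter al n (q' - 1) y' \<le> viter al n q' y'"
      using regular_mono_x[of "viter al n" y' "q' - 1"] regular_viter[OF al, of n] y' by (cases q') (auto simp: One_nat_def)
    then have "mu1 * viter al n (q' - 1) y' \<le> mu1 * u"
      using inc mu1 z by (intro mult_left_mono) auto
    then show ?thesis
      using 2 3 unfolding z bsum_fast_idle[OF y', where q="q'" and v="viter al n"] add_0_right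
      by (simp add: Lam_def algebra_simps)
  next
    assume z: "z' = 1"
    then show ?thesis
      using 2 3 bsum_fast_busy[OF y', where q="q'" and v="viter al n"]
      by (simp add: Lam_def algebra_simps)
  qed
  with 1 show ?thesis
    unfolding d by linarith
qed

text \<open>Shared by both criteria: \<open>rho = 0\<close> for discounting and
  \<open>al = 0\<close> for the average cost. The relaxed equation becomes the actual one because
  fictitious events leave the value unchanged under the rule.\<close>

lemma threshold_rule_Bellman:
  assumes v: "\<And>x y. y \<le> 2 \<Longrightarrow> v x y = relocate w x y"
    and w: "\<And>x y. y \<le> 2 \<Longrightarrow> (al + Lam) * w x y + rho = bsum v x y"
    and d: "\<And>n z y. (n, z, y) \<in> states \<Longrightarrow>
       relocate w (n + z) y = w (n + z - snd (threshold_rule qL qH (n, z, y))) (y + snd (threshold_rule qL qH (n, z, y)))"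
    and s: "s \<in> states"
  shows "real (jobs (decide s (threshold_rule qL qH s)))
      + next_sum lam mu1 mu2 (lift_state v) (decide s (threshold_rule qL qH s))
    = (al + out_rate lam mu1 mu2 (decide s (threshold_rule qL qH s))) * lift_state v s + rho"
proof -
  obtain q z y where sp: "s = (q, z, y)"
    by (metis surj_pair)
  define a where "a = (if z = 0 \<and> q \<ge> 1 then 1 else 0 :: nat)"
  define b where "b = slow_rule qL qH (q - a) y"
  have rule: "threshold_rule qL qH (q, z, y) = (a, b)"
    by (simp add: a_def b_def)
  define q' z' y' where post: "q' = q - (a + b)" "z' = z + a" "y' = y + b"
  have "(a, b) \<in> feasible s"
    using threshold_rule_feasible[OF s, of qL qH] by (simp only: sp rule)
  then have f: "z + a \<le> 1" "y + b \<le> 2" "a + b \<le> q"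
    by (auto simp: sp)
  have D: "decide s (threshold_rule qL qH s) = (q', z', y')"
    by (simp add: sp rule post del: threshold_rule.simps)
  have x': "q' + z' = q + z - b" and y': "y' \<le> 2" and y: "y \<le> 2"
    using f by (auto simp: post)
  have vw: "v (q + z) y = w (q' + z') y'"
    using d[of q z y] s v[OF y, of "q + z"] unfolding x' post(3) by (simp add: sp rule del: threshold_rule.simps)
  \<comment> \<open>The chosen post-decision state is itself a minimiser, so a further decision at a
    fictitious event there would gain nothing.\<close>
  have "relocate w (q + z) y \<le> relocate w (q' + z') y'"
    unfolding x' post(3) using f by (intro relocate_le_relocate) auto
  then have "w (q' + z') y' \<le> v (q' + z') y'"
    using vw v[OF y, of "q + z"] v[OF y', of "q' + z'"] by simp
  moreover have "v (q' + z') y' \<le> w (q' + z') y'"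
    using v[OF y', of "q' + z'"] relocate_le_self[of w "q' + z'" y'] by simp
  ultimately have v': "v (q' + z') y' = w (q' + z') y'"
    by simp
  \<comment> \<open>Since the rule idles the fast server only with an empty queue, its fictitious
    service is the harmless truncation at 0.\<close>
  consider "z' = 1" | "z' = 0" "q' = 0"
    using f s unfolding post by (cases "z = 0 \<and> q \<ge> 1") (auto simp: a_def sp states_def)
  then have "real (jobs (q', z', y')) + next_sum lam mu1 mu2 (lift_state v) (q', z', y')
      = (al + out_rate lam mu1 mu2 (q', z', y')) * w (q' + z') y' + rho"
  proof cases
    case 1
    then show ?thesis
      using w[OF y', of "q' + z'"] v' bsum_fast_busy[OF y', where q="q'" and v=v]
      by (simp add: Lam_def algebra_simps)
  next
    case 2
    then show ?thesis
      using w[OF y', of "q' + z'"] v' bsum_fast_idle[OF y', where q=0 and v=v]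
      by (simp add: Lam_def algebra_simps)
  qed
  then show ?thesis
    unfolding D using vw by (simp add: sp)
qed

end

section \<open>Vanishing discount\<close>

context rates
begin

text \<open>If the jobs are always packed into the slow servers first, the total number of jobs is a
  birth-death chain. \<open>descent n\<close> is the expected holding cost until it first drops
  from \<open>n\<close> to \<open>n - 1\<close>.\<close>

definition descent3 :: "nat \<Rightarrow> real" where
  "descent3 n = real n / (mu1 + 2 * mu2 - lam) + lam / (mu1 + 2 * mu2 - lam)\<^sup>2"

definition descent :: "nat \<Rightarrow> real" where
  "descent n =
    (let d2 = (2 + lam * descent3 3) / (2 * mu2)
     in if n \<ge> 3 then descent3 n else if n = 2 then d2 else (1 + lam * d2) / mu2)"

text \<open>Expected holding cost until the packed system first becomes empty.\<close>

definition passage :: "nat \<Rightarrow> real" where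
  "passage n = (\<Sum>i<n. descent (Suc i))"

text \<open>First-step equations with death rates \<open>mu2\<close>, \<open>2 * mu2\<close> and,
  from three jobs on, \<open>mu1 + 2 * mu2\<close>; a birth at \<open>n\<close> adds a descent from
  \<open>Suc n\<close>. An affine ansatz solves them for \<open>n \<ge> 3\<close>, with the positive
  drift \<open>mu1 + 2 * mu2 - lam\<close> in the denominators; the two low levels follow
  downwards.\<close>

lemma descent_eqs:
  assumes "lam < mu1 + 2 * mu2"
  shows "mu2 * descent 1 = 1 + lam * descent 2"
    "2 * mu2 * descent 2 = 2 + lam * descent 3"
    "n \<ge> 3 \<Longrightarrow> (mu1 + 2 * mu2) * descent n = real n + lam * descent (Suc n)"
    "0 \<le> descent n"
proof -
  have D: "mu1 + 2 * mu2 - lam > 0" using assms by simp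
  show "mu2 * descent 1 = 1 + lam * descent 2" "2 * mu2 * descent 2 = 2 + lam * descent 3"
    using mu2 by (simp_all add: descent_def)
  have "0 \<le> descent3 n" for n
    unfolding descent3_def using D lam by (intro add_nonneg_nonneg divide_nonneg_nonneg) auto
  then show "0 \<le> descent n"
    using lam mu2 by (auto simp: descent_def Let_def intro!: divide_nonneg_nonneg add_nonneg_nonneg)
  define E where "E = mu1 + 2 * mu2 - lam"
  have "(E + lam) * (real n / E + lam / E\<^sup>2) = real n + lam * (real (Suc n) / E + lam / E\<^sup>2)"
  proof -
    have "E > 0" using D by (simp add: E_def)
    then show ?thesis by (simp add: field_simps power2_eq_square)
  qed
  then show "(mu1 + 2 * mu2) * descent n = real n + lam * descent (Suc n)" if "n \<ge> 3"
    using that by (simp add: descent_def descent3_def E_def)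
qed

lemma passage_simps: "passage 0 = 0" "passage (Suc n) = passage n + descent (Suc n)"
  by (simp_all add: passage_def)

lemma passage_nonneg: "lam < mu1 + 2 * mu2 \<Longrightarrow> 0 \<le> passage n"
  unfolding passage_def by (intro sum_nonneg descent_eqs)

text \<open>Empty the system, then continue optimally from the origin. The comparison function
  \<open>c + passage\<close> solves the undiscounted equation of the packing policy exactly, and
  discounting only helps since it is nonnegative.\<close>

lemma val_le_passage:
  assumes al: "0 < al" and stable: "lam < mu1 + 2 * mu2" and "y \<le> 2"
  shows "val al x y \<le> val al 0 0 + passage (x + y)"
proof -
  have "viter al n x y \<le> val al 0 0 + passage (x + y)" if "y \<le> 2" for n x y
    using that
  proof (induction n arbitrary: x y)
    case 0
    then show ?case using val_nonneg[OF al, of 0 0] passage_nonneg[OF stable] by simp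
  next
    case (Suc n)
    show ?case
    proof (cases "x + y = 0")
      case True
      then show ?thesis using viter_val(2)[OF al, of 0 "Suc n" 0] by (simp add: passage_simps del: viter.simps)
    next
      case False
      \<comment> \<open>Fill the slow servers as far as possible, even by withdrawing the job at the
        fast server, so that the total number of jobs alone determines the rates.\<close>
      define b where "b = min x (2 - y)"
      define x' y' where "x' = x - b" and "y' = y + b"
      define c where "c = val al 0 0"
      have b: "b \<le> x" "y + b \<le> 2" using Suc.prems by (auto simp: b_def)
      have xy: "x' + y' = x + y" "y' \<le> 2" using b by (auto simp: x'_def y'_def)
      have "viter al (Suc n) x y \<le> bsum (viter al n) x' y' / (al + Lam)"
        unfolding viter.simps x'_def y'_def by (rule relocate_le_move[OF b])
      also have "\<dots> \<le> bsum (\<lambda>x y. c + passage (x + y)) x' y' / (al + Lam)"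
        using al Lam_pos Suc.IH xy by (intro divide_right_mono bsum_mono) (auto simp: c_def)
      also have "bsum (\<lambda>x y. c + passage (x + y)) x' y' = Lam * (c + passage (x' + y'))"
      proof -
        consider "x' = 0" "y' = 1" | "x' = 0" "y' = 2" | m where "x' = Suc m" "y' = 2"
        proof (cases "x \<le> 2 - y")
          case True
          then have "x' = 0" "y' = y + x" by (auto simp: x'_def y'_def b_def)
          moreover have "y + x = 1 \<or> y + x = 2" using True False Suc.prems by linarith
          ultimately show thesis using that by auto
        next
          case False
          then have "x' = Suc (x - (2 - y) - 1)" "y' = 2" using Suc.prems by (auto simp: x'_def y'_def b_def)
          then show thesis using that by blast
        qed
        then show ?thesis
        proof cases
          case 1
          then show ?thesis
            unfolding bsum_affine[OF xy(2)]
            using descent_eqs(1)[OF stable] by (simp add: passage_simps Lam_def algebra_simps numeral_2_eq_2)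
        next
          case 2
          then show ?thesis
            unfolding bsum_affine[OF xy(2)]
            using descent_eqs(2)[OF stable]
            by (simp add: passage_simps Lam_def algebra_simps numeral_2_eq_2 numeral_3_eq_3)
        next
          case (3 m)
          then show ?thesis
            unfolding bsum_affine[OF xy(2)]
            using descent_eqs(3)[OF stable, of "Suc (m + 2)"]
            by (simp add: passage_simps Lam_def algebra_simps)
        qed
      qed
      also have "\<dots> / (al + Lam) \<le> c + passage (x' + y')"
        using al Lam_pos val_nonneg[OF al, of 0 0] passage_nonneg[OF stable, of "x' + y'"]
        by (subst pos_divide_le_eq) (auto simp: c_def algebra_simps)
      finally show ?thesis
        unfolding xy c_def .
    qed
  qed
  then show ?thesis
    using viter_val(1)[OF al \<open>y \<le> 2\<close>, of x] \<open>y \<le> 2\<close> by (intro LIMSEQ_le_const2[where X="\<lambda>n. viter al n x y"]) auto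
qed

text \<open>At the origin there is no holding cost and only an arrival changes the state, so the
  fixed-point equation reduces to
  \<open>al * val al 0 0 = lam * (val al 1 0 - val al 0 0)\<close>.\<close>

lemma al_val_le:
  assumes al: "0 < al" and stable: "lam < mu1 + 2 * mu2"
  shows "al * val al 0 0 \<le> lam * passage 1"
proof -
  have "(al + Lam) * val al 0 0 = bsum (val al) 0 0"
    using val_fixpoint[OF al, of 0 0] al Lam_pos by (simp add: field_simps)
  also have "\<dots> = lam * val al 1 0 + mu1 * val al 0 0 + 2 * mu2 * val al 0 0"
    by (simp add: bellman_sum_def)
  finally have "al * val al 0 0 = lam * (val al 1 0 - val al 0 0)"
    by (simp add: Lam_def algebra_simps)
  also have "\<dots> \<le> lam * passage 1"
    using val_le_passage[OF al stable, of 0 1] lam by (intro mult_left_mono) auto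
  finally show ?thesis .
qed

text \<open>Gives the average-cost equation in two functions: \<open>h\<close> before and
  \<open>w\<close> after the decision. Regularity is claimed for \<open>w\<close>, because the
  threshold rule is read off from it.\<close>

lemma vanishing_discount:
  assumes stable: "lam < mu1 + 2 * mu2"
  obtains h w rho al where "regular w" "\<And>k. 0 < al k" "al \<longlonglongrightarrow> 0" "0 \<le> rho"
    "(\<lambda>k::nat. al k * val (al k) 0 0) \<longlonglongrightarrow> rho"
    "\<And>x y. y \<le> 2 \<Longrightarrow> 0 \<le> h x y"
    "\<And>x y. y \<le> 2 \<Longrightarrow> h x y = relocate w x y"
    "\<And>x y. y \<le> 2 \<Longrightarrow> Lam * w x y + rho = bsum h x y"
proof -
  define a0 :: "nat \<Rightarrow> real" where "a0 k = inverse (real (Suc k))" for k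
  have a0: "0 < a0 k" for k by (simp add: a0_def)
  \<comment> \<open>Index 0 carries the candidate for the average cost, the others the relative
    values of the pairs; the value 0 for \<open>y > 2\<close> merely keeps all coordinates
    bounded.\<close>
  define F where "F k m = (case m of 0 \<Rightarrow> a0 k * val (a0 k) 0 0
      | Suc j \<Rightarrow> (case prod_decode j of (x, y) \<Rightarrow> if y \<le> 2 then val (a0 k) x y - val (a0 k) 0 0 else 0))" for k m
  have "bounded (range (\<lambda>k. F k m))" for m
  proof (cases m)
    case 0
    have "norm (F k m) \<le> lam * passage 1" for k
      using al_val_le[OF a0 stable, of k] val_nonneg[OF a0, of 0 k 0] a0[of k] by (simp add: F_def 0)
    then show ?thesis by (intro boundedI) blast
  next
    case (Suc j)
    obtain x y where j: "prod_decode j = (x, y)" by force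
    have "norm (F k m) \<le> passage (x + y)" for k
      using val_le_passage[OF a0 stable, of y k x] regular_ge_origin[OF regular_val[OF a0], of y k x]
        passage_nonneg[OF stable, of "x + y"] by (cases "y \<le> 2") (simp_all add: F_def Suc j)
    then show ?thesis by (intro boundedI) blast
  qed
  then obtain r where r: "strict_mono r" "\<And>m. convergent (\<lambda>k. F (r k) m)"
    using diagonal_convergent[of F] by blast
  define al where "al = a0 \<circ> r"
  have al: "0 < al k" for k using a0 by (simp add: al_def)
  have "a0 \<longlonglongrightarrow> 0" unfolding a0_def by (rule LIMSEQ_inverse_real_of_nat)
  then have al0: "al \<longlonglongrightarrow> 0" unfolding al_def by (rule LIMSEQ_subseq_LIMSEQ[OF _ r(1)])
  define rho where "rho = lim (\<lambda>k. F (r k) 0)"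
  have rho: "(\<lambda>k. al k * val (al k) 0 0) \<longlonglongrightarrow> rho"
    using r(2)[of 0] unfolding convergent_LIMSEQ_iff rho_def[symmetric] by (simp add: F_def al_def)
  define H where "H k x y = val (al k) x y - val (al k) 0 0" for k x y
  define h where "h x y = lim (\<lambda>k. F (r k) (Suc (prod_encode (x, y))))" for x y
  have h: "(\<lambda>k. H k x y) \<longlonglongrightarrow> h x y" if "y \<le> 2" for x y
    using r(2)[of "Suc (prod_encode (x, y))"] that
    unfolding convergent_LIMSEQ_iff h_def[symmetric] by (simp add: F_def al_def H_def)
  define w where "w x y = (bsum h x y - rho) / Lam" for x y
  \<comment> \<open>A constant shift of a regular function. The identity below rewrites it by
    \<open>H k\<close> and \<open>al k * val (al k) 0 0\<close>, which converge although
    \<open>val (al k) 0 0\<close> itself need not.\<close>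
  define W where "W k x y = bsum (val (al k)) x y / (al k + Lam) + (- val (al k) 0 0)" for k x y
  have W: "W k x y = (bsum (H k) x y - al k * val (al k) 0 0) / (al k + Lam)" for k x y
  proof -
    have "al k + Lam \<noteq> 0" using al[of k] Lam_pos by simp
    moreover have "bsum (H k) x y = bsum (val (al k)) x y - Lam * val (al k) 0 0"
      by (simp add: H_def bellman_sum_def Lam_def algebra_simps)
    ultimately show ?thesis by (simp add: W_def field_simps)
  qed
  have "(\<lambda>k. W k x y) \<longlonglongrightarrow> (bsum h x y - rho) / (0 + Lam)" if "y \<le> 2" for x y
    unfolding W using that Lam_pos by (intro tendsto_intros tendsto_bsum h rho al0) auto
  then have Ww: "(\<lambda>k. W k x y) \<longlonglongrightarrow> w x y" if "y \<le> 2" for x y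
    using that by (simp add: w_def)
  have regW: "regular (W k)" for k
    unfolding W_def by (intro regular_add regular_bsum_val al)
  show thesis
  proof
    show "regular w" by (rule regular_LIMSEQ[OF Ww regW])
    show "0 < al k" for k by (rule al)
    show "al \<longlonglongrightarrow> 0" "(\<lambda>k. al k * val (al k) 0 0) \<longlonglongrightarrow> rho" by fact+
    show "0 \<le> rho"
    proof (rule LIMSEQ_le_const[OF rho], intro exI allI impI)
      show "0 \<le> al k * val (al k) 0 0" for k
        by (intro mult_nonneg_nonneg val_nonneg al less_imp_le[OF al]) simp
    qed
    fix x y :: nat assume y: "y \<le> 2"
    show "0 \<le> h x y"
      by (rule LIMSEQ_le_const[OF h[OF y]])
        (use regular_ge_origin[OF regular_val[OF al] y] in \<open>auto simp: H_def\<close>)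
    show "Lam * w x y + rho = bsum h x y"
      using Lam_pos by (simp add: w_def)
    show "h x y = relocate w x y"
    proof (rule LIMSEQ_unique[OF h[OF y]])
      have "H k x y = relocate (W k) x y" for k
        unfolding H_def W_def relocate_add using val_fixpoint[OF al y] by simp
      then show "(\<lambda>k. H k x y) \<longlonglongrightarrow> relocate w x y"
        using tendsto_relocate[OF Ww y] by simp
    qed
  qed
qed

end

section \<open>Independent exponential clocks\<close>

abbreviation Expo :: "real \<Rightarrow> real measure" where
  "Expo r \<equiv> density lborel (\<lambda>x. ennreal (exponential_density r x))"

lemma nn_integral_Expo:
  assumes [measurable]: "f \<in> borel_measurable borel" and "0 < r"
  shows "(\<integral>\<^sup>+ x. f x \<partial>Expo r) = (\<integral>\<^sup>+ x\<in>{0..}. ennreal (r * exp (- r * x)) * f x \<partial>lborel)"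
  by (subst nn_integral_density)
    (auto intro!: nn_integral_cong simp: exponential_density_def indicator_def mult.commute)

text \<open>Memorylessness of a single clock: the density at \<open>x + y\<close> is
  \<open>exp (- r * x)\<close> times the density at \<open>y\<close>.\<close>

lemma nn_integral_Expo_shift:
  assumes [measurable]: "f \<in> borel_measurable borel" and r: "0 < r" and x: "0 \<le> x"
  shows "(\<integral>\<^sup>+ y. indicator {x<..} y * f y \<partial>Expo r) = ennreal (exp (- r * x)) * (\<integral>\<^sup>+ y. f (y + x) \<partial>Expo r)"
proof -
  have "(\<integral>\<^sup>+ y. indicator {x<..} y * f y \<partial>Expo r)
      = (\<integral>\<^sup>+ y. ennreal (r * exp (- r * y)) * (indicator {x<..} y * f y) * indicator {0..} y \<partial>lborel)"
    using r by (subst nn_integral_Expo) auto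
  also have "\<dots> = (\<integral>\<^sup>+ y. ennreal (r * exp (- r * (x + y))) * (indicator {x<..} (x + y) * f (x + y)) * indicator {0..} (x + y) \<partial>lborel)"
    by (subst nn_integral_real_affine[where c=1 and t=x]) auto
  also have "\<dots> = (\<integral>\<^sup>+ y. ennreal (exp (- r * x)) * (ennreal (r * exp (- r * y)) * f (y + x) * indicator {0..} y) \<partial>lborel)"
  \<comment> \<open>The two indicators differ at \<open>y = 0\<close>, a null set.\<close>
  proof (rule nn_integral_cong_AE, rule AE_mp[OF AE_lborel_singleton[of 0]], rule AE_I2, rule impI)
    fix y :: real assume "y \<noteq> 0"
    have "ennreal (r * exp (- r * (x + y))) = ennreal (exp (- r * x)) * ennreal (r * exp (- r * y))"
      using r by (subst ennreal_mult[symmetric]) (auto simp: exp_add[symmetric] algebra_simps)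
    then show "ennreal (r * exp (- r * (x + y))) * (indicator {x<..} (x + y) * f (x + y)) * indicator {0..} (x + y)
       = ennreal (exp (- r * x)) * (ennreal (r * exp (- r * y)) * f (y + x) * indicator {0..} y)"
      using \<open>y \<noteq> 0\<close> x by (auto simp: indicator_def ac_simps)
  qed
  also have "\<dots> = ennreal (exp (- r * x)) * (\<integral>\<^sup>+ y. f (y + x) \<partial>Expo r)"
    using r by (subst nn_integral_cmult) (auto simp: nn_integral_Expo)
  finally show ?thesis .
qed

locale exponential_clocks =
  fixes R :: "'i::countable \<Rightarrow> real"
  assumes R: "0 < R i"
begin

definition P :: "('i \<Rightarrow> real) measure" where
  "P = (\<Pi>\<^sub>M i\<in>UNIV. Expo (R i))"

lemma prob_space_P: "prob_space P"
  unfolding P_def using R by (intro prob_space_PiM prob_space_exponential_density)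

sublocale P: prob_space P
  by (rule prob_space_P)

lemma sets_P [measurable_cong]: "sets P = sets (\<Pi>\<^sub>M i\<in>UNIV. borel)"
  unfolding P_def by (intro sets_PiM_cong) auto

lemma space_P [simp]: "space P = UNIV"
  unfolding P_def by (simp add: space_PiM)

lemma measurable_coord [measurable]: "(\<lambda>\<xi>. \<xi> i) \<in> borel_measurable P"
  by (subst measurable_cong_sets[OF sets_P refl]) simp

lemma measurable_upd [measurable]: "(\<lambda>(y, \<xi>). \<xi>(i := y)) \<in> measurable (borel \<Otimes>\<^sub>M P) P"
proof -
  have "(\<lambda>x. (snd x)(i := fst x)) \<in> measurable (borel \<Otimes>\<^sub>M P) (\<Pi>\<^sub>M i\<in>UNIV. borel)"
    by (rule measurable_PiM_single') (auto simp: fun_upd_def)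
  then show ?thesis
    by (subst measurable_cong_sets[OF refl sets_P]) (simp add: case_prod_beta')
qed

text \<open>Redrawing one coordinate independently preserves the product law. This replaces
  conditioning: the inner integral concerns clock \<open>i\<close> with all others frozen.\<close>

lemma resample:
  assumes [measurable]: "f \<in> borel_measurable P"
  shows "(\<integral>\<^sup>+ \<xi>. f \<xi> \<partial>P) = (\<integral>\<^sup>+ \<xi>. (\<integral>\<^sup>+ y. f (\<xi>(i := y)) \<partial>Expo (R i)) \<partial>P)"
proof -
  interpret E: prob_space "Expo (R i)"
    by (rule prob_space_exponential_density[OF R])
  interpret EP: pair_sigma_finite "Expo (R i)" P ..
  have "P = distr (Expo (R i) \<Otimes>\<^sub>M P) P (\<lambda>(y, \<xi>). \<xi>(i := y))"
    using distr_pair_PiM_eq_PiM[of UNIV "\<lambda>i. Expo (R i)" i] R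
    by (simp add: P_def prob_space_exponential_density)
  then have "(\<integral>\<^sup>+ \<xi>. f \<xi> \<partial>P) = (\<integral>\<^sup>+ \<xi>. f \<xi> \<partial>distr (Expo (R i) \<Otimes>\<^sub>M P) P (\<lambda>(y, \<xi>). \<xi>(i := y)))"
    by simp
  also have "\<dots> = (\<integral>\<^sup>+ x. f (case x of (y, \<xi>) \<Rightarrow> \<xi>(i := y)) \<partial>(Expo (R i) \<Otimes>\<^sub>M P))"
    by (rule nn_integral_distr) measurable
  also have "\<dots> = (\<integral>\<^sup>+ \<xi>. (\<integral>\<^sup>+ y. f (\<xi>(i := y)) \<partial>Expo (R i)) \<partial>P)"
    by (subst EP.nn_integral_snd[symmetric]) auto
  finally show ?thesis .
qed

lemma shift_coord:
  assumes [measurable]: "f \<in> borel_measurable P" and x: "0 \<le> x"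
  shows "(\<integral>\<^sup>+ \<xi>. indicator {x<..} (\<xi> i) * f \<xi> \<partial>P) = ennreal (exp (- R i * x)) * (\<integral>\<^sup>+ \<xi>. f (\<xi>(i := \<xi> i + x)) \<partial>P)"
proof -
  have [measurable]: "(\<lambda>\<xi>. f (\<xi>(i := g \<xi>))) \<in> borel_measurable P" if [measurable]: "g \<in> borel_measurable P" for g
  proof -
    have "(\<lambda>\<xi>. f (case (g \<xi>, \<xi>) of (y, \<xi>) \<Rightarrow> \<xi>(i := y))) \<in> borel_measurable P"
      by measurable
    then show ?thesis by simp
  qed
  have m: "(\<lambda>y. f (\<xi>(i := y))) \<in> borel_measurable borel" for \<xi>
  proof -
    have "(\<lambda>y. f (case (y, \<xi>) of (y, \<xi>) \<Rightarrow> \<xi>(i := y))) \<in> borel_measurable borel"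
      by measurable
    then show ?thesis by simp
  qed
  have "(\<integral>\<^sup>+ \<xi>. indicator {x<..} (\<xi> i) * f \<xi> \<partial>P)
     = (\<integral>\<^sup>+ \<xi>. (\<integral>\<^sup>+ y. indicator {x<..} y * f (\<xi>(i := y)) \<partial>Expo (R i)) \<partial>P)"
    by (subst resample[where i=i]) auto
  also have "\<dots> = (\<integral>\<^sup>+ \<xi>. ennreal (exp (- R i * x)) * (\<integral>\<^sup>+ y. f (\<xi>(i := y + x)) \<partial>Expo (R i)) \<partial>P)"
    using m R x by (simp add: nn_integral_Expo_shift)
  also have "\<dots> = ennreal (exp (- R i * x)) * (\<integral>\<^sup>+ \<xi>. (\<integral>\<^sup>+ y. f (\<xi>(i := y + x)) \<partial>Expo (R i)) \<partial>P)"
  proof (rule nn_integral_cmult)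
    interpret E: prob_space "Expo (R i)"
      by (rule prob_space_exponential_density[OF R])
    have "(\<lambda>(\<xi>, y). f (case (y + x, \<xi>) of (y, \<xi>) \<Rightarrow> \<xi>(i := y))) \<in> borel_measurable (P \<Otimes>\<^sub>M Expo (R i))"
      by measurable
    then show "(\<lambda>\<xi>. \<integral>\<^sup>+ y. f (\<xi>(i := y + x)) \<partial>Expo (R i)) \<in> borel_measurable P"
      by (intro E.borel_measurable_nn_integral) (simp add: case_prod_beta')
  qed
  also have "(\<integral>\<^sup>+ \<xi>. (\<integral>\<^sup>+ y. f (\<xi>(i := y + x)) \<partial>Expo (R i)) \<partial>P) = (\<integral>\<^sup>+ \<xi>. f (\<xi>(i := \<xi> i + x)) \<partial>P)"
    by (subst resample[where i=i and f="\<lambda>\<xi>. f (\<xi>(i := \<xi> i + x))"]) auto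
  finally show ?thesis .
qed

definition delay :: "'i set \<Rightarrow> real \<Rightarrow> ('i \<Rightarrow> real) \<Rightarrow> 'i \<Rightarrow> real" where
  "delay A x \<xi> = (\<lambda>i. if i \<in> A then \<xi> i + x else \<xi> i)"

lemma measurable_delay [measurable]: "(\<lambda>(x, \<xi>). delay A x \<xi>) \<in> measurable (borel \<Otimes>\<^sub>M P) P"
proof -
  have "(\<lambda>z. delay A (fst z) (snd z)) \<in> measurable (borel \<Otimes>\<^sub>M P) (\<Pi>\<^sub>M i\<in>UNIV. borel)"
    by (rule measurable_PiM_single') (auto simp: delay_def)
  then show ?thesis
    by (subst measurable_cong_sets[OF refl sets_P]) (simp add: case_prod_beta')
qed

lemma shift_coords:
  assumes "finite A" and "f \<in> borel_measurable P" and x: "0 \<le> x"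
  shows "(\<integral>\<^sup>+ \<xi>. indicator {\<xi>. \<forall>i\<in>A. x < \<xi> i} \<xi> * f \<xi> \<partial>P)
    = ennreal (exp (- (\<Sum>i\<in>A. R i) * x)) * (\<integral>\<^sup>+ \<xi>. f (delay A x \<xi>) \<partial>P)"
  using assms(1,2)
proof (induction A arbitrary: f)
  case empty
  then show ?case by (simp add: delay_def)
next
  case (insert i A)
  note [measurable] = insert.prems \<open>finite A\<close>
  have [measurable]: "Measurable.pred P (\<lambda>\<xi>. \<forall>i\<in>A. x < \<xi> i)"
    using \<open>finite A\<close> by measurable
  have [measurable]: "(\<lambda>\<xi>. f (\<xi>(i := \<xi> i + x))) \<in> borel_measurable P"
  proof -
    have "(\<lambda>\<xi>. f (case (\<xi> i + x, \<xi>) of (y, \<xi>) \<Rightarrow> \<xi>(i := y))) \<in> borel_measurable P"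
      by measurable
    then show ?thesis by simp
  qed
  have "(\<integral>\<^sup>+ \<xi>. indicator {\<xi>. \<forall>i\<in>insert i A. x < \<xi> i} \<xi> * f \<xi> \<partial>P)
      = (\<integral>\<^sup>+ \<xi>. indicator {x<..} (\<xi> i) * (indicator {\<xi>. \<forall>i\<in>A. x < \<xi> i} \<xi> * f \<xi>) \<partial>P)"
    by (intro nn_integral_cong) (auto simp: indicator_def)
  also have "\<dots> = ennreal (exp (- R i * x)) *
      (\<integral>\<^sup>+ \<xi>. indicator {\<xi>. \<forall>i\<in>A. x < \<xi> i} (\<xi>(i := \<xi> i + x)) * f (\<xi>(i := \<xi> i + x)) \<partial>P)"
    by (rule shift_coord[OF _ x]) measurable
  also have "(\<integral>\<^sup>+ \<xi>. indicator {\<xi>. \<forall>i\<in>A. x < \<xi> i} (\<xi>(i := \<xi> i + x)) * f (\<xi>(i := \<xi> i + x)) \<partial>P)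
     = (\<integral>\<^sup>+ \<xi>. indicator {\<xi>. \<forall>i\<in>A. x < \<xi> i} \<xi> * f (\<xi>(i := \<xi> i + x)) \<partial>P)"
    using \<open>i \<notin> A\<close> by (intro nn_integral_cong) (auto simp: indicator_def)
  also have "\<dots> = ennreal (exp (- (\<Sum>i\<in>A. R i) * x)) * (\<integral>\<^sup>+ \<xi>. f ((delay A x \<xi>)(i := delay A x \<xi> i + x)) \<partial>P)"
    by (rule insert.IH) measurable
  also have "(\<lambda>\<xi>. f ((delay A x \<xi>)(i := delay A x \<xi> i + x))) = (\<lambda>\<xi>. f (delay (insert i A) x \<xi>))"
    using \<open>i \<notin> A\<close> by (intro ext arg_cong[where f=f]) (auto simp: delay_def)
  also have "ennreal (exp (- R i * x)) * (ennreal (exp (- (\<Sum>i\<in>A. R i) * x)) * (\<integral>\<^sup>+ \<xi>. f (delay (insert i A) x \<xi>) \<partial>P))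
     = ennreal (exp (- (\<Sum>i\<in>insert i A. R i) * x)) * (\<integral>\<^sup>+ \<xi>. f (delay (insert i A) x \<xi>) \<partial>P)"
    using insert.hyps unfolding mult.assoc[symmetric]
    by (subst ennreal_mult[symmetric]) (auto simp: exp_add[symmetric] algebra_simps)
  finally show ?case .
qed

text \<open>Memorylessness: given that clock \<open>i\<close> is the first of the clocks in \<open>insert i A\<close> to ring, and
  rings at \<open>x\<close>, the remaining times of the others are again independent and exponential.\<close>

lemma first_ring:
  assumes "finite A" "i \<notin> A" and [measurable]: "f \<in> borel_measurable P"
  shows "(\<integral>\<^sup>+ \<xi>. indicator {\<xi>. \<forall>j\<in>A. \<xi> i < \<xi> j} \<xi> * f \<xi> \<partial>P)
    = (\<integral>\<^sup>+ x\<in>{0..}. ennreal (R i * exp (- (R i + (\<Sum>j\<in>A. R j)) * x)) *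
         (\<integral>\<^sup>+ \<xi>. f ((delay A x \<xi>)(i := x)) \<partial>P) \<partial>lborel)"
proof -
  interpret E: prob_space "Expo (R i)"
    by (rule prob_space_exponential_density[OF R])
  interpret EP: pair_sigma_finite "Expo (R i)" P ..
  have [measurable]: "Measurable.pred (borel \<Otimes>\<^sub>M P) (\<lambda>z. \<forall>j\<in>A. fst z < snd z j)"
    "Measurable.pred P (\<lambda>\<xi>. \<forall>j\<in>A. \<xi> i < \<xi> j)"
    using \<open>finite A\<close> by measurable
  have fm [measurable]: "(\<lambda>z. f ((snd z)(i := fst z))) \<in> borel_measurable (borel \<Otimes>\<^sub>M P)"
  proof -
    have "(\<lambda>z. f (case z of (y, \<xi>) \<Rightarrow> \<xi>(i := y))) \<in> borel_measurable (borel \<Otimes>\<^sub>M P)"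
      by measurable
    then show ?thesis by (simp add: case_prod_beta')
  qed
  have fm2 [measurable]: "(\<lambda>\<xi>. f (\<xi>(i := x))) \<in> borel_measurable P" for x
    using measurable_compose[OF _ fm, of "\<lambda>\<xi>. (x, \<xi>)" P] by simp
  have fm3 [measurable]: "(\<lambda>z. f ((delay A (fst z) (snd z))(i := fst z))) \<in> borel_measurable (borel \<Otimes>\<^sub>M P)"
    using measurable_compose[OF _ fm, of "\<lambda>z. (fst z, case z of (x, \<xi>) \<Rightarrow> delay A x \<xi>)" "borel \<Otimes>\<^sub>M P"]
    by (simp add: case_prod_beta')
  have "(\<integral>\<^sup>+ \<xi>. indicator {\<xi>. \<forall>j\<in>A. \<xi> i < \<xi> j} \<xi> * f \<xi> \<partial>P)
      = (\<integral>\<^sup>+ \<xi>. (\<integral>\<^sup>+ x. indicator {\<xi>. \<forall>j\<in>A. \<xi> i < \<xi> j} (\<xi>(i := x)) * f (\<xi>(i := x)) \<partial>Expo (R i)) \<partial>P)"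
    by (rule resample) measurable
  also have "\<dots> = (\<integral>\<^sup>+ \<xi>. (\<integral>\<^sup>+ x. indicator {z. \<forall>j\<in>A. fst z < snd z j} (x, \<xi>) * f ((snd (x, \<xi>))(i := fst (x, \<xi>))) \<partial>Expo (R i)) \<partial>P)"
    using \<open>i \<notin> A\<close> by (intro nn_integral_cong) (auto simp: indicator_def)
  \<comment> \<open>After the exchange the ring time \<open>x\<close> is a constant for the other
    clocks, so \<open>shift_coords\<close> applies to them.\<close>
  also have "\<dots> = (\<integral>\<^sup>+ x. (\<integral>\<^sup>+ \<xi>. indicator {z. \<forall>j\<in>A. fst z < snd z j} (x, \<xi>) * f ((snd (x, \<xi>))(i := fst (x, \<xi>))) \<partial>P) \<partial>Expo (R i))"
    by (rule EP.Fubini') measurable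
  also have "\<dots> = (\<integral>\<^sup>+ x\<in>{0..}. ennreal (R i * exp (- R i * x)) *
      (\<integral>\<^sup>+ \<xi>. indicator {z. \<forall>j\<in>A. fst z < snd z j} (x, \<xi>) * f ((snd (x, \<xi>))(i := fst (x, \<xi>))) \<partial>P) \<partial>lborel)"
    by (rule nn_integral_Expo[OF _ R]) measurable
  also have "\<dots> = (\<integral>\<^sup>+ x\<in>{0..}. ennreal (R i * exp (- (R i + (\<Sum>j\<in>A. R j)) * x)) *
         (\<integral>\<^sup>+ \<xi>. f ((delay A x \<xi>)(i := x)) \<partial>P) \<partial>lborel)"
  proof (rule nn_integral_cong)
    fix x :: real
    have "(\<integral>\<^sup>+ \<xi>. indicator {z. \<forall>j\<in>A. fst z < snd z j} (x, \<xi>) * f ((snd (x, \<xi>))(i := fst (x, \<xi>))) \<partial>P)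
      = ennreal (exp (- (\<Sum>j\<in>A. R j) * x)) * (\<integral>\<^sup>+ \<xi>. f ((delay A x \<xi>)(i := x)) \<partial>P)" if "0 \<le> x"
      using shift_coords[OF \<open>finite A\<close> fm2 that, of x] by (simp add: indicator_def)
    moreover have "ennreal (R i * exp (- R i * x)) * ennreal (exp (- (\<Sum>j\<in>A. R j) * x))
        = ennreal (R i * exp (- (R i + (\<Sum>j\<in>A. R j)) * x))"
      using less_imp_le[OF R[of i]] by (subst ennreal_mult[symmetric]) (auto simp: exp_add[symmetric] algebra_simps)
    ultimately show "ennreal (R i * exp (- R i * x)) *
      (\<integral>\<^sup>+ \<xi>. indicator {z. \<forall>j\<in>A. fst z < snd z j} (x, \<xi>) * f ((snd (x, \<xi>))(i := fst (x, \<xi>))) \<partial>P) * indicator {0..} x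
      = ennreal (R i * exp (- (R i + (\<Sum>j\<in>A. R j)) * x)) *
         (\<integral>\<^sup>+ \<xi>. f ((delay A x \<xi>)(i := x)) \<partial>P) * indicator {0..} x"
      by (auto simp: indicator_def mult.assoc[symmetric])
  qed
  finally show ?thesis .
qed

lemma AE_pos: "AE \<xi> in P. \<forall>i. 0 < \<xi> i"
proof -
  have "AE \<xi> in P. 0 < \<xi> i" for i
  proof -
    have "AE y in lborel. 0 < ennreal (exponential_density (R i) y) \<longrightarrow> 0 < y"
      using AE_lborel_singleton[of "0::real"]
      by eventually_elim (auto simp: exponential_density_def split: if_splits)
    then have "AE y in Expo (R i). 0 < y"
      by (subst AE_density) auto
    then have "AE y in distr P (Expo (R i)) (\<lambda>\<xi>. \<xi> i). 0 < y"
      unfolding P_def by (subst distr_PiM_component) (auto intro!: prob_space_exponential_density R)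
    then show ?thesis
      by (rule AE_distrD[rotated]) (simp add: P_def)
  qed
  then show ?thesis by (simp add: AE_all_countable)
qed

lemma AE_distinct: "AE \<xi> in P. \<forall>i j. i \<noteq> j \<longrightarrow> \<xi> i \<noteq> \<xi> j"
proof -
  have "AE \<xi> in P. \<xi> i \<noteq> \<xi> j" if ij: "i \<noteq> j" for i j
  proof -
    have [measurable]: "Measurable.pred P (\<lambda>\<xi>. \<xi> i = \<xi> j)"
      unfolding pred_def by (rule borel_measurable_eq) measurable
    then have sets: "{\<xi>. \<xi> i = \<xi> j} \<in> sets P"
      by (simp add: pred_def)
    have "(\<integral>\<^sup>+ \<xi>. indicator {\<xi>. \<xi> i = \<xi> j} \<xi> \<partial>P) = (\<integral>\<^sup>+ \<xi>. (\<integral>\<^sup>+ y. indicator {\<xi>. \<xi> i = \<xi> j} (\<xi>(i := y)) \<partial>Expo (R i)) \<partial>P)"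
      by (rule resample) measurable
    also have "\<dots> = (\<integral>\<^sup>+ \<xi>. (\<integral>\<^sup>+ y. indicator {\<xi> j} y \<partial>Expo (R i)) \<partial>P)"
      using ij by (intro nn_integral_cong) (auto simp: indicator_def)
    also have "\<dots> = 0"
    proof -
      have "(\<integral>\<^sup>+ y. indicator {c} y \<partial>Expo (R i)) = 0" for c :: real
      proof -
        have "AE y in lborel. ennreal (exponential_density (R i) y) * indicator {c} y = 0"
          using AE_lborel_singleton[of c] by eventually_elim (auto simp: indicator_def)
        then show ?thesis
          by (subst nn_integral_density) (auto simp: nn_integral_0_iff_AE)
      qed
      then show ?thesis by simp
    qed
    finally have "emeasure P {\<xi>. \<xi> i = \<xi> j} = 0"
      by (simp add: nn_integral_indicator[OF sets])
    then show ?thesis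
      using sets by (intro AE_I[of _ _ "{\<xi>. \<xi> i = \<xi> j}"]) auto
  qed
  then show ?thesis by (simp add: AE_all_countable)
qed

text \<open>Without ties exactly one clock of \<open>A\<close> rings first; the integral is split
  according to which one.\<close>

lemma split_first_ring:
  assumes A: "finite A" "A \<noteq> {}" and [measurable]: "f \<in> borel_measurable P"
  shows "(\<integral>\<^sup>+ \<xi>. f \<xi> \<partial>P) = (\<Sum>i\<in>A. \<integral>\<^sup>+ x\<in>{0..}. ennreal (R i * exp (- (\<Sum>j\<in>A. R j) * x)) *
         (\<integral>\<^sup>+ \<xi>. f ((delay (A - {i}) x \<xi>)(i := x)) \<partial>P) \<partial>lborel)"
proof -
  have [measurable]: "Measurable.pred P (\<lambda>\<xi>. \<forall>j\<in>A - {i}. \<xi> i < \<xi> j)" for i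
    using A by measurable
  have "(\<integral>\<^sup>+ \<xi>. f \<xi> \<partial>P) = (\<integral>\<^sup>+ \<xi>. (\<Sum>i\<in>A. indicator {\<xi>. \<forall>j\<in>A - {i}. \<xi> i < \<xi> j} \<xi> * f \<xi>) \<partial>P)"
  proof (rule nn_integral_cong_AE, rule AE_mp[OF AE_distinct], intro AE_I2 impI)
    fix \<xi> :: "'i \<Rightarrow> real" assume d: "\<forall>i j. i \<noteq> j \<longrightarrow> \<xi> i \<noteq> \<xi> j"
    define i where "i = arg_min_on \<xi> A"
    have i: "i \<in> A" unfolding i_def by (rule arg_min_if_finite[OF A])
    have le: "\<xi> i \<le> \<xi> j" if "j \<in> A" for j
      unfolding i_def by (rule arg_min_least[OF A that])
    have "(\<forall>j\<in>A - {k}. \<xi> k < \<xi> j) \<longleftrightarrow> k = i" if "k \<in> A" for k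
      using d le i that by (metis DiffD1 DiffD2 DiffI insertI1 not_less order.not_eq_order_implies_strict singletonD)
    then have "(\<Sum>k\<in>A. indicator {\<xi>. \<forall>j\<in>A - {k}. \<xi> k < \<xi> j} \<xi> * f \<xi>) = (\<Sum>k\<in>A. if k = i then f \<xi> else 0)"
      by (intro sum.cong) (auto simp: indicator_def)
    then show "f \<xi> = (\<Sum>k\<in>A. indicator {\<xi>. \<forall>j\<in>A - {k}. \<xi> k < \<xi> j} \<xi> * f \<xi>)"
      using i A by simp
  qed
  also have "\<dots> = (\<Sum>i\<in>A. \<integral>\<^sup>+ \<xi>. indicator {\<xi>. \<forall>j\<in>A - {i}. \<xi> i < \<xi> j} \<xi> * f \<xi> \<partial>P)"
    by (rule nn_integral_sum) measurable
  also have "\<dots> = (\<Sum>i\<in>A. \<integral>\<^sup>+ x\<in>{0..}. ennreal (R i * exp (- (\<Sum>j\<in>A. R j) * x)) *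
         (\<integral>\<^sup>+ \<xi>. f ((delay (A - {i}) x \<xi>)(i := x)) \<partial>P) \<partial>lborel)"
  proof (rule sum.cong[OF refl])
    fix i assume "i \<in> A"
    then have s: "R i + (\<Sum>j\<in>A - {i}. R j) = (\<Sum>j\<in>A. R j)"
      using A by (simp add: sum.remove)
    show "(\<integral>\<^sup>+ \<xi>. indicator {\<xi>. \<forall>j\<in>A - {i}. \<xi> i < \<xi> j} \<xi> * f \<xi> \<partial>P)
      = (\<integral>\<^sup>+ x\<in>{0..}. ennreal (R i * exp (- (\<Sum>j\<in>A. R j) * x)) *
         (\<integral>\<^sup>+ \<xi>. f ((delay (A - {i}) x \<xi>)(i := x)) \<partial>P) \<partial>lborel)"
      using first_ring[of "A - {i}" i f] A unfolding s by simp
  qed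
  finally show ?thesis .
qed

end

section \<open>Configurations and measurability\<close>

lemma UNIV_server: "UNIV = {Fast, Slow1, Slow2}"
  using server.exhaust by auto

instance server :: finite
  by standard (simp add: UNIV_server)

lemma UNIV_event: "UNIV = insert Arrival (range Departure)"
  using event.exhaust by auto

instance event :: finite
  by standard (simp add: UNIV_event)

definition active :: "config \<Rightarrow> event set" where
  "active c = insert Arrival (Departure ` busy c)"

definition config_state :: "config \<Rightarrow> state" where
  "config_state c = occupancy (queue c) (busy c)"

definition pre_queue :: "event \<Rightarrow> config \<Rightarrow> nat" where
  "pre_queue e c = (if e = Arrival then Suc (queue c) else queue c)"

definition pre_busy :: "event \<Rightarrow> config \<Rightarrow> server set" where
  "pre_busy e c = {i \<in> busy c. e \<noteq> Departure i}"

definition pre_state :: "event \<Rightarrow> config \<Rightarrow> state" where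
  "pre_state e c = occupancy (pre_queue e c) (pre_busy e c)"

definition history_at :: "event \<Rightarrow> config \<Rightarrow> history" where
  "history_at e c = past c @ [(due c e, e, pre_state e c)]"

definition started_clocks :: "event \<Rightarrow> nat \<times> nat \<Rightarrow> config \<Rightarrow> event set" where
  "started_clocks e p c = (if e = Arrival then {Arrival} else {}) \<union> Departure ` assigned (pre_busy e c) p"

definition move :: "(event \<times> nat \<Rightarrow> real) \<Rightarrow> event \<Rightarrow> nat \<times> nat \<Rightarrow> config \<Rightarrow> config" where
  "move \<xi> e p c = start \<xi> (started_clocks e p c)
     (c\<lparr>clock := due c e, queue := pre_queue e c - (fst p + snd p),
       busy := pre_busy e c \<union> assigned (pre_busy e c) p, past := history_at e c\<rparr>)"

text \<open>Making the event an argument separates the random choice of the first clock from the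
  dynamics that follow it.\<close>

definition step_by :: "policy \<Rightarrow> real \<Rightarrow> state \<Rightarrow> (event \<times> nat \<Rightarrow> real) \<Rightarrow> event \<Rightarrow> config \<Rightarrow> config" where
  "step_by \<pi> u s0 \<xi> e c = move \<xi> e (\<pi> u s0 (history_at e c)) c"

lemma step_eq_step_by: "step \<pi> u s0 \<xi> c = step_by \<pi> u s0 \<xi> (next_event c) c"
proof -
  obtain a b where p: "\<pi> u s0 (history_at (next_event c) c) = (a, b)"
    by force
  show ?thesis
    unfolding step_def Let_def step_by_def p
    unfolding p[unfolded history_at_def pre_state_def pre_queue_def pre_busy_def]
      move_def started_clocks_def history_at_def pre_state_def pre_queue_def pre_busy_def prod.case fst_conv snd_conv
    by (rule refl)
qed

lemma move_simps [simp]: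
  "clock (move \<xi> e p c) = due c e"
  "queue (move \<xi> e p c) = pre_queue e c - (fst p + snd p)"
  "busy (move \<xi> e p c) = pre_busy e c \<union> assigned (pre_busy e c) p"
  "past (move \<xi> e p c) = history_at e c"
  "due (move \<xi> e p c) e' = (if e' \<in> started_clocks e p c then due c e + \<xi> (e', started c e') else due c e')"
  "started (move \<xi> e p c) e' = (if e' \<in> started_clocks e p c then Suc (started c e') else started c e')"
  by (simp_all add: move_def start_def)

lemma next_event_active: "next_event c \<in> active c"
  unfolding next_event_def active_def by (rule arg_min_if_finite) auto

lemma due_next_event: "e \<in> active c \<Longrightarrow> due c (next_event c) \<le> due c e"
  unfolding next_event_def active_def by (rule arg_min_least) auto

lemma occupancy_states: "occupancy q B \<in> states"
proof -
  have "card (B \<inter> {Fast}) \<le> card {Fast}" "card (B \<inter> {Slow1, Slow2}) \<le> card {Slow1, Slow2}"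
    by (intro card_mono; auto)+
  then show ?thesis
    by (auto simp: occupancy_def states_def le_Suc_eq numeral_2_eq_2)
qed

lemma config_state_states: "config_state c \<in> states" and pre_state_states: "pre_state e c \<in> states"
  by (simp_all add: config_state_def pre_state_def occupancy_states)

lemma card_busy:
  "card (B \<inter> {Fast}) = (if Fast \<in> B then 1 else 0)"
  "card (B \<inter> {Slow1, Slow2}) = (if Slow1 \<in> B then 1 else 0) + (if Slow2 \<in> B then 1 else 0)"
  by (auto simp: Int_insert_right)

lemma mem_assigned:
  "Fast \<in> assigned B (a, b) \<longleftrightarrow> Fast \<notin> B \<and> 1 \<le> a"
  "Slow1 \<in> assigned B (a, b) \<longleftrightarrow> Slow1 \<notin> B \<and> 1 \<le> b"
  "Slow2 \<in> assigned B (a, b) \<longleftrightarrow> Slow2 \<notin> B \<and> (2 \<le> b \<or> Slow1 \<in> B \<and> 1 \<le> b)"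
  by (cases a; cases b; cases "b - 1"; simp)+

lemma occupancy_assigned:
  assumes "p \<in> feasible (occupancy q B)"
  shows "occupancy (q - (fst p + snd p)) (B \<union> assigned B p) = decide (occupancy q B) p"
proof -
  obtain a b where p: "p = (a, b)" by force
  have "(if Fast \<in> B then 1 else 0) + a \<le> 1"
    "(if Slow1 \<in> B then 1 else 0) + (if Slow2 \<in> B then 1 else 0) + b \<le> 2"
    using assms unfolding p occupancy_def card_busy by simp_all
  then show ?thesis
    unfolding p occupancy_def card_busy Un_iff mem_assigned decide.simps fst_conv snd_conv
    by (auto split: if_splits)
qed

lemma config_state_move:
  "p \<in> feasible (pre_state e c) \<Longrightarrow> config_state (move \<xi> e p c) = decide (pre_state e c) p"
  unfolding config_state_def move_def pre_state_def
  by (subst occupancy_assigned[symmetric]) (simp_all add: start_def)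

lemma sum_active:
  fixes f :: "event \<Rightarrow> real"
  shows "(\<Sum>e\<in>active c. f e) = f Arrival + (if Fast \<in> busy c then f (Departure Fast) else 0)
    + (if Slow1 \<in> busy c then f (Departure Slow1) else 0) + (if Slow2 \<in> busy c then f (Departure Slow2) else 0)"
proof -
  have "(\<Sum>e\<in>active c. f e) = f Arrival + (\<Sum>i\<in>busy c. f (Departure i))"
    unfolding active_def by (subst sum.insert) (auto simp: sum.reindex inj_on_def)
  also have "(\<Sum>i\<in>busy c. f (Departure i)) = (\<Sum>i\<in>UNIV. if i \<in> busy c then f (Departure i) else 0)"
    by (simp add: sum.If_cases)
  finally show ?thesis by (simp add: UNIV_server)
qed

lemma sum_rate_active: "(\<Sum>e\<in>active c. rate lam mu1 mu2 e) = out_rate lam mu1 mu2 (config_state c)"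
  unfolding sum_active config_state_def occupancy_def card_busy by (simp add: algebra_simps)

lemma sum_rate_pre_state:
  "(\<Sum>e\<in>active c. rate lam mu1 mu2 e * f (pre_state e c)) = next_sum lam mu1 mu2 f (config_state c)"
  unfolding sum_active config_state_def occupancy_def pre_state_def pre_queue_def pre_busy_def card_busy
  by (simp add: algebra_simps)

text \<open>The coordinate that the running clock of \<open>e\<close> was read from:
  \<open>started\<close> counts that reading already, hence the \<open>- 1\<close>.
  \<open>well_started\<close> excludes truncation.\<close>

definition slot :: "config \<Rightarrow> event \<Rightarrow> event \<times> nat" where
  "slot c e = (e, started c e - 1)"

text \<open>The running clocks of \<open>fill c \<xi>\<close> ring at times freshly read off from \<open>\<xi>\<close>; their entries
  in \<open>due c\<close> are ignored.\<close>

definition fill :: "config \<Rightarrow> (event \<times> nat \<Rightarrow> real) \<Rightarrow> config" where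
  "fill c \<xi> = c\<lparr>due := (\<lambda>e. if e \<in> active c then clock c + \<xi> (slot c e) else due c e)\<rparr>"

lemma fill_simps [simp]:
  "clock (fill c \<xi>) = clock c" "queue (fill c \<xi>) = queue c" "busy (fill c \<xi>) = busy c"
  "started (fill c \<xi>) = started c" "past (fill c \<xi>) = past c"
  "due (fill c \<xi>) e = (if e \<in> active c then clock c + \<xi> (slot c e) else due c e)"
  "active (fill c \<xi>) = active c"
  by (simp_all add: fill_def active_def)

text \<open>The zero sample is a dummy: the entries it produces in \<open>due\<close> belong to
  running clocks, which \<open>fill\<close> overwrites.\<close>

definition advance :: "policy \<Rightarrow> real \<Rightarrow> state \<Rightarrow> config \<Rightarrow> event \<Rightarrow> real \<Rightarrow> config" where
  "advance \<pi> u s0 c e x = step_by \<pi> u s0 (\<lambda>_. 0) e (c\<lparr>due := (due c)(e := clock c + x)\<rparr>)"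

definition well_started :: "config \<Rightarrow> bool" where
  "well_started c \<longleftrightarrow> (\<forall>e\<in>active c. 1 \<le> started c e)"

lemma active_move: "active (move \<xi> e p c) = (active c - {e}) \<union> started_clocks e p c"
  by (auto simp: active_def move_def start_def started_clocks_def pre_busy_def)

lemma well_started_step_by: "well_started c \<Longrightarrow> well_started (step_by \<pi> u s0 \<xi> e c)"
  unfolding well_started_def step_by_def active_move
  by (auto simp: move_def start_def)

lemma well_started_advance: "well_started c \<Longrightarrow> well_started (advance \<pi> u s0 c e x)"
  unfolding advance_def by (rule well_started_step_by) (simp add: well_started_def active_def)

lemma started_mono: "started c e \<le> started (step_by \<pi> u s0 \<xi> e' c) e"
  by (simp add: step_by_def move_def start_def)

lemma clock_advance: "clock (advance \<pi> u s0 c e x) = clock c + x"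
  by (simp add: advance_def step_by_def move_def start_def)

lemma started_advance: "started c e \<le> started (advance \<pi> u s0 c e' x) e"
  using started_mono[of "c\<lparr>due := (due c)(e' := clock c + x)\<rparr>" e] by (simp add: advance_def)

lemma pre_state_due: "pre_state e (c\<lparr>due := d\<rparr>) = pre_state e c"
  by (simp add: pre_state_def pre_queue_def pre_busy_def)

lemma config_state_advance:
  assumes "admissible \<pi>"
  obtains p where "p \<in> feasible (pre_state e c)" "config_state (advance \<pi> u s0 c e x) = decide (pre_state e c) p"
    "p = \<pi> u s0 (past c @ [(clock c + x, e, pre_state e c)])"
proof -
  define c' where "c' = c\<lparr>due := (due c)(e := clock c + x)\<rparr>"
  define p where "p = \<pi> u s0 (past c @ [(clock c + x, e, pre_state e c)])"
  have h: "history_at e c' = past c @ [(clock c + x, e, pre_state e c)]"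
    by (simp add: history_at_def c'_def pre_state_due)
  have "p \<in> feasible (pre_state e c)"
    unfolding p_def using assms pre_state_states unfolding admissible_def by blast
  moreover have "config_state (advance \<pi> u s0 c e x) = decide (pre_state e c) p"
    unfolding advance_def c'_def[symmetric] step_by_def h p_def[symmetric]
    using calculation by (subst config_state_move) (simp_all add: c'_def pre_state_due)
  ultimately show thesis using that p_def by blast
qed

text \<open>Memorylessness on a single path. If \<open>e\<close> rings after \<open>x\<close> and
  the other running clocks were delayed by \<open>x\<close>, their remaining times are again the
  values of \<xi>, and newly started clocks read untouched coordinates. So an event leads from a
  filled configuration to a filled configuration.\<close>

lemma fill_step_by:
  assumes c: "well_started c" and e: "e \<in> active c"
    and \<xi>': "\<xi>' (slot c e) = x" "\<And>e'. e' \<in> active c \<Longrightarrow> e' \<noteq> e \<Longrightarrow> \<xi>' (slot c e') = \<xi> (slot c e') + x"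
      "\<And>e' k. started c e' \<le> k \<Longrightarrow> \<xi>' (e', k) = \<xi> (e', k)"
  shows "step_by \<pi> u s0 \<xi>' e (fill c \<xi>') = fill (advance \<pi> u s0 c e x) \<xi>"
proof -
  define c' where "c' = c\<lparr>due := (due c)(e := clock c + x)\<rparr>"
  have h: "history_at e (fill c \<xi>') = history_at e c'"
    using e \<xi>'(1) by (simp add: history_at_def c'_def pre_state_due pre_state_def pre_queue_def pre_busy_def)
  define p where "p = \<pi> u s0 (history_at e c')"
  define S where "S = started_clocks e p c"
  have S: "started_clocks e p (fill c \<xi>') = S" "started_clocks e p c' = S"
    by (simp_all add: S_def started_clocks_def pre_busy_def c'_def)
  have A: "active (move (\<lambda>_. 0) e p c') = (active c - {e}) \<union> S"
    unfolding active_move S by (simp add: c'_def active_def)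
  have c': "due c' e = clock c + x" "started c' = started c" "\<And>e'. e' \<noteq> e \<Longrightarrow> due c' e' = due c e'"
    by (simp_all add: c'_def)
  have "due (move \<xi>' e p (fill c \<xi>')) e' = due (fill (move (\<lambda>_. 0) e p c') \<xi>) e'" for e'
  proof (cases "e' \<in> S")
    case True
    then show ?thesis
      using e \<xi>'(1,3) by (simp add: A S c' slot_def)
  next
    case False
    then show ?thesis
      using e \<xi>'(1,2) by (cases "e' = e") (simp_all add: A S c' slot_def)
  qed
  then have "move \<xi>' e p (fill c \<xi>') = fill (move (\<lambda>_. 0) e p c') \<xi>"
    by (intro config.equality ext) (simp_all add: S h c' pre_queue_def pre_busy_def, simp_all add: c'_def e \<xi>'(1))
  then show ?thesis
    unfolding step_by_def h advance_def c'_def[symmetric] p_def[symmetric] .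
qed

lemma next_event_fill:
  assumes "e \<in> active c" and "\<And>e'. e' \<in> active c \<Longrightarrow> e' \<noteq> e \<Longrightarrow> \<xi>' (slot c e) < \<xi>' (slot c e')"
  shows "next_event (fill c \<xi>') = e"
proof (rule ccontr)
  assume n: "next_event (fill c \<xi>') \<noteq> e"
  have "due (fill c \<xi>') (next_event (fill c \<xi>')) \<le> due (fill c \<xi>') e"
    using assms(1) by (intro due_next_event) simp
  then show False
    using assms(2)[OF _ n] next_event_active[of "fill c \<xi>'"] assms(1) by simp
qed

section \<open>Measurability in the sample point\<close>

definition discrete :: "config \<Rightarrow> nat \<times> server set \<times> (event \<Rightarrow> nat) \<times> (event \<times> state) list" where
  "discrete c = (queue c, busy c, started c, map snd (past c))"

definition time_at :: "history \<Rightarrow> nat \<Rightarrow> real" where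
  "time_at h k = (if k < length h then fst (h ! k) else 0)"

text \<open>A configuration is observed through a part with countably many values and a family of
  real coordinates. Padding by 0 in \<open>time_at\<close> makes the event times of histories of
  varying length such a family.\<close>

definition config_measurable :: "'a measure \<Rightarrow> ('a \<Rightarrow> config) \<Rightarrow> bool" where
  "config_measurable N C \<longleftrightarrow>
     (\<lambda>x. clock (C x)) \<in> borel_measurable N \<and>
     (\<forall>e. (\<lambda>x. due (C x) e) \<in> borel_measurable N) \<and>
     (\<lambda>x. discrete (C x)) \<in> measurable N (count_space UNIV) \<and>
     (\<forall>k. (\<lambda>x. time_at (past (C x)) k) \<in> borel_measurable N)"

lemma config_measurableD:
  assumes "config_measurable N C"
  shows "(\<lambda>x. clock (C x)) \<in> borel_measurable N" "(\<lambda>x. due (C x) e) \<in> borel_measurable N"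
    "(\<lambda>x. time_at (past (C x)) k) \<in> borel_measurable N"
  using assms by (auto simp: config_measurable_def)

lemma config_measurable_discrete:
  assumes "config_measurable N C" and "\<And>x. F x = G (discrete (C x))"
  shows "F \<in> measurable N (count_space UNIV)"
proof -
  have "(\<lambda>x. G (discrete (C x))) \<in> measurable N (count_space UNIV)"
    by (rule measurable_compose[of "\<lambda>x. discrete (C x)" N "count_space UNIV"])
      (use assms(1) in \<open>simp_all add: config_measurable_def\<close>)
  moreover have "F = (\<lambda>x. G (discrete (C x)))"
    by (rule ext) (rule assms(2))
  ultimately show ?thesis by simp
qed

lemma config_measurable_compose_countable:
  fixes g :: "'a \<Rightarrow> 'i::countable"
  assumes "\<And>i. config_measurable N (C i)" and "g \<in> measurable N (count_space UNIV)"
  shows "config_measurable N (\<lambda>x. C (g x) x)"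
  unfolding config_measurable_def
proof (intro conjI allI)
  note D = assms(1)[unfolded config_measurable_def]
  show "(\<lambda>x. clock (C (g x) x)) \<in> borel_measurable N"
    by (rule measurable_compose_countable[where f="\<lambda>i x. clock (C i x)", OF _ assms(2)]) (use D in blast)
  show "(\<lambda>x. due (C (g x) x) e) \<in> borel_measurable N" for e
    by (rule measurable_compose_countable[where f="\<lambda>i x. due (C i x) e", OF _ assms(2)]) (use D in blast)
  show "(\<lambda>x. discrete (C (g x) x)) \<in> measurable N (count_space UNIV)"
    by (rule measurable_compose_countable[where f="\<lambda>i x. discrete (C i x)", OF _ assms(2)]) (use D in blast)
  show "(\<lambda>x. time_at (past (C (g x) x)) k) \<in> borel_measurable N" for k
    by (rule measurable_compose_countable[where f="\<lambda>i x. time_at (past (C i x)) k", OF _ assms(2)]) (use D in blast)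
qed

lemma config_measurable_const: "config_measurable N (\<lambda>x. c)"
  by (simp add: config_measurable_def)

lemma config_measurable_fields:
  assumes C: "config_measurable N C"
  shows "(\<lambda>x. config_state (C x)) \<in> measurable N (count_space UNIV)"
    "(\<lambda>x. started (C x) e) \<in> measurable N (count_space UNIV)"
    "Measurable.pred N (\<lambda>x. e \<in> active (C x))"
    "Measurable.pred N (\<lambda>x. e' \<in> started_clocks e p (C x))"
    "Measurable.pred N (\<lambda>x. k < length (past (C x)))" "Measurable.pred N (\<lambda>x. k = length (past (C x)))"
    "(\<lambda>x. map snd (past (C x)) @ [(e, pre_state e (C x))]) \<in> measurable N (count_space UNIV)"
  by (rule config_measurable_discrete[OF C, where G="\<lambda>(q, B, st, h). occupancy q B"], simp add: discrete_def config_state_def)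
    (rule config_measurable_discrete[OF C, where G="\<lambda>(q, B, st, h). st e"], simp add: discrete_def,
     rule config_measurable_discrete[OF C, where G="\<lambda>(q, B, st, h). e \<in> insert Arrival (Departure ` B)"], simp add: discrete_def active_def,
     rule config_measurable_discrete[OF C, where G="\<lambda>(q, B, st, h). e' \<in> (if e = Arrival then {Arrival} else {}) \<union> Departure ` assigned {i \<in> B. e \<noteq> Departure i} p"],
       simp add: discrete_def started_clocks_def pre_busy_def,
     rule config_measurable_discrete[OF C, where G="\<lambda>(q, B, st, h). k < length h"], simp add: discrete_def,
     rule config_measurable_discrete[OF C, where G="\<lambda>(q, B, st, h). k = length h"], simp add: discrete_def,
     rule config_measurable_discrete[OF C, where G="\<lambda>(q, B, st, h). h @ [(e, occupancy (if e = Arrival then Suc q else q) {i \<in> B. e \<noteq> Departure i})]"],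
       simp add: discrete_def pre_state_def pre_queue_def pre_busy_def)

text \<open>Under ties the choice is unspecified, but it depends only on the set of minimising
  events, and that set has finitely many possible values.\<close>

lemma next_event_measurable:
  assumes C: "config_measurable N C"
  shows "(\<lambda>x. next_event (C x)) \<in> measurable N (count_space UNIV)"
proof -
  define M where "M c = {e. e \<in> active c \<and> (\<forall>e'. e' \<in> active c \<longrightarrow> due c e \<le> due c e')}" for c
  note [measurable] = config_measurableD[OF C] config_measurable_fields[OF C]
  have [measurable]: "Measurable.pred N (\<lambda>x. e \<in> M (C x))" for e
    unfolding M_def mem_Collect_eq by measurable
  have "(\<lambda>x. M (C x)) \<in> measurable N (count_space UNIV)"
  proof (subst measurable_count_space_eq2_countable, intro conjI ballI)
    fix S :: "event set"
    have "(\<lambda>x. M (C x)) -` {S} \<inter> space N = {x \<in> space N. \<forall>e. (e \<in> M (C x)) = (e \<in> S)}"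
      by auto
    also have "\<dots> \<in> sets N"
      by measurable
    finally show "(\<lambda>x. M (C x)) -` {S} \<inter> space N \<in> sets N" .
  qed auto
  then have "(\<lambda>x. SOME e. e \<in> M (C x)) \<in> measurable N (count_space UNIV)"
    by (rule measurable_compose) simp
  moreover have "next_event c = (SOME e. e \<in> M c)" for c
    unfolding next_event_def arg_min_on_def arg_min_def is_arg_min_def M_def active_def[symmetric]
    by (rule arg_cong[where f=Eps]) (auto simp: not_less)
  ultimately show ?thesis by simp
qed

text \<open>Cut the sample space by the pattern \<open>ds\<close> of events and states: there are
  countably many, and for each of them admissibility gives measurability in seed and times.\<close>

lemma decision_measurable:
  assumes \<pi>: "admissible \<pi>" and U [measurable]: "U \<in> borel_measurable N" and C: "config_measurable N C"
  shows "(\<lambda>x. \<pi> (U x) s0 (history_at e (C x))) \<in> measurable N (count_space UNIV)"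
proof -
  note [measurable] = config_measurableD[OF C] config_measurable_fields[OF C]
  define \<tau> where "\<tau> x k = (if k < length (past (C x)) then time_at (past (C x)) k else due (C x) e)" for x k
  define D where "D d x = \<pi> (U x) s0 (map (\<lambda>k. (\<tau> x k, d ! k)) [0..<length d])" for d x
  define ds where "ds x = map snd (past (C x)) @ [(e, pre_state e (C x))]" for x
  have [measurable]: "(\<lambda>x. \<tau> x k) \<in> borel_measurable N" for k
    unfolding \<tau>_def by measurable
  have "(\<lambda>x. (U x, \<tau> x)) \<in> measurable N (borel \<Otimes>\<^sub>M (\<Pi>\<^sub>M k\<in>(UNIV :: nat set). borel))"
    by (intro measurable_Pair measurable_PiM_single' U) auto
  then have "(\<lambda>x. (\<lambda>(u, \<tau>). \<pi> u s0 (map (\<lambda>k. (\<tau> k, d ! k)) [0..<length d])) (U x, \<tau> x)) \<in> measurable N (count_space UNIV)" for d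
    by (rule measurable_compose) (use \<pi> in \<open>unfold admissible_def, blast\<close>)
  then have "D d \<in> measurable N (count_space UNIV)" for d
    by (simp add: D_def[abs_def])
  moreover have "ds \<in> measurable N (count_space UNIV)"
    unfolding ds_def[abs_def] by (rule config_measurable_fields[OF C])
  ultimately have "(\<lambda>x. D (ds x) x) \<in> measurable N (count_space UNIV)"
    by (rule measurable_compose_countable)
  moreover have "history_at e (C x) = map (\<lambda>k. (\<tau> x k, ds x ! k)) [0..<length (ds x)]" for x
    by (rule nth_equalityI) (auto simp: history_at_def ds_def nth_append \<tau>_def time_at_def less_Suc_eq)
  ultimately show ?thesis
    by (simp add: D_def)
qed

text \<open>Times and clock values do not influence the discrete part, so they may be replaced by
  zeros; this exhibits the new discrete part as a function of the old one.\<close>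

lemma discrete_move:
  "discrete (move \<xi> e p c) = (case discrete c of (q, B, st, h) \<Rightarrow>
     discrete (move (\<lambda>_. 0) e p \<lparr>clock = 0, queue = q, busy = B, due = (\<lambda>_. 0), started = st, past = map (\<lambda>x. (0, x)) h\<rparr>))"
proof -
  have "started (move \<xi> e p c) = (\<lambda>e'. if e' \<in> started_clocks e p c then Suc (started c e') else started c e')" for \<xi> c
    by (simp add: fun_eq_iff)
  then show ?thesis
    by (simp add: discrete_def fun_eq_iff started_clocks_def pre_busy_def pre_queue_def history_at_def pre_state_def comp_def)
qed

lemma move_measurable:
  assumes C: "config_measurable N C" and \<Xi>: "\<And>i. (\<lambda>x. \<Xi> x i) \<in> borel_measurable N"
  shows "config_measurable N (\<lambda>x. move (\<Xi> x) e p (C x))"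
proof -
  note [measurable] = config_measurableD[OF C] config_measurable_fields[OF C] \<Xi>
  have [measurable]: "(\<lambda>x. \<Xi> x (e', started (C x) e')) \<in> borel_measurable N" for e'
    by (rule measurable_compose_countable[where f="\<lambda>n x. \<Xi> x (e', n)" and g="\<lambda>x. started (C x) e'"]) measurable
  have "time_at (past (move (\<Xi> x) e p (C x))) k = (if k < length (past (C x)) then time_at (past (C x)) k
      else if k = length (past (C x)) then due (C x) e else 0)" for x k
    by (auto simp: time_at_def history_at_def nth_append)
  moreover have "(\<lambda>x. discrete (move (\<Xi> x) e p (C x))) \<in> measurable N (count_space UNIV)"
    by (rule config_measurable_discrete[OF C, where G="\<lambda>(q, B, st, h). discrete (move (\<lambda>_. 0) e p
       \<lparr>clock = 0, queue = q, busy = B, due = (\<lambda>_. 0), started = st, past = map (\<lambda>x. (0, x)) h\<rparr>)"])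
      (rule discrete_move)
  ultimately show ?thesis
    unfolding config_measurable_def by simp
qed

lemma step_by_measurable:
  assumes "admissible \<pi>" "U \<in> borel_measurable N" "config_measurable N C" "\<And>i. (\<lambda>x. \<Xi> x i) \<in> borel_measurable N"
  shows "config_measurable N (\<lambda>x. step_by \<pi> (U x) s0 (\<Xi> x) e (C x))"
  unfolding step_by_def
  by (rule config_measurable_compose_countable[where C="\<lambda>p x. move (\<Xi> x) e p (C x)"])
    (intro move_measurable decision_measurable assms)+

lemma step_measurable:
  assumes "admissible \<pi>" "U \<in> borel_measurable N" "config_measurable N C" "\<And>i. (\<lambda>x. \<Xi> x i) \<in> borel_measurable N"
  shows "config_measurable N (\<lambda>x. step \<pi> (U x) s0 (\<Xi> x) (C x))"
  unfolding step_eq_step_by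
  by (rule config_measurable_compose_countable[where C="\<lambda>e x. step_by \<pi> (U x) s0 (\<Xi> x) e (C x)"])
    (intro step_by_measurable next_event_measurable assms)+

lemma fill_measurable:
  assumes C: "config_measurable N C" and \<Xi>: "\<And>i. (\<lambda>x. \<Xi> x i) \<in> borel_measurable N"
  shows "config_measurable N (\<lambda>x. fill (C x) (\<Xi> x))"
proof -
  note [measurable] = config_measurableD[OF C] config_measurable_fields[OF C] \<Xi>
  have [measurable]: "(\<lambda>x. \<Xi> x (slot (C x) e')) \<in> borel_measurable N" for e'
    unfolding slot_def
    by (rule measurable_compose_countable[where f="\<lambda>n x. \<Xi> x (e', n - 1)" and g="\<lambda>x. started (C x) e'"]) measurable
  have "(\<lambda>x. discrete (fill (C x) (\<Xi> x))) \<in> measurable N (count_space UNIV)"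
    by (rule config_measurable_discrete[OF C, where G="\<lambda>x. x"]) (simp add: discrete_def)
  then show ?thesis
    unfolding config_measurable_def by simp
qed

lemma advance_measurable:
  assumes "admissible \<pi>" and X: "X \<in> borel_measurable N"
  shows "config_measurable N (\<lambda>x. advance \<pi> u s0 c e (X x))"
  unfolding advance_def
proof (intro step_by_measurable assms)
  have "(\<lambda>x. clock c + X x) \<in> borel_measurable N"
    using X by measurable
  then show "config_measurable N (\<lambda>x. c\<lparr>due := (due c)(e := clock c + X x)\<rparr>)"
    by (simp add: config_measurable_def discrete_def)
qed auto

section \<open>Pathwise cost of the first events\<close>

definition mass :: "(real \<Rightarrow> ennreal) \<Rightarrow> real \<Rightarrow> real \<Rightarrow> ennreal" where
  "mass w a b = (\<integral>\<^sup>+ t. w t * indicator {a..<b} t \<partial>lborel)"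

lemma mass_measurable:
  assumes [measurable]: "w \<in> borel_measurable borel" "a \<in> borel_measurable N" "b \<in> borel_measurable N"
  shows "(\<lambda>x. mass w (a x) (b x)) \<in> borel_measurable N"
proof -
  have "(\<lambda>x. \<integral>\<^sup>+ t. w t * (if a x \<le> t \<and> t < b x then 1 else 0) \<partial>lborel) \<in> borel_measurable N"
    by measurable
  moreover have "w t * indicator {a x..<b x} t = w t * (if a x \<le> t \<and> t < b x then 1 else 0)" for x t
    by (auto simp: indicator_def)
  ultimately show ?thesis
    unfolding mass_def by simp
qed

text \<open>The weight \<open>w\<close> covers discounting and finite horizons alike, and a general
  cost rate \<kappa> admits the constant 1, by which explosion is excluded later.\<close>

primrec path_cost :: "(state \<Rightarrow> ennreal) \<Rightarrow> (real \<Rightarrow> ennreal) \<Rightarrow> policy \<Rightarrow> real \<Rightarrow> state \<Rightarrow>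
    (event \<times> nat \<Rightarrow> real) \<Rightarrow> nat \<Rightarrow> config \<Rightarrow> ennreal" where
  "path_cost \<kappa> w \<pi> u s0 \<xi> 0 c = 0"
| "path_cost \<kappa> w \<pi> u s0 \<xi> (Suc n) c = \<kappa> (config_state c) * mass w (clock c) (due c (next_event c))
     + path_cost \<kappa> w \<pi> u s0 \<xi> n (step \<pi> u s0 \<xi> c)"

lemma path_cost_measurable:
  assumes "admissible \<pi>" and w: "w \<in> borel_measurable borel"
    and U: "U \<in> borel_measurable N" and "config_measurable N C" and \<Xi>: "\<And>i. (\<lambda>x. \<Xi> x i) \<in> borel_measurable N"
  shows "(\<lambda>x. path_cost \<kappa> w \<pi> (U x) s0 (\<Xi> x) n (C x)) \<in> borel_measurable N"
  using assms(4)
proof (induction n arbitrary: C)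
  case (Suc n)
  note C = Suc.prems
  have due: "(\<lambda>x. due (C x) (next_event (C x))) \<in> borel_measurable N"
    by (rule measurable_compose_countable[where f="\<lambda>e x. due (C x) e" and g="\<lambda>x. next_event (C x)"])
      (intro config_measurableD C next_event_measurable)+
  have "(\<lambda>x. \<kappa> (config_state (C x))) \<in> borel_measurable N"
    by (rule measurable_compose[OF config_measurable_fields(1)[OF C]]) simp
  moreover have "(\<lambda>x. mass w (clock (C x)) (due (C x) (next_event (C x)))) \<in> borel_measurable N"
    by (intro mass_measurable w due config_measurableD C)
  moreover have "(\<lambda>x. path_cost \<kappa> w \<pi> (U x) s0 (\<Xi> x) n (step \<pi> (U x) s0 (\<Xi> x) (C x))) \<in> borel_measurable N"
    by (intro Suc.IH step_measurable assms U \<Xi> C)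
  ultimately show ?case by simp
qed simp

lemma step_cong:
  assumes "\<And>e k. started c e \<le> k \<Longrightarrow> \<xi> (e, k) = \<xi>' (e, k)"
  shows "step \<pi> u s0 \<xi> c = step \<pi> u s0 \<xi>' c"
  unfolding step_eq_step_by step_by_def move_def start_def using assms by (auto intro!: config.equality)

text \<open>The future reads only clock values not drawn so far, so it ignores the coordinates that
  \<open>path_cost_fill\<close> overwrites.\<close>

lemma path_cost_cong:
  assumes "\<And>e k. started c e \<le> k \<Longrightarrow> \<xi> (e, k) = \<xi>' (e, k)"
  shows "path_cost \<kappa> w \<pi> u s0 \<xi> n c = path_cost \<kappa> w \<pi> u s0 \<xi>' n c"
  using assms
proof (induction n arbitrary: c)
  case (Suc n)
  have "path_cost \<kappa> w \<pi> u s0 \<xi> n (step \<pi> u s0 \<xi> c) = path_cost \<kappa> w \<pi> u s0 \<xi>' n (step \<pi> u s0 \<xi> c)"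
    using Suc.prems started_mono unfolding step_eq_step_by by (intro Suc.IH) (meson order.trans)
  then show ?case
    using step_cong[of c \<xi> \<xi>' \<pi> u s0] Suc.prems by simp
qed simp

section \<open>The one-step recursion\<close>

text \<open>By Fubini, the expected weight collected up to an exponential time is the weight
  integrated against the survival probability. The same identity, read backwards with
  \<open>r = al\<close>, serves the Abelian estimate.\<close>

lemma mass_exp:
  assumes [measurable]: "w \<in> borel_measurable borel" and r: "0 < r"
  shows "(\<integral>\<^sup>+ x\<in>{0..}. ennreal (r * exp (- r * x)) * mass w t (t + x) \<partial>lborel)
    = (\<integral>\<^sup>+ x\<in>{0..}. ennreal (exp (- r * x)) * w (t + x) \<partial>lborel)"
proof -
  interpret E: prob_space "Expo r"
    by (rule prob_space_exponential_density[OF r])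
  interpret EL: pair_sigma_finite "Expo r" lborel ..
  have m: "mass w t (t + x) = (\<integral>\<^sup>+ y. w (t + y) * (indicator {0..} y * indicator {y<..} x) \<partial>lborel)" for x
  proof -
    have "mass w t (t + x) = (\<integral>\<^sup>+ y. w (t + 1 * y) * indicator {t..<t + x} (t + 1 * y) \<partial>lborel)"
      unfolding mass_def by (subst nn_integral_real_affine[where c=1 and t=t]) auto
    also have "\<dots> = (\<integral>\<^sup>+ y. w (t + y) * (indicator {0..} y * indicator {y<..} x) \<partial>lborel)"
      by (intro nn_integral_cong) (auto simp: indicator_def)
    finally show ?thesis .
  qed
  have meas: "(\<lambda>z. w (t + snd z) * (indicator {0..} (snd z) * (if snd z < fst z then 1 else 0)))
      \<in> borel_measurable (Expo r \<Otimes>\<^sub>M lborel)"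
    by measurable
  have i: "(if y < x then 1 else 0) = (indicator {y<..} x :: ennreal)" for x y :: real
    by (simp add: indicator_def)
  have "(\<integral>\<^sup>+ x\<in>{0..}. ennreal (r * exp (- r * x)) * mass w t (t + x) \<partial>lborel) = (\<integral>\<^sup>+ x. mass w t (t + x) \<partial>Expo r)"
    by (rule nn_integral_Expo[symmetric, OF mass_measurable r]) measurable
  also have "\<dots> = (\<integral>\<^sup>+ y. (\<integral>\<^sup>+ x. w (t + y) * (indicator {0..} y * indicator {y<..} x) \<partial>Expo r) \<partial>lborel)"
    unfolding m by (rule EL.Fubini'[symmetric]) (use meas in \<open>simp add: case_prod_beta' i\<close>)
  also have "\<dots> = (\<integral>\<^sup>+ y\<in>{0..}. ennreal (exp (- r * y)) * w (t + y) \<partial>lborel)"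
  proof (rule nn_integral_cong)
    fix y :: real
    have "(\<integral>\<^sup>+ x. w (t + y) * (indicator {0..} y * indicator {y<..} x) \<partial>Expo r)
        = w (t + y) * indicator {0..} y * (\<integral>\<^sup>+ x. indicator {y<..} x * 1 \<partial>Expo r)"
      by (subst nn_integral_cmult[symmetric]) (auto simp: mult.assoc)
    also have "\<dots> = w (t + y) * indicator {0..} y * ennreal (exp (- r * y))"
    proof (cases "0 \<le> y")
      case True
      then show ?thesis
        using nn_integral_Expo_shift[of "\<lambda>_. 1" r y] r E.emeasure_space_1 by simp
    qed simp
    finally show "(\<integral>\<^sup>+ x. w (t + y) * (indicator {0..} y * indicator {y<..} x) \<partial>Expo r)
      = ennreal (exp (- r * y)) * w (t + y) * indicator {0..} y"
      by (simp add: ac_simps)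
  qed
  finally show ?thesis .
qed

lemma nn_integral_exp:
  assumes "0 < a" "0 \<le> b"
  shows "(\<integral>\<^sup>+ x\<in>{0..}. ennreal (b * exp (- a * x)) \<partial>lborel) = ennreal (b / a)"
proof -
  have "(\<integral>\<^sup>+ x\<in>{0..}. ennreal (b * exp (- a * x)) \<partial>lborel) = ennreal (0 - (- b / a * exp (- a * 0)))"
  proof (rule nn_integral_FTC_atLeast)
    show "DERIV (\<lambda>x. - b / a * exp (- a * x)) x :> b * exp (- a * x)" for x
      using assms by (auto intro!: derivative_eq_intros)
    have "((\<lambda>x. - b / a * exp (- (a * x))) \<longlongrightarrow> - b / a * 0) at_top"
      using assms by (intro tendsto_intros filterlim_compose[OF exp_at_bot] filterlim_uminus_at_bot[THEN iffD1]
          filterlim_tendsto_pos_mult_at_top[OF tendsto_const] filterlim_ident) (auto simp: filterlim_uminus_at_bot intro!: filterlim_tendsto_pos_mult_at_top[OF tendsto_const] filterlim_ident)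
    then show "((\<lambda>x. - b / a * exp (- a * x)) \<longlongrightarrow> 0) at_top" by simp
  qed (use assms in auto)
  then show ?thesis by simp
qed

context rates
begin

sublocale clocks: exponential_clocks "\<lambda>p :: event \<times> nat. rate lam mu1 mu2 (fst p)"
proof
  show "0 < rate lam mu1 mu2 (fst p)" for p :: "event \<times> nat"
    using lam mu1 mu2 by (cases "(lam, mu1, mu2, fst p)" rule: rate.cases) auto
qed

lemma rate_pos: "0 < rate lam mu1 mu2 e"
  using clocks.R[of "(e, 0)"] by simp

lemma out_rate_pos: "0 < out_rate lam mu1 mu2 s"
  using lam mu1 mu2 by (cases s) (auto intro!: add_pos_nonneg)

lemma next_sum_nonneg:
  assumes "\<And>s. s \<in> states \<Longrightarrow> 0 \<le> f s" "s \<in> states"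
  shows "0 \<le> next_sum lam mu1 mu2 f s"
proof -
  obtain q z y where s: "s = (q, z, y)" by (metis surj_pair)
  then have "(Suc q, z, y) \<in> states" "(q, z - 1, y) \<in> states" "(q, z, y - 1) \<in> states"
    using assms(2) by (auto simp: states_iff)
  then show ?thesis
    using assms(1) lam mu1 mu2 unfolding s next_sum.simps
    by (intro add_nonneg_nonneg mult_nonneg_nonneg) auto
qed

definition expected_cost :: "(state \<Rightarrow> ennreal) \<Rightarrow> (real \<Rightarrow> ennreal) \<Rightarrow> policy \<Rightarrow> real \<Rightarrow> state \<Rightarrow> nat \<Rightarrow> config \<Rightarrow> ennreal" where
  "expected_cost \<kappa> w \<pi> u s0 n c = (\<integral>\<^sup>+ \<xi>. path_cost \<kappa> w \<pi> u s0 \<xi> n (fill c \<xi>) \<partial>clocks.P)"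

lemma expected_cost_0 [simp]: "expected_cost \<kappa> w \<pi> u s0 0 c = 0"
  by (simp add: expected_cost_def)

lemma expected_cost_advance_measurable:
  assumes "admissible \<pi>" "w \<in> borel_measurable borel"
  shows "(\<lambda>x. expected_cost \<kappa> w \<pi> u s0 n (advance \<pi> u s0 c e x)) \<in> borel_measurable borel"
proof -
  have [measurable]: "(\<lambda>z. snd z i) \<in> borel_measurable (borel \<Otimes>\<^sub>M clocks.P)" for i
    by measurable
  have "(\<lambda>z. path_cost \<kappa> w \<pi> u s0 (snd z) n (fill (advance \<pi> u s0 c e (fst z)) (snd z)))
      \<in> borel_measurable (borel \<Otimes>\<^sub>M clocks.P)"
    by (intro path_cost_measurable[where U="\<lambda>_. u"] fill_measurable advance_measurable assms) measurable
  then show ?thesis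
    unfolding expected_cost_def
    by (intro clocks.P.borel_measurable_nn_integral) (simp add: case_prod_beta')
qed

lemma path_cost_fill:
  fixes x :: real
  assumes c: "well_started c" and e: "e \<in> active c" and pos: "\<And>i. 0 < \<xi> i"
  defines "\<xi>' \<equiv> (clocks.delay (slot c ` active c - {slot c e}) x \<xi>)(slot c e := x)"
  shows "path_cost \<kappa> w \<pi> u s0 \<xi>' (Suc n) (fill c \<xi>') = \<kappa> (config_state c) * mass w (clock c) (clock c + x)
      + path_cost \<kappa> w \<pi> u s0 \<xi> n (fill (advance \<pi> u s0 c e x) \<xi>)"
proof -
  have inj: "slot c e' = slot c e'' \<longleftrightarrow> e' = e''" for e' e''
    by (auto simp: slot_def)
  have \<xi>': "\<xi>' (slot c e) = x" "\<And>e'. e' \<in> active c \<Longrightarrow> e' \<noteq> e \<Longrightarrow> \<xi>' (slot c e') = \<xi> (slot c e') + x"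
    by (auto simp: \<xi>'_def clocks.delay_def inj)
  have late: "\<xi>' (e', k) = \<xi> (e', k)" if "started c e' \<le> k" for e' k
  proof -
    have "(e', k) \<notin> slot c ` active c"
      using that c by (auto simp: slot_def well_started_def)
    then show ?thesis using e by (auto simp: \<xi>'_def clocks.delay_def)
  qed
  have ne: "next_event (fill c \<xi>') = e"
    using e by (rule next_event_fill) (simp add: \<xi>' pos)
  have s: "step \<pi> u s0 \<xi>' (fill c \<xi>') = fill (advance \<pi> u s0 c e x) \<xi>"
    unfolding step_eq_step_by ne by (rule fill_step_by[OF c e \<xi>' late])
  have "path_cost \<kappa> w \<pi> u s0 \<xi>' n (fill (advance \<pi> u s0 c e x) \<xi>) = path_cost \<kappa> w \<pi> u s0 \<xi> n (fill (advance \<pi> u s0 c e x) \<xi>)"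
  proof (rule path_cost_cong)
    fix e' k assume k: "started (fill (advance \<pi> u s0 c e x) \<xi>) e' \<le> k"
    show "\<xi>' (e', k) = \<xi> (e', k)"
      by (rule late) (rule order.trans[OF started_advance], use k in simp)
  qed
  then show ?thesis
    unfolding path_cost.simps(2) ne s using e \<xi>'(1) by (simp add: config_state_def)
qed

text \<open>First-step analysis for a fixed seed. The policy may use the whole history, since the
  history is part of the configuration; the remaining clocks are fresh by memorylessness.\<close>

lemma expected_cost_Suc:
  assumes \<pi>: "admissible \<pi>" and w [measurable]: "w \<in> borel_measurable borel" and c: "well_started c"
  shows "expected_cost \<kappa> w \<pi> u s0 (Suc n) c =
    (\<integral>\<^sup>+ x\<in>{0..}. ennreal (exp (- out_rate lam mu1 mu2 (config_state c) * x)) *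
      (\<kappa> (config_state c) * w (clock c + x) +
       (\<Sum>e\<in>active c. ennreal (rate lam mu1 mu2 e) * expected_cost \<kappa> w \<pi> u s0 n (advance \<pi> u s0 c e x))) \<partial>lborel)"
proof -
  define A where "A = slot c ` active c"
  define r where "r = out_rate lam mu1 mu2 (config_state c)"
  define K where "K = \<kappa> (config_state c)"
  define F where "F e x = expected_cost \<kappa> w \<pi> u s0 n (advance \<pi> u s0 c e x)" for e x
  define m where "m x = mass w (clock c) (clock c + x)" for x
  let ?f = "\<lambda>\<xi>. path_cost \<kappa> w \<pi> u s0 \<xi> (Suc n) (fill c \<xi>)"
  have r: "0 < r" unfolding r_def by (rule out_rate_pos)
  have inj: "inj_on (slot c) (active c)"
    by (auto simp: slot_def inj_on_def)
  have fst_slot: "fst (slot c e) = e" for e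
    by (simp add: slot_def)
  have A: "finite A" "A \<noteq> {}"
    by (auto simp: A_def active_def)
  have rA: "(\<Sum>p\<in>A. rate lam mu1 mu2 (fst p)) = r"
    unfolding A_def r_def sum_rate_active[symmetric] by (subst sum.reindex[OF inj]) (simp add: slot_def)
  have [measurable]: "F e \<in> borel_measurable borel" for e
    unfolding F_def[abs_def] by (rule expected_cost_advance_measurable[OF \<pi> w])
  have [measurable]: "m \<in> borel_measurable borel"
    unfolding m_def[abs_def] by (rule mass_measurable) measurable
  have fm: "?f \<in> borel_measurable clocks.P"
    by (intro path_cost_measurable[where U="\<lambda>_. u"] fill_measurable config_measurable_const \<pi> w) measurable
  have inner: "(\<integral>\<^sup>+ \<xi>. ?f ((clocks.delay (A - {slot c e}) x \<xi>)(slot c e := x)) \<partial>clocks.P)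
      = K * m x + F e x" if e: "e \<in> active c" for e x
  proof -
    have "(\<integral>\<^sup>+ \<xi>. ?f ((clocks.delay (A - {slot c e}) x \<xi>)(slot c e := x)) \<partial>clocks.P)
       = (\<integral>\<^sup>+ \<xi>. K * m x + path_cost \<kappa> w \<pi> u s0 \<xi> n (fill (advance \<pi> u s0 c e x) \<xi>) \<partial>clocks.P)"
      unfolding A_def K_def m_def
      by (rule nn_integral_cong_AE, rule AE_mp[OF clocks.AE_pos], rule AE_I2, rule impI,
          rule path_cost_fill[OF c e]) blast
    also have "\<dots> = K * m x + F e x"
      unfolding F_def expected_cost_def
      by (subst nn_integral_add)
        (auto intro!: path_cost_measurable[where U="\<lambda>_. u"] fill_measurable config_measurable_const \<pi> w
          simp: clocks.P.emeasure_space_1[simplified])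
    finally show ?thesis .
  qed
  note clocks.measurable_coord [measurable del]
  have "expected_cost \<kappa> w \<pi> u s0 (Suc n) c
      = (\<Sum>p\<in>A. \<integral>\<^sup>+ x\<in>{0..}. ennreal (rate lam mu1 mu2 (fst p) * exp (- r * x)) *
         (\<integral>\<^sup>+ \<xi>. ?f ((clocks.delay (A - {p}) x \<xi>)(p := x)) \<partial>clocks.P) \<partial>lborel)"
    unfolding expected_cost_def using clocks.split_first_ring[OF A fm] unfolding rA .
  also have "\<dots> = (\<Sum>e\<in>active c. \<integral>\<^sup>+ x\<in>{0..}. ennreal (rate lam mu1 mu2 e * exp (- r * x)) *
         (\<integral>\<^sup>+ \<xi>. ?f ((clocks.delay (A - {slot c e}) x \<xi>)(slot c e := x)) \<partial>clocks.P) \<partial>lborel)"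
    unfolding A_def by (subst sum.reindex[OF inj]) (simp add: fst_slot)
  also have "\<dots> = (\<Sum>e\<in>active c. \<integral>\<^sup>+ x\<in>{0..}. ennreal (rate lam mu1 mu2 e * exp (- r * x)) *
         (K * m x + F e x) \<partial>lborel)"
    by (rule sum.cong[OF refl]) (simp only: inner)
  also have "\<dots> = (\<integral>\<^sup>+ x. (\<Sum>e\<in>active c. ennreal (rate lam mu1 mu2 e * exp (- r * x)) *
         (K * m x + F e x) * indicator {0..} x) \<partial>lborel)"
    by (rule nn_integral_sum[symmetric]) measurable
  \<comment> \<open>The mass term is the same for every event, so the rates add up to
    \<open>r\<close> and \<open>mass_exp\<close> becomes applicable.\<close>
  also have "\<dots> = (\<integral>\<^sup>+ x. K * (ennreal (r * exp (- r * x)) * m x * indicator {0..} x)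
      + ennreal (exp (- r * x)) * (\<Sum>e\<in>active c. ennreal (rate lam mu1 mu2 e) * F e x) * indicator {0..} x \<partial>lborel)"
  proof (rule nn_integral_cong)
    fix x :: real
    have 1: "ennreal (rate lam mu1 mu2 e * exp (- r * x)) = ennreal (exp (- r * x)) * ennreal (rate lam mu1 mu2 e)" for e
      using less_imp_le[OF rate_pos[of e]] by (subst ennreal_mult[symmetric]) (auto simp: mult.commute)
    have 2: "ennreal (r * exp (- r * x)) = ennreal (exp (- r * x)) * (\<Sum>e\<in>active c. ennreal (rate lam mu1 mu2 e))"
    proof -
      have "(\<Sum>e\<in>active c. ennreal (rate lam mu1 mu2 e)) = ennreal r"
        unfolding r_def sum_rate_active[symmetric] using rate_pos by (intro sum_ennreal less_imp_le)
      then show ?thesis using r by (simp add: ennreal_mult mult.commute)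
    qed
    show "(\<Sum>e\<in>active c. ennreal (rate lam mu1 mu2 e * exp (- r * x)) *
         (K * m x + F e x) * indicator {0..} x)
      = K * (ennreal (r * exp (- r * x)) * m x * indicator {0..} x)
      + ennreal (exp (- r * x)) * (\<Sum>e\<in>active c. ennreal (rate lam mu1 mu2 e) * F e x) * indicator {0..} x"
      unfolding 1 2 by (simp add: distrib_left distrib_right sum.distrib sum_distrib_left sum_distrib_right ac_simps)
  qed
  also have "\<dots> = K * (\<integral>\<^sup>+ x\<in>{0..}. ennreal (r * exp (- r * x)) * m x \<partial>lborel)
      + (\<integral>\<^sup>+ x\<in>{0..}. ennreal (exp (- r * x)) * (\<Sum>e\<in>active c. ennreal (rate lam mu1 mu2 e) * F e x) \<partial>lborel)"
    by (subst nn_integral_add, measurable, subst nn_integral_cmult, measurable)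
  also have "\<dots> = K * (\<integral>\<^sup>+ x\<in>{0..}. ennreal (exp (- r * x)) * w (clock c + x) \<partial>lborel)
      + (\<integral>\<^sup>+ x\<in>{0..}. ennreal (exp (- r * x)) * (\<Sum>e\<in>active c. ennreal (rate lam mu1 mu2 e) * F e x) \<partial>lborel)"
    by (simp only: m_def mass_exp[OF w r])
  also have "\<dots> = (\<integral>\<^sup>+ x. K * (ennreal (exp (- r * x)) * w (clock c + x) * indicator {0..} x)
      + ennreal (exp (- r * x)) * (\<Sum>e\<in>active c. ennreal (rate lam mu1 mu2 e) * F e x) * indicator {0..} x \<partial>lborel)"
    by (subst nn_integral_add, measurable, subst nn_integral_cmult, measurable)
  also have "\<dots> = (\<integral>\<^sup>+ x\<in>{0..}. ennreal (exp (- r * x)) *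
      (K * w (clock c + x) + (\<Sum>e\<in>active c. ennreal (rate lam mu1 mu2 e) * F e x)) \<partial>lborel)"
    by (intro nn_integral_cong) (simp add: distrib_left distrib_right ac_simps)
  finally show ?thesis
    unfolding K_def r_def F_def .
qed

section \<open>Verification bounds for the cost of the first events\<close>

lemma sum_ennreal_pre_state:
  assumes "0 \<le> a" "\<And>s. s \<in> states \<Longrightarrow> 0 \<le> f s"
  shows "(\<Sum>e\<in>active c. ennreal (rate lam mu1 mu2 e) * ennreal (a * f (pre_state e c)))
    = ennreal (a * next_sum lam mu1 mu2 f (config_state c))"
proof -
  have "(\<Sum>e\<in>active c. ennreal (rate lam mu1 mu2 e) * ennreal (a * f (pre_state e c)))
      = (\<Sum>e\<in>active c. ennreal (a * (rate lam mu1 mu2 e * f (pre_state e c))))"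
    using less_imp_le[OF rate_pos] by (intro sum.cong refl, subst ennreal_mult'[symmetric]) (auto simp: ac_simps)
  also have "\<dots> = ennreal (\<Sum>e\<in>active c. a * (rate lam mu1 mu2 e * f (pre_state e c)))"
    using assms less_imp_le[OF rate_pos] by (intro sum_ennreal mult_nonneg_nonneg) (auto simp: pre_state_states)
  finally show ?thesis
    by (simp add: sum_rate_pre_state[symmetric] sum_distrib_left)
qed

lemma nn_integral_discounted_step:
  assumes "0 < al + r" "0 \<le> K" "0 \<le> S"
  shows "(\<integral>\<^sup>+ x\<in>{0..}. ennreal (exp (- r * x)) *
      (ennreal K * ennreal (exp (- al * (t + x))) + ennreal (exp (- al * (t + x)) * S)) \<partial>lborel)
    = ennreal (exp (- al * t) * ((K + S) / (al + r)))"
proof -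
  have "ennreal (exp (- r * x)) * (ennreal K * ennreal (exp (- al * (t + x))) + ennreal (exp (- al * (t + x)) * S))
      = ennreal ((exp (- al * t) * (K + S)) * exp (- (al + r) * x))" for x
  proof -
    have "exp (- r * x) * (K * exp (- al * (t + x)) + exp (- al * (t + x)) * S)
        = (exp (- al * t) * (K + S)) * exp (- (al + r) * x)"
    proof -
      have "exp (- r * x) * exp (- al * (t + x)) = exp (- al * t) * exp (- (al + r) * x)"
        by (simp add: mult_exp_exp algebra_simps)
      moreover have "exp (- r * x) * (K * exp (- al * (t + x)) + exp (- al * (t + x)) * S)
          = (K + S) * (exp (- r * x) * exp (- al * (t + x)))"
        by (simp only: distrib_left distrib_right ac_simps)
      ultimately show ?thesis by (simp only: ac_simps)
    qed
    moreover have "ennreal (exp (- r * x)) * (ennreal K * ennreal (exp (- al * (t + x))) + ennreal (exp (- al * (t + x)) * S))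
        = ennreal (exp (- r * x) * (K * exp (- al * (t + x)) + exp (- al * (t + x)) * S))"
      using assms by (simp add: ennreal_mult ennreal_plus)
    ultimately show ?thesis by simp
  qed
  then show ?thesis
    using nn_integral_exp[of "al + r" "exp (- al * t) * (K + S)"] assms by simp
qed

text \<open>\<open>g n\<close> bounds the cost of \<open>n\<close> further events before a decision
  is made. As the premise holds for every feasible decision, history and seed are irrelevant. A
  configuration is post-decision, so the bound for it is \<open>g\<close> expanded by one
  event.\<close>

lemma expected_cost_discounted_ge:
  fixes k :: "state \<Rightarrow> real" and g :: "nat \<Rightarrow> state \<Rightarrow> real"
  assumes \<pi>: "admissible \<pi>" and al: "0 < al"
    and k: "\<And>s. 0 \<le> k s" and g: "\<And>n s. s \<in> states \<Longrightarrow> 0 \<le> g n s" and g0: "\<And>s. g 0 s = 0"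
    and step: "\<And>n s p. s \<in> states \<Longrightarrow> p \<in> feasible s \<Longrightarrow>
       (al + out_rate lam mu1 mu2 (decide s p)) * g (Suc n) s \<le> k (decide s p) + next_sum lam mu1 mu2 (g n) (decide s p)"
    and c: "well_started c"
  shows "ennreal (exp (- al * clock c) * ((k (config_state c) + next_sum lam mu1 mu2 (g n) (config_state c))
      / (al + out_rate lam mu1 mu2 (config_state c))))
    \<le> expected_cost (\<lambda>s. ennreal (k s)) (\<lambda>t. ennreal (exp (- al * t))) \<pi> u s0 (Suc n) c"
  using c
proof (induction n arbitrary: c)
  case (0 c)
  have next0: "next_sum lam mu1 mu2 (g 0) s = 0" for s
    by (cases s) (simp add: g0)
  show ?case
    unfolding next0 using nn_integral_discounted_step[of al _ "k (config_state c)" 0] al k out_rate_pos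
    by (subst expected_cost_Suc[OF \<pi> _ 0]) (simp_all add: add_pos_pos)
next
  case (Suc n c)
  let ?w = "\<lambda>t. ennreal (exp (- al * t))"
  let ?E = "expected_cost (\<lambda>s. ennreal (k s)) ?w \<pi> u s0"
  let ?r = "out_rate lam mu1 mu2 (config_state c)"
  have w: "?w \<in> borel_measurable borel" by measurable
  have E: "ennreal (exp (- al * (clock c + x)) * g (Suc n) (pre_state e c)) \<le> ?E (Suc n) (advance \<pi> u s0 c e x)" for e x
  proof -
    obtain p where p: "p \<in> feasible (pre_state e c)" "config_state (advance \<pi> u s0 c e x) = decide (pre_state e c) p"
      using config_state_advance[OF \<pi>] by blast
    have "g (Suc n) (pre_state e c) \<le> (k (decide (pre_state e c) p) + next_sum lam mu1 mu2 (g n) (decide (pre_state e c) p))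
      / (al + out_rate lam mu1 mu2 (decide (pre_state e c) p))"
      using step[OF pre_state_states p(1), of n] al out_rate_pos[of "decide (pre_state e c) p"]
      by (simp add: pos_le_divide_eq mult.commute)
    then show ?thesis
      using Suc.IH[OF well_started_advance[OF Suc.prems], of \<pi> u s0 e x] unfolding p(2) clock_advance
      by (elim order.trans[rotated]) (intro ennreal_leI mult_left_mono, auto)
  qed
  have "ennreal (exp (- al * clock c) * ((k (config_state c) + next_sum lam mu1 mu2 (g (Suc n)) (config_state c)) / (al + ?r)))
    = (\<integral>\<^sup>+ x\<in>{0..}. ennreal (exp (- ?r * x)) * (ennreal (k (config_state c)) * ?w (clock c + x)
        + (\<Sum>e\<in>active c. ennreal (rate lam mu1 mu2 e) * ennreal (exp (- al * (clock c + x)) * g (Suc n) (pre_state e c)))) \<partial>lborel)"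
    by (subst sum_ennreal_pre_state, simp, rule g, assumption, subst nn_integral_discounted_step)
      (use al out_rate_pos[of "config_state c"] k next_sum_nonneg[OF g config_state_states] in simp_all)
  also have "\<dots> \<le> ?E (Suc (Suc n)) c"
    unfolding expected_cost_Suc[OF \<pi> w Suc.prems]
    by (intro nn_integral_mono mult_right_mono mult_left_mono add_left_mono sum_mono E) auto
  finally show ?case .
qed

text \<open>A nonnegative supersolution bounds the cost uniformly in the number of events.\<close>

lemma expected_cost_discounted_le:
  fixes k :: "state \<Rightarrow> real" and G :: "state \<Rightarrow> real"
  assumes \<pi>: "admissible (stationary_policy d)" and al: "0 < al"
    and k: "\<And>s. 0 \<le> k s" and G: "\<And>s. s \<in> states \<Longrightarrow> 0 \<le> G s"
    and step: "\<And>s. s \<in> states \<Longrightarrow>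
       k (decide s (d s)) + next_sum lam mu1 mu2 G (decide s (d s)) \<le> (al + out_rate lam mu1 mu2 (decide s (d s))) * G s"
    and c: "well_started c"
  shows "expected_cost (\<lambda>s. ennreal (k s)) (\<lambda>t. ennreal (exp (- al * t))) (stationary_policy d) u s0 n c
    \<le> ennreal (exp (- al * clock c) * ((k (config_state c) + next_sum lam mu1 mu2 G (config_state c))
      / (al + out_rate lam mu1 mu2 (config_state c))))"
  using c
proof (induction n arbitrary: c)
  case (Suc n c)
  let ?w = "\<lambda>t. ennreal (exp (- al * t))"
  let ?E = "expected_cost (\<lambda>s. ennreal (k s)) ?w (stationary_policy d) u s0"
  let ?r = "out_rate lam mu1 mu2 (config_state c)"
  have w: "?w \<in> borel_measurable borel" by measurable
  have E: "?E n (advance (stationary_policy d) u s0 c e x) \<le> ennreal (exp (- al * (clock c + x)) * G (pre_state e c))" for e x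
  proof -
    have p: "config_state (advance (stationary_policy d) u s0 c e x) = decide (pre_state e c) (d (pre_state e c))"
      using config_state_advance[OF \<pi>, of e c u s0 x] by (metis last_snoc snd_conv stationary_policy_def)
    have "(k (decide (pre_state e c) (d (pre_state e c))) + next_sum lam mu1 mu2 G (decide (pre_state e c) (d (pre_state e c))))
      / (al + out_rate lam mu1 mu2 (decide (pre_state e c) (d (pre_state e c)))) \<le> G (pre_state e c)"
      using step[OF pre_state_states, of e c] al out_rate_pos[of "decide (pre_state e c) (d (pre_state e c))"]
      by (simp add: pos_divide_le_eq mult.commute)
    then show ?thesis
      using Suc.IH[OF well_started_advance[OF Suc.prems], of "stationary_policy d" u s0 e x] unfolding p clock_advance
      by (elim order.trans) (intro ennreal_leI mult_left_mono, auto)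
  qed
  have "?E (Suc n) c \<le> (\<integral>\<^sup>+ x\<in>{0..}. ennreal (exp (- ?r * x)) * (ennreal (k (config_state c)) * ?w (clock c + x)
        + (\<Sum>e\<in>active c. ennreal (rate lam mu1 mu2 e) * ennreal (exp (- al * (clock c + x)) * G (pre_state e c)))) \<partial>lborel)"
    unfolding expected_cost_Suc[OF \<pi> w Suc.prems]
    by (intro nn_integral_mono mult_right_mono mult_left_mono add_left_mono sum_mono E) auto
  also have "\<dots> = ennreal (exp (- al * clock c) * ((k (config_state c) + next_sum lam mu1 mu2 G (config_state c)) / (al + ?r)))"
    by (subst sum_ennreal_pre_state, simp, rule G, assumption, subst nn_integral_discounted_step)
      (use al out_rate_pos[of "config_state c"] k next_sum_nonneg[OF G config_state_states] in simp_all)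
  finally show ?case .
qed simp

text \<open>\<open>h\<close> and \<open>H\<close> are relative values before and after a decision.
  The terminal relative value is dropped because it is nonnegative. The first premise on
  \<open>H\<close> covers all states because the initial one need not result from a decision of
  \<open>d\<close>.\<close>

lemma expected_cost_average_le:
  fixes k H h :: "state \<Rightarrow> real" and rho T :: real
  assumes \<pi>: "admissible (stationary_policy d)"
    and k: "\<And>s. 0 \<le> k s" and h: "\<And>s. s \<in> states \<Longrightarrow> 0 \<le> h s" and H: "\<And>s. s \<in> states \<Longrightarrow> 0 \<le> H s" and rho: "0 \<le> rho"
    and step: "\<And>s. s \<in> states \<Longrightarrow> k s + next_sum lam mu1 mu2 h s \<le> out_rate lam mu1 mu2 s * H s + rho"
    and decide: "\<And>s. s \<in> states \<Longrightarrow> H (decide s (d s)) \<le> h s"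
    and c: "well_started c"
  shows "expected_cost (\<lambda>s. ennreal (k s)) (indicator {..T}) (stationary_policy d) u s0 n c
    \<le> (if clock c \<le> T then ennreal (H (config_state c) + rho * (T - clock c)) else 0)"
  using c
proof (induction n arbitrary: c)
  case (Suc n c)
  let ?w = "indicator {..T} :: real \<Rightarrow> ennreal"
  let ?E = "expected_cost (\<lambda>s. ennreal (k s)) ?w (stationary_policy d) u s0"
  define r where "r = out_rate lam mu1 mu2 (config_state c)"
  define Q where "Q = T - clock c"
  define HH where "HH = H (config_state c)"
  have r: "0 < r" unfolding r_def by (rule out_rate_pos)
  have w: "?w \<in> borel_measurable borel" by measurable
  have E: "?E n (advance (stationary_policy d) u s0 c e x) \<le> (if x \<le> Q then ennreal (1 * (h (pre_state e c) + rho * (Q - x))) else 0)" for e x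
  proof -
    have p: "config_state (advance (stationary_policy d) u s0 c e x) = decide (pre_state e c) (d (pre_state e c))"
      using config_state_advance[OF \<pi>, of e c u s0 x] by (metis last_snoc snd_conv stationary_policy_def)
    show ?thesis
      using Suc.IH[OF well_started_advance[OF Suc.prems], of "stationary_policy d" u s0 e x]
        decide[OF pre_state_states, of e c] unfolding p clock_advance Q_def
      by (elim order.trans) (auto intro!: ennreal_leI simp: algebra_simps)
  qed
  have bound: "ennreal (exp (- r * x)) * (ennreal (k (config_state c)) * ?w (clock c + x)
        + (\<Sum>e\<in>active c. ennreal (rate lam mu1 mu2 e) * ?E n (advance (stationary_policy d) u s0 c e x))) * indicator {0..} x
      \<le> ennreal (exp (- r * x) * (r * (HH + rho * (Q - x)) + rho)) * indicator {0..Q} x" for x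
  proof (cases "x \<le> Q")
    case True
    have "(\<Sum>e\<in>active c. ennreal (rate lam mu1 mu2 e) * ?E n (advance (stationary_policy d) u s0 c e x))
       \<le> (\<Sum>e\<in>active c. ennreal (rate lam mu1 mu2 e) * ennreal (1 * (h (pre_state e c) + rho * (Q - x))))"
      using E[of _ x] True by (intro sum_mono mult_left_mono) auto
    also have "\<dots> = ennreal (1 * next_sum lam mu1 mu2 (\<lambda>s. h s + rho * (Q - x)) (config_state c))"
      using True rho by (intro sum_ennreal_pre_state add_nonneg_nonneg h) auto
    also have "next_sum lam mu1 mu2 (\<lambda>s. h s + rho * (Q - x)) (config_state c)
        = next_sum lam mu1 mu2 h (config_state c) + r * (rho * (Q - x))"
      unfolding r_def by (cases "config_state c") (simp add: algebra_simps)
    finally have S: "(\<Sum>e\<in>active c. ennreal (rate lam mu1 mu2 e) * ?E n (advance (stationary_policy d) u s0 c e x))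
      \<le> ennreal (next_sum lam mu1 mu2 h (config_state c) + r * (rho * (Q - x)))"
      by (simp only: mult_1_left)
    have "ennreal (k (config_state c)) * ?w (clock c + x)
        + (\<Sum>e\<in>active c. ennreal (rate lam mu1 mu2 e) * ?E n (advance (stationary_policy d) u s0 c e x))
      \<le> ennreal (k (config_state c)) + ennreal (next_sum lam mu1 mu2 h (config_state c) + r * (rho * (Q - x)))"
      by (rule add_mono[OF _ S]) (simp add: indicator_def)
    also have "\<dots> = ennreal (k (config_state c) + (next_sum lam mu1 mu2 h (config_state c) + r * (rho * (Q - x))))"
      using k r rho True by (intro ennreal_plus[symmetric] add_nonneg_nonneg next_sum_nonneg h config_state_states) auto
    also have "\<dots> \<le> ennreal (r * (HH + rho * (Q - x)) + rho)"
      using step[OF config_state_states, of c] unfolding r_def HH_def by (intro ennreal_leI) (simp add: algebra_simps)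
    finally show ?thesis
      using True by (auto simp: indicator_def ennreal_mult' intro!: mult_left_mono)
  next
    case False
    have "?E n (advance (stationary_policy d) u s0 c e x) = 0" for e
      using E[of e x] False by simp
    then show ?thesis
      using False by (simp add: indicator_def Q_def)
  qed
  have "?E (Suc n) c \<le> (\<integral>\<^sup>+ x. ennreal (exp (- r * x) * (r * (HH + rho * (Q - x)) + rho)) * indicator {0..Q} x \<partial>lborel)"
    unfolding expected_cost_Suc[OF \<pi> w Suc.prems] r_def[symmetric] by (intro nn_integral_mono bound)
  also have "\<dots> \<le> (if clock c \<le> T then ennreal (HH + rho * Q) else 0)"
  proof (cases "0 \<le> Q")
    case True
    have "(\<integral>\<^sup>+ x. ennreal (exp (- r * x) * (r * (HH + rho * (Q - x)) + rho)) * indicator {0..Q} x \<partial>lborel)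
      = ennreal (- exp (- r * Q) * (HH + rho * (Q - Q)) - - exp (- r * 0) * (HH + rho * (Q - 0)))"
    proof (rule nn_integral_FTC_Icc)
      \<comment> \<open>The bound for the remaining horizon \<open>Q - x\<close>, times the survival
        probability, is an antiderivative up to sign.\<close>
      show "((\<lambda>x. - exp (- r * x) * (HH + rho * (Q - x))) has_real_derivative exp (- r * x) * (r * (HH + rho * (Q - x)) + rho)) (at x)" for x
        by (auto intro!: derivative_eq_intros simp: algebra_simps)
      show "0 \<le> exp (- r * x) * (r * (HH + rho * (Q - x)) + rho)" if "x \<in> {0..Q}" for x
        using that r rho H[OF config_state_states, of c]
        by (intro mult_nonneg_nonneg add_nonneg_nonneg) (auto simp: HH_def)
    qed (use True in auto)
    also have "\<dots> \<le> ennreal (HH + rho * Q)"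
      using H[OF config_state_states, of c] by (intro ennreal_leI) (simp add: HH_def)
    finally show ?thesis
      using True by (simp add: Q_def)
  qed auto
  finally show ?case
    unfolding HH_def Q_def .
qed simp

end

section \<open>Sample paths\<close>

text \<open>The sample-free skeleton of the initial configuration, to be completed by
  \<open>fill\<close>; the zero sample is again a dummy.\<close>

definition start_config :: "state \<Rightarrow> config" where
  "start_config s0 = initial (\<lambda>_. 0) s0"

lemma start_config_fields:
  assumes "s0 \<in> states"
  shows "clock (start_config s0) = 0" "config_state (start_config s0) = s0"
    "well_started (start_config s0)" "initial \<xi> s0 = fill (start_config s0) \<xi>"
proof -
  obtain q z y where s0: "s0 = (q, z, y)" by (metis surj_pair)
  define B where "B = assigned {} (z, y)"
  have zy: "z \<le> 1" "y \<le> 2" using assms by (auto simp: s0 states_iff)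
  have i: "initial \<xi> s0 = \<lparr>clock = 0, queue = q, busy = B,
      due = (\<lambda>e. if e \<in> insert Arrival (Departure ` B) then \<xi> (e, 0) else 0),
      started = (\<lambda>e. if e \<in> insert Arrival (Departure ` B) then 1 else 0), past = []\<rparr>" for \<xi>
    by (simp add: s0 B_def[symmetric] Let_def start_def fun_eq_iff del: assigned.simps)
  show "clock (start_config s0) = 0" "well_started (start_config s0)"
    by (simp_all add: start_config_def i well_started_def active_def)
  show "initial \<xi> s0 = fill (start_config s0) \<xi>"
    by (simp add: start_config_def i fill_def active_def slot_def fun_eq_iff)
  have "occupancy (q + (z + y) - (z + y)) ({} \<union> assigned {} (z, y)) = decide (occupancy (q + (z + y)) {}) (z, y)"
    using zy occupancy_assigned[of "(z, y)" "q + (z + y)" "{}"] by (simp add: occupancy_def)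
  then have "occupancy q B = s0"
    by (simp add: B_def s0 occupancy_def)
  moreover have "config_state (start_config s0) = occupancy q B"
    by (simp add: start_config_def i config_state_def)
  ultimately show "config_state (start_config s0) = s0"
    by simp
qed

lemma clock_step: "clock (step \<pi> u s0 \<xi> c) = due c (next_event c)"
  by (simp add: step_eq_step_by step_by_def)

definition clocks_ahead :: "config \<Rightarrow> bool" where
  "clocks_ahead c \<longleftrightarrow> (\<forall>e\<in>active c. clock c \<le> due c e)"

lemma clocks_ahead_step:
  assumes "clocks_ahead c" "\<And>i. 0 < \<xi> i"
  shows "clocks_ahead (step \<pi> u s0 \<xi> c)" "clock c \<le> clock (step \<pi> u s0 \<xi> c)"
proof -
  show "clocks_ahead (step \<pi> u s0 \<xi> c)"
    unfolding clocks_ahead_def step_eq_step_by step_by_def active_move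
    using due_next_event[of _ c] less_imp_le[OF assms(2)] by auto
  show "clock c \<le> clock (step \<pi> u s0 \<xi> c)"
    using assms(1) next_event_active unfolding clock_step clocks_ahead_def by auto
qed

lemma path_cost_eq_sum:
  "path_cost \<kappa> w \<pi> u s0 \<xi> n c =
     (\<Sum>i<n. \<kappa> (config_state ((step \<pi> u s0 \<xi> ^^ i) c)) *
        mass w (clock ((step \<pi> u s0 \<xi> ^^ i) c)) (clock ((step \<pi> u s0 \<xi> ^^ Suc i) c)))"
proof (induction n arbitrary: c)
  case (Suc n)
  show ?case
    unfolding path_cost.simps(2) Suc sum.lessThan_Suc_shift
    by (simp add: clock_step funpow_swap1)
qed simp

lemma mass_telescope:
  assumes "\<And>i. (T i :: real) \<le> T (Suc i)" and [measurable]: "w \<in> borel_measurable borel"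
  shows "(\<Sum>i<n. mass w (T i) (T (Suc i))) = mass w (T 0) (T n)"
proof (induction n)
  case 0
  then show ?case by (simp add: mass_def)
next
  case (Suc n)
  have T: "T 0 \<le> T n" using lift_Suc_mono_le[of T, OF assms(1)] by simp
  have "mass w (T 0) (T n) + mass w (T n) (T (Suc n))
      = (\<integral>\<^sup>+ t. w t * indicator {T 0..<T n} t + w t * indicator {T n..<T (Suc n)} t \<partial>lborel)"
    unfolding mass_def by (rule nn_integral_add[symmetric]) measurable
  also have "\<dots> = mass w (T 0) (T (Suc n))"
    unfolding mass_def using T assms(1)[of n] by (intro nn_integral_cong) (auto simp: indicator_def)
  finally show ?case using Suc by simp
qed

lemma event_window:
  fixes T :: "nat \<Rightarrow> real"
  assumes mono: "\<And>i. T i \<le> T (Suc i)" and "T 0 \<le> t" and unbounded: "\<exists>n. t < T n"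
  obtains m where "T m \<le> t" "t < T (Suc m)" "card {n. T (Suc n) \<le> t} = m"
    "\<And>i. i \<noteq> m \<Longrightarrow> t \<notin> {T i..<T (Suc i)}"
proof -
  have le: "i \<le> j \<Longrightarrow> T i \<le> T j" for i j using lift_Suc_mono_le[of T, OF mono] .
  define n where "n = (LEAST n. t < T n)"
  have n: "t < T n" unfolding n_def using unbounded by (rule LeastI_ex)
  have less: "T i \<le> t" if "i < n" for i
    using not_less_Least[of i "\<lambda>n. t < T n"] that by (simp add: n_def not_less)
  obtain m where m: "n = Suc m" using n \<open>T 0 \<le> t\<close> by (cases n) auto
  have "{i. T (Suc i) \<le> t} = {..<m}"
  proof (intro set_eqI iffI)
    fix i assume "i \<in> {i. T (Suc i) \<le> t}"
    then have "\<not> T n \<le> T (Suc i)" using n by auto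
    then have "\<not> n \<le> Suc i" using le by blast
    then show "i \<in> {..<m}" by (simp add: m)
  next
    fix i assume "i \<in> {..<m}"
    then show "i \<in> {i. T (Suc i) \<le> t}" using less[of "Suc i"] by (simp add: m)
  qed
  moreover have "t \<notin> {T i..<T (Suc i)}" if "i \<noteq> m" for i
  proof (cases "i < m")
    case True
    then show ?thesis using less[of "Suc i"] by (simp add: m)
  next
    case False
    then have "T n \<le> T i" using that by (intro le) (simp add: m)
    then show ?thesis using n by auto
  qed
  ultimately show thesis using that[of m] less[of m] n m by simp
qed

context rates
begin

section \<open>The product sample space and nonexplosion\<close>

definition seed :: "real measure" where
  "seed = uniform_measure lborel {0..1}"

lemma prob_space_seed: "prob_space seed"
  unfolding seed_def by (rule prob_space_uniform_measure) auto

sublocale seed: prob_space seed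
  by (rule prob_space_seed)

lemma sets_seed [measurable_cong]: "sets seed = sets borel"
  by (simp add: seed_def)

sublocale sp: pair_prob_space seed clocks.P ..

lemma sample_space_eq: "sample_space lam mu1 mu2 = seed \<Otimes>\<^sub>M clocks.P"
  by (simp add: sample_space_def seed_def clocks.P_def)

lemma AE_sample_pos: "AE x in seed \<Otimes>\<^sub>M clocks.P. \<forall>i. 0 < snd x i"
proof -
  have "AE x in seed \<Otimes>\<^sub>M clocks.P. 0 < snd x i" for i
  proof (rule sp.AE_pair_measure)
    show "{x \<in> space (seed \<Otimes>\<^sub>M clocks.P). 0 < snd x i} \<in> sets (seed \<Otimes>\<^sub>M clocks.P)"
      by measurable
    have "AE y in clocks.P. 0 < y i"
      using clocks.AE_pos by eventually_elim blast
    then show "AE x in seed. AE y in clocks.P. 0 < snd (x, y) i"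
      by simp
  qed
  then show ?thesis by (simp add: AE_all_countable)
qed

abbreviation sample_path_cost where
  "sample_path_cost \<kappa> w \<pi> s0 n x \<equiv> path_cost \<kappa> w \<pi> (fst x) s0 (snd x) n (initial (snd x) s0)"

lemma sample_path_cost_measurable:
  assumes "admissible \<pi>" "w \<in> borel_measurable borel" "s0 \<in> states"
  shows "sample_path_cost \<kappa> w \<pi> s0 n \<in> borel_measurable (seed \<Otimes>\<^sub>M clocks.P)"
proof -
  have c: "(\<lambda>x. snd x i) \<in> borel_measurable (seed \<Otimes>\<^sub>M clocks.P)" for i
    by measurable
  have f: "fst \<in> borel_measurable (seed \<Otimes>\<^sub>M clocks.P)"
    by measurable
  show ?thesis
    unfolding start_config_fields(4)[OF assms(3)]
    by (intro path_cost_measurable fill_measurable config_measurable_const assms c f)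
qed

lemma nn_integral_sample_path_cost:
  assumes "admissible \<pi>" "w \<in> borel_measurable borel" "s0 \<in> states"
  shows "(\<integral>\<^sup>+ x. sample_path_cost \<kappa> w \<pi> s0 n x \<partial>(seed \<Otimes>\<^sub>M clocks.P))
    = (\<integral>\<^sup>+ u. expected_cost \<kappa> w \<pi> u s0 n (start_config s0) \<partial>seed)"
  using clocks.P.nn_integral_fst[OF sample_path_cost_measurable[OF assms], symmetric]
  unfolding expected_cost_def start_config_fields(4)[OF assms(3)] by simp

lemma config_after_clock:
  assumes "s0 \<in> states" "\<And>i. 0 < snd x i"
  shows "clock (config_after \<pi> s0 x 0) = 0"
    "clock (config_after \<pi> s0 x n) \<le> clock (config_after \<pi> s0 x (Suc n))"
proof -
  obtain u \<xi> where x: "x = (u, \<xi>)" by force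
  have pos: "0 < \<xi> i" for i using assms(2)[of i] by (simp add: x)
  show "clock (config_after \<pi> s0 x 0) = 0"
    by (simp add: x config_after_def start_config_fields[OF assms(1)])
  have "clocks_ahead (fill (start_config s0) \<xi>)"
    using less_imp_le[OF pos] by (auto simp: clocks_ahead_def)
  then have "clocks_ahead (config_after \<pi> s0 x n)" for n
    by (induction n) (simp_all add: x config_after_def start_config_fields(4)[OF assms(1)] clocks_ahead_step(1) pos)
  then show "clock (config_after \<pi> s0 x n) \<le> clock (config_after \<pi> s0 x (Suc n))"
    using clocks_ahead_step(2)[OF _ pos] by (simp add: x config_after_def)
qed

lemma sample_path_cost_eq_sum:
  "sample_path_cost \<kappa> w \<pi> s0 n x = (\<Sum>i<n. \<kappa> (config_state (config_after \<pi> s0 x i)) *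
     mass w (clock (config_after \<pi> s0 x i)) (clock (config_after \<pi> s0 x (Suc i))))"
  unfolding path_cost_eq_sum by (cases x) (simp add: config_after_def)

lemma out_rate_le_Lam: "s \<in> states \<Longrightarrow> out_rate lam mu1 mu2 s \<le> Lam"
proof (cases s)
  case (fields q z y)
  assume "s \<in> states"
  then have "z \<le> 1" "y \<le> 2" by (auto simp: fields states_iff)
  then have "real z * mu1 \<le> 1 * mu1" "real y * mu2 \<le> 2 * mu2"
    using mu1 mu2 by (intro mult_right_mono; simp)+
  then show ?thesis by (simp add: fields Lam_def)
qed

text \<open>With unit cost rate and weight \<open>exp (- t)\<close> the first \<open>n\<close>
  events cost one minus \<open>exp\<close> of minus the time of the \<open>n\<close>-th event. Its
  expectation tends to 1 since the event rate never exceeds \<open>Lam\<close>, whatever the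
  policy.\<close>

lemma SUP_sample_path_cost_one:
  assumes \<pi>: "admissible \<pi>" and s0: "s0 \<in> states"
  shows "AE x in seed \<Otimes>\<^sub>M clocks.P. (SUP n. sample_path_cost (\<lambda>_. 1) (\<lambda>t. ennreal (exp (- t))) \<pi> s0 n x) = 1"
proof -
  let ?M = "seed \<Otimes>\<^sub>M clocks.P"
  let ?w = "\<lambda>t :: real. ennreal (exp (- t))"
  let ?p = "\<lambda>n x. sample_path_cost (\<lambda>_. 1) ?w \<pi> s0 n x"
  have w: "?w \<in> borel_measurable borel" by measurable
  note pm [measurable] = sample_path_cost_measurable[OF \<pi> w s0, where \<kappa>="\<lambda>_. 1"]
  have ub: "?p n x \<le> 1" if pos: "\<forall>i. 0 < snd x i" for n x
  proof -
    have "?p n x = mass ?w 0 (clock (config_after \<pi> s0 x n))"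
      unfolding sample_path_cost_eq_sum mult_1_left
      using mass_telescope[of "\<lambda>n. clock (config_after \<pi> s0 x n)" ?w n, OF config_after_clock(2)[OF s0] w] pos
        config_after_clock(1)[OF s0, of x \<pi>] by simp
    also have "\<dots> \<le> (\<integral>\<^sup>+ t\<in>{0..}. ennreal (1 * exp (- 1 * t)) \<partial>lborel)"
      unfolding mass_def by (intro nn_integral_mono) (auto simp: indicator_def)
    also have "\<dots> = 1"
      by (subst nn_integral_exp) auto
    finally show ?thesis .
  qed
  \<comment> \<open>The Laplace transform at 1 of an exponential time of rate \<open>Lam\<close>. A
    smaller rate \<open>r\<close> gives \<open>r / (1 + r) \<le> q\<close>, so \<open>q ^ n\<close>
    bounds the expectation of \<open>exp (- t)\<close> at the \<open>n\<close>-th event time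
    \<open>t\<close>.\<close>
  define q where "q = Lam / (1 + Lam)"
  have q: "0 \<le> q" "q < 1" using Lam_pos by (auto simp: q_def)
  define g where "g n s = 1 - q ^ n" for n :: nat and s :: state
  have ns: "next_sum lam mu1 mu2 (g n) s = out_rate lam mu1 mu2 s * (1 - q ^ n)" for n s
    by (cases s) (simp add: g_def algebra_simps)
  have step: "(1 + r) * (1 - q ^ Suc n) \<le> 1 + r * (1 - q ^ n)" if "0 \<le> r" "r \<le> Lam" for r n
  proof -
    have "r \<le> (1 + r) * q"
      using that Lam_pos by (simp add: q_def field_simps)
    then have "r * q ^ n \<le> (1 + r) * q * q ^ n"
      using q by (intro mult_right_mono) auto
    then show ?thesis by (simp add: algebra_simps)
  qed
  have lb: "ennreal (1 - q ^ Suc n) \<le> (\<integral>\<^sup>+ x. ?p (Suc n) x \<partial>?M)" for n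
  proof -
    let ?r = "out_rate lam mu1 mu2 s0"
    have "ennreal (1 - q ^ Suc n) \<le> ennreal ((1 + ?r * (1 - q ^ n)) / (1 + ?r))"
      using step[of ?r n] out_rate_pos[of s0] out_rate_le_Lam[OF s0]
      by (intro ennreal_leI) (simp add: pos_le_divide_eq mult.commute)
    also have "\<dots> \<le> expected_cost (\<lambda>_. 1) ?w \<pi> u s0 (Suc n) (start_config s0)" for u
    proof -
      have "ennreal (exp (- 1 * clock (start_config s0)) * ((1 + next_sum lam mu1 mu2 (g n) (config_state (start_config s0)))
          / (1 + out_rate lam mu1 mu2 (config_state (start_config s0)))))
        \<le> expected_cost (\<lambda>s. ennreal 1) (\<lambda>t. ennreal (exp (- 1 * t))) \<pi> u s0 (Suc n) (start_config s0)"
      proof (rule expected_cost_discounted_ge[OF \<pi>])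
        fix n s p assume "s \<in> states" "p \<in> feasible s"
        then show "(1 + out_rate lam mu1 mu2 (decide s p)) * g (Suc n) s \<le> 1 + next_sum lam mu1 mu2 (g n) (decide s p)"
          unfolding ns using step[of "out_rate lam mu1 mu2 (decide s p)" n] out_rate_pos[of "decide s p"]
            out_rate_le_Lam[OF decide_states] by (simp add: g_def)
      qed (use q start_config_fields(3)[OF s0] in \<open>auto simp: g_def power_le_one\<close>)
      then show ?thesis
        by (simp add: ns start_config_fields[OF s0])
    qed
    then have "ennreal ((1 + ?r * (1 - q ^ n)) / (1 + ?r)) \<le> (\<integral>\<^sup>+ u. expected_cost (\<lambda>_. 1) ?w \<pi> u s0 (Suc n) (start_config s0) \<partial>seed)"
      using nn_integral_mono[of seed "\<lambda>_. ennreal ((1 + ?r * (1 - q ^ n)) / (1 + ?r))" "\<lambda>u. expected_cost (\<lambda>_. 1) ?w \<pi> u s0 (Suc n) (start_config s0)"]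
      by (simp add: seed.emeasure_space_1)
    finally show ?thesis
      unfolding nn_integral_sample_path_cost[OF \<pi> w s0] .
  qed
  let ?S = "\<lambda>x. SUP n. ?p n x"
  have Sm [measurable]: "?S \<in> borel_measurable ?M"
    by measurable
  have S1: "AE x in ?M. ?S x \<le> 1"
    using AE_sample_pos by eventually_elim (intro SUP_least ub)
  have "1 \<le> (\<integral>\<^sup>+ x. ?S x \<partial>?M)"
  proof (rule LIMSEQ_le_const2)
    have "(\<lambda>n. 1 - q ^ Suc n) \<longlonglongrightarrow> 1 - 0"
      using q by (intro tendsto_intros LIMSEQ_Suc LIMSEQ_realpow_zero) auto
    then have "(\<lambda>n. ennreal (1 - q ^ Suc n)) \<longlonglongrightarrow> ennreal (1 - 0)"
      by (rule tendsto_ennrealI)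
    then show "(\<lambda>n. ennreal (1 - q ^ Suc n)) \<longlonglongrightarrow> 1" by simp
    show "\<exists>N. \<forall>n\<ge>N. ennreal (1 - q ^ Suc n) \<le> (\<integral>\<^sup>+ x. ?S x \<partial>?M)"
      by (intro exI allI impI order.trans[OF lb] nn_integral_mono SUP_upper) auto
  qed
  moreover have "(\<integral>\<^sup>+ x. ?S x \<partial>?M) \<le> (\<integral>\<^sup>+ x. 1 \<partial>?M)"
    by (rule nn_integral_mono_AE[OF S1])
  moreover have one: "(\<integral>\<^sup>+ x. 1 \<partial>?M) = 1"
    using sp.emeasure_space_1 by simp
  ultimately have S: "(\<integral>\<^sup>+ x. ?S x \<partial>?M) = 1"
    by simp
  \<comment> \<open>A function below 1 with integral 1 over a probability space equals 1 almost
    everywhere.\<close>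
  have "(\<integral>\<^sup>+ x. 1 - ?S x \<partial>?M) = (\<integral>\<^sup>+ x. 1 \<partial>?M) - (\<integral>\<^sup>+ x. ?S x \<partial>?M)"
    by (rule nn_integral_diff) (use S S1 in auto)
  also have "\<dots> = 0" by (simp add: S one del: nn_integral_const)
  finally have "AE x in ?M. 1 - ?S x = 0"
    by (subst (asm) nn_integral_0_iff_AE) auto
  then show ?thesis
    using S1 by eventually_elim (metis diff_eq_0_iff_ennreal antisym ennreal_one_less_top)
qed

text \<open>Event times bounded by \<open>t\<close> would keep the supremum below
  \<open>1 - exp (- t)\<close>.\<close>

lemma AE_nonexplosive:
  assumes \<pi>: "admissible \<pi>" and s0: "s0 \<in> states"
  shows "AE x in seed \<Otimes>\<^sub>M clocks.P. \<forall>t. \<exists>n. t < clock (config_after \<pi> s0 x n)"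
  using SUP_sample_path_cost_one[OF assms] AE_sample_pos
proof eventually_elim
  fix x assume one: "(SUP n. sample_path_cost (\<lambda>_. 1) (\<lambda>t. ennreal (exp (- t))) \<pi> s0 n x) = 1" and pos: "\<forall>i. 0 < snd x i"
  let ?w = "\<lambda>t :: real. ennreal (exp (- t))"
  let ?T = "\<lambda>n. clock (config_after \<pi> s0 x n)"
  have w: "?w \<in> borel_measurable borel" by measurable
  show "\<forall>t. \<exists>n. t < ?T n"
  proof (rule ccontr)
    assume "\<not> (\<forall>t. \<exists>n. t < ?T n)"
    then obtain t where t: "?T n \<le> t" for n by (auto simp: not_less)
    have t0: "0 \<le> t" using t[of 0] config_after_clock(1)[OF s0, of x \<pi>] pos by simp
    have "sample_path_cost (\<lambda>_. 1) ?w \<pi> s0 n x \<le> ennreal (1 - exp (- t))" for n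
    proof -
      have "sample_path_cost (\<lambda>_. 1) ?w \<pi> s0 n x = mass ?w 0 (?T n)"
        unfolding sample_path_cost_eq_sum mult_1_left
        using mass_telescope[of ?T ?w n, OF config_after_clock(2)[OF s0] w] pos
          config_after_clock(1)[OF s0, of x \<pi>] by simp
      also have "\<dots> \<le> (\<integral>\<^sup>+ y. ennreal (exp (- y)) * indicator {0..t} y \<partial>lborel)"
        unfolding mass_def using t[of n] by (intro nn_integral_mono) (auto simp: indicator_def)
      also have "\<dots> = ennreal (- exp (- t) - - exp (- 0))"
        using t0 by (intro nn_integral_FTC_Icc) (auto intro!: derivative_eq_intros)
      finally show ?thesis by simp
    qed
    then have "(SUP n. sample_path_cost (\<lambda>_. 1) ?w \<pi> s0 n x) \<le> ennreal (1 - exp (- t))"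
      by (rule SUP_least)
    then have "1 \<le> ennreal (1 - exp (- t))" unfolding one .
    then have "1 \<le> 1 - exp (- t)"
      using t0 by (subst (asm) ennreal_1[symmetric], subst (asm) ennreal_le_iff) auto
    then show False by simp
  qed
qed

lemma cost_eq_suminf:
  assumes w: "w \<in> borel_measurable borel" and s0: "s0 \<in> states"
    and pos: "\<forall>i. 0 < snd x i" and unbounded: "\<forall>t. \<exists>n. t < clock (config_after \<pi> s0 x n)"
  shows "t \<ge> 0 \<Longrightarrow> ennreal (real (jobs (state_at \<pi> s0 x t))) = (\<Sum>i. ennreal (real (jobs (config_state (config_after \<pi> s0 x i))))
      * indicator {clock (config_after \<pi> s0 x i)..<clock (config_after \<pi> s0 x (Suc i))} t)"
    and "(\<integral>\<^sup>+ t\<in>{0..}. w t * ennreal (real (jobs (state_at \<pi> s0 x t))) \<partial>lborel)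
    = (SUP n. sample_path_cost (\<lambda>s. ennreal (real (jobs s))) w \<pi> s0 n x)"
proof -
  let ?T = "\<lambda>n. clock (config_after \<pi> s0 x n)"
  let ?k = "\<lambda>i. ennreal (real (jobs (config_state (config_after \<pi> s0 x i))))"
  have T0: "?T 0 = 0" and Tm: "?T n \<le> ?T (Suc n)" for n
    using config_after_clock[OF s0] pos by blast+
  have T_nonneg: "0 \<le> ?T n" for n
    using lift_Suc_mono_le[of ?T, OF Tm, of 0 n] T0 by simp
  show 1: "ennreal (real (jobs (state_at \<pi> s0 x t))) = (\<Sum>i. ?k i * indicator {?T i..<?T (Suc i)} t)" if t: "t \<ge> 0" for t
  proof -
    obtain m where m: "?T m \<le> t" "t < ?T (Suc m)" "card {n. ?T (Suc n) \<le> t} = m"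
      "\<And>i. i \<noteq> m \<Longrightarrow> t \<notin> {?T i..<?T (Suc i)}"
      using event_window[of ?T t, OF Tm] T0 t unbounded by auto
    have "(\<Sum>i. ?k i * indicator {?T i..<?T (Suc i)} t) = (\<Sum>i\<in>{m}. ?k i * indicator {?T i..<?T (Suc i)} t)"
      using m(4) by (intro suminf_finite) auto
    also have "\<dots> = ?k m" using m by simp
    finally show ?thesis
      by (simp add: state_at_def Let_def num_events_def m(3) config_state_def)
  qed
  have "(\<integral>\<^sup>+ t\<in>{0..}. w t * ennreal (real (jobs (state_at \<pi> s0 x t))) \<partial>lborel)
      = (\<integral>\<^sup>+ t. (\<Sum>i. ?k i * (w t * indicator {?T i..<?T (Suc i)} t)) \<partial>lborel)"
  proof (rule nn_integral_cong)
    fix t :: real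
    show "w t * ennreal (real (jobs (state_at \<pi> s0 x t))) * indicator {0..} t
      = (\<Sum>i. ?k i * (w t * indicator {?T i..<?T (Suc i)} t))"
    proof (cases "0 \<le> t")
      case True
      then have "w t * ennreal (real (jobs (state_at \<pi> s0 x t))) * indicator {0..} t
        = w t * (\<Sum>i. ?k i * indicator {?T i..<?T (Suc i)} t)"
        using 1 by simp
      also have "\<dots> = (\<Sum>i. w t * (?k i * indicator {?T i..<?T (Suc i)} t))"
        by (rule ennreal_suminf_cmult[symmetric])
      finally show ?thesis by (simp add: ac_simps)
    next
      case False
      then have "indicator {?T i..<?T (Suc i)} t = (0 :: ennreal)" for i
        using T_nonneg[of i] by (simp add: indicator_def)
      then show ?thesis using False by simp
    qed
  qed
  also have "\<dots> = (\<Sum>i. \<integral>\<^sup>+ t. ?k i * (w t * indicator {?T i..<?T (Suc i)} t) \<partial>lborel)"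
    using w by (intro nn_integral_suminf) auto
  also have "\<dots> = (\<Sum>i. ?k i * mass w (?T i) (?T (Suc i)))"
    unfolding mass_def using w by (subst nn_integral_cmult) auto
  also have "\<dots> = (SUP n. sample_path_cost (\<lambda>s. ennreal (real (jobs s))) w \<pi> s0 n x)"
    unfolding sample_path_cost_eq_sum by (rule suminf_eq_SUP)
  finally show "(\<integral>\<^sup>+ t\<in>{0..}. w t * ennreal (real (jobs (state_at \<pi> s0 x t))) \<partial>lborel)
    = (SUP n. sample_path_cost (\<lambda>s. ennreal (real (jobs s))) w \<pi> s0 n x)" .
qed

definition weighted_cost :: "(real \<Rightarrow> ennreal) \<Rightarrow> policy \<Rightarrow> state \<Rightarrow> ennreal" where
  "weighted_cost w \<pi> s0 = (\<integral>\<^sup>+ x. (\<integral>\<^sup>+ t\<in>{0..}. w t * ennreal (real (jobs (state_at \<pi> s0 x t))) \<partial>lborel)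
     \<partial>sample_space lam mu1 mu2)"

lemma weighted_cost_eq_SUP:
  assumes \<pi>: "admissible \<pi>" and w: "w \<in> borel_measurable borel" and s0: "s0 \<in> states"
  shows "weighted_cost w \<pi> s0 = (SUP n. \<integral>\<^sup>+ u. expected_cost (\<lambda>s. ennreal (real (jobs s))) w \<pi> u s0 n (start_config s0) \<partial>seed)"
proof -
  have "weighted_cost w \<pi> s0 = (\<integral>\<^sup>+ x. (SUP n. sample_path_cost (\<lambda>s. ennreal (real (jobs s))) w \<pi> s0 n x) \<partial>(seed \<Otimes>\<^sub>M clocks.P))"
    unfolding weighted_cost_def sample_space_eq
  proof (rule nn_integral_cong_AE)
    show "AE x in seed \<Otimes>\<^sub>M clocks.P. (\<integral>\<^sup>+ t\<in>{0..}. w t * ennreal (real (jobs (state_at \<pi> s0 x t))) \<partial>lborel)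
      = (SUP n. sample_path_cost (\<lambda>s. ennreal (real (jobs s))) w \<pi> s0 n x)"
      using AE_sample_pos AE_nonexplosive[OF \<pi> s0] by eventually_elim (rule cost_eq_suminf(2)[OF w s0])
  qed
  also have "\<dots> = (SUP n. \<integral>\<^sup>+ x. sample_path_cost (\<lambda>s. ennreal (real (jobs s))) w \<pi> s0 n x \<partial>(seed \<Otimes>\<^sub>M clocks.P))"
  proof (rule nn_integral_monotone_convergence_SUP)
    show "incseq (\<lambda>n. sample_path_cost (\<lambda>s. ennreal (real (jobs s))) w \<pi> s0 n)"
      unfolding sample_path_cost_eq_sum by (intro incseq_SucI le_funI) simp
  qed (rule sample_path_cost_measurable[OF \<pi> w s0])
  finally show ?thesis
    unfolding nn_integral_sample_path_cost[OF \<pi> w s0] .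
qed

end

section \<open>Optimality\<close>

lemma stationary_admissible:
  assumes "\<And>s. s \<in> states \<Longrightarrow> d s \<in> feasible s"
  shows "admissible (stationary_policy d)"
  unfolding admissible_def stationary_policy_def
proof (intro conjI allI impI)
  show "d (snd (snd (last (h @ [(t, e, s)])))) \<in> feasible s" if "s \<in> states" for h :: history and t e s
    using assms[OF that] by simp
  fix s0 :: state and ds :: "(event \<times> state) list"
  have "snd (snd (last (map (\<lambda>k. (\<tau> k :: real, ds ! k)) [0..<length ds])))
      = (if ds = [] then snd (snd (last ([] :: history))) else snd (last ds))" for \<tau>
    by (cases "ds = []") (simp_all add: last_map last_conv_nth)
  then show "(\<lambda>(u :: real, \<tau>). d (snd (snd (last (map (\<lambda>k. (\<tau> k :: real, ds ! k)) [0..<length ds])))))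
      \<in> measurable (borel \<Otimes>\<^sub>M (\<Pi>\<^sub>M k\<in>(UNIV :: nat set). borel)) (count_space UNIV)"
    by (simp only: case_prod_beta' measurable_const UNIV_I space_count_space)
qed

context rates
begin

lemma discounted_cost_eq:
  "discounted_cost lam mu1 mu2 al \<pi> s0 = weighted_cost (\<lambda>t. ennreal (exp (- al * t))) \<pi> s0"
  unfolding discounted_cost_def weighted_cost_def
  by (simp add: ennreal_mult)

lemma average_cost_eq:
  "average_cost lam mu1 mu2 \<pi> s0 = Limsup at_top (\<lambda>T. weighted_cost (indicator {..T}) \<pi> s0 / ennreal T)"
proof -
  have "indicator {..T} t * ennreal (real j) * indicator {0..} t = ennreal (real j) * indicator {0..T} t" for T t :: real and j
    by (auto simp: indicator_def)
  then show ?thesis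
    unfolding average_cost_def weighted_cost_def by simp
qed

lemma weighted_cost_ge:
  assumes "admissible \<pi>" "w \<in> borel_measurable borel" "s0 \<in> states"
    and "\<And>u. a \<le> expected_cost (\<lambda>s. ennreal (real (jobs s))) w \<pi> u s0 n (start_config s0)"
  shows "a \<le> weighted_cost w \<pi> s0"
proof -
  have "a = (\<integral>\<^sup>+ u. a \<partial>seed)"
    by (simp add: seed.emeasure_space_1)
  also have "\<dots> \<le> (\<integral>\<^sup>+ u. expected_cost (\<lambda>s. ennreal (real (jobs s))) w \<pi> u s0 n (start_config s0) \<partial>seed)"
    by (intro nn_integral_mono assms)
  also have "\<dots> \<le> weighted_cost w \<pi> s0"
    unfolding weighted_cost_eq_SUP[OF assms(1-3)] by (rule SUP_upper) simp
  finally show ?thesis .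
qed

lemma weighted_cost_le:
  assumes "admissible \<pi>" "w \<in> borel_measurable borel" "s0 \<in> states"
    and "\<And>u n. expected_cost (\<lambda>s. ennreal (real (jobs s))) w \<pi> u s0 n (start_config s0) \<le> a"
  shows "weighted_cost w \<pi> s0 \<le> a"
  unfolding weighted_cost_eq_SUP[OF assms(1-3)]
proof (rule SUP_least)
  fix n
  have "(\<integral>\<^sup>+ u. expected_cost (\<lambda>s. ennreal (real (jobs s))) w \<pi> u s0 n (start_config s0) \<partial>seed) \<le> (\<integral>\<^sup>+ u. a \<partial>seed)"
    by (intro nn_integral_mono assms)
  then show "(\<integral>\<^sup>+ u. expected_cost (\<lambda>s. ennreal (real (jobs s))) w \<pi> u s0 n (start_config s0) \<partial>seed) \<le> a"
    by (simp add: seed.emeasure_space_1)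
qed

lemma lift_state_nonneg:
  assumes "\<And>x y. y \<le> 2 \<Longrightarrow> 0 \<le> v x y" "s \<in> states"
  shows "0 \<le> lift_state v s"
  using assms by (cases s) (auto simp: states_iff)

lemma tendsto_next_sum:
  assumes "\<And>x y. y \<le> 2 \<Longrightarrow> (\<lambda>n. f n x y) \<longlonglongrightarrow> v x y" "s \<in> states"
  shows "(\<lambda>n. next_sum lam mu1 mu2 (lift_state (f n)) s) \<longlonglongrightarrow> next_sum lam mu1 mu2 (lift_state v) s"
  using assms(2) by (cases s) (auto simp: states_iff intro!: tendsto_intros assms(1))

text \<open>The initial state is post-decision, so the optimal cost is not \<open>val\<close> there
  but its expansion up to the first event.\<close>

lemma discounted_cost_ge:
  assumes \<pi>: "admissible \<pi>" and al: "0 < al" and s0: "s0 \<in> states"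
  shows "ennreal ((real (jobs s0) + next_sum lam mu1 mu2 (lift_state (val al)) s0) / (al + out_rate lam mu1 mu2 s0))
    \<le> weighted_cost (\<lambda>t. ennreal (exp (- al * t))) \<pi> s0"
proof (rule LIMSEQ_le_const2)
  let ?w = "\<lambda>t. ennreal (exp (- al * t))"
  have w: "?w \<in> borel_measurable borel" by measurable
  let ?a = "\<lambda>v. (real (jobs s0) + next_sum lam mu1 mu2 (lift_state v) s0) / (al + out_rate lam mu1 mu2 s0)"
  show "(\<lambda>n. ennreal (?a (viter al n))) \<longlonglongrightarrow> ennreal (?a (val al))"
    using al out_rate_pos[of s0]
    by (intro tendsto_ennrealI tendsto_intros tendsto_next_sum viter_val s0) auto
  have "ennreal (exp (- al * clock (start_config s0)) * ((real (jobs (config_state (start_config s0)))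
      + next_sum lam mu1 mu2 (lift_state (viter al n)) (config_state (start_config s0)))
      / (al + out_rate lam mu1 mu2 (config_state (start_config s0)))))
    \<le> expected_cost (\<lambda>s. ennreal (real (jobs s))) ?w \<pi> u s0 (Suc n) (start_config s0)" for u n
  proof (rule expected_cost_discounted_ge[OF \<pi> al, where g="\<lambda>n. lift_state (viter al n)"])
    show "0 \<le> lift_state (viter al n) s" if "s \<in> states" for n s
      using that viter_nonneg[OF al] by (rule lift_state_nonneg[rotated])
    show "lift_state (viter al 0) s = 0" for s
      by (cases s) simp
    show "(al + out_rate lam mu1 mu2 (decide s p)) * lift_state (viter al (Suc n)) s
      \<le> real (jobs (decide s p)) + next_sum lam mu1 mu2 (lift_state (viter al n)) (decide s p)"
      if "s \<in> states" "p \<in> feasible s" for n s p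
      by (rule viter_le_decide[OF al that])
  qed (use start_config_fields(3)[OF s0] in simp_all)
  then have "ennreal (?a (viter al n)) \<le> weighted_cost ?w \<pi> s0" for n
    by (intro weighted_cost_ge[OF \<pi> w s0, of _ "Suc n"]) (simp add: start_config_fields[OF s0])
  then show "\<exists>N. \<forall>n\<ge>N. ennreal (?a (viter al n)) \<le> weighted_cost ?w \<pi> s0"
    by blast
qed

lemma val_le_discounted_cost:
  assumes \<pi>: "admissible \<pi>" and al: "0 < al" and s0: "s0 \<in> states"
  shows "ennreal (val al 0 0) \<le> weighted_cost (\<lambda>t. ennreal (exp (- al * t))) \<pi> s0"
proof -
  obtain q z y where s: "s0 = (q, z, y)" by (metis surj_pair)
  have y: "y \<le> 2" using s0 by (simp add: s states_iff)
  \<comment> \<open>The empty decision turns the post-decision state into an admissible outcome of a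
    decision, so \<open>viter_le_decide\<close> bounds its expansion.\<close>
  have p: "(0, 0) \<in> feasible s0" "decide s0 (0, 0) = s0"
    using s0 by (auto simp: s states_iff)
  have "val al 0 0 \<le> lift_state (val al) s0"
    unfolding s lift_state.simps by (rule regular_ge_origin[OF regular_val[OF al] y])
  also have "(al + out_rate lam mu1 mu2 s0) * lift_state (val al) s0
      \<le> real (jobs s0) + next_sum lam mu1 mu2 (lift_state (val al)) s0"
  proof (rule LIMSEQ_le)
    show "(\<lambda>n. (al + out_rate lam mu1 mu2 s0) * lift_state (viter al (Suc n)) s0)
        \<longlonglongrightarrow> (al + out_rate lam mu1 mu2 s0) * lift_state (val al) s0"
      unfolding s lift_state.simps by (intro tendsto_intros LIMSEQ_Suc viter_val al y)
    show "(\<lambda>n. real (jobs s0) + next_sum lam mu1 mu2 (lift_state (viter al n)) s0)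
        \<longlonglongrightarrow> real (jobs s0) + next_sum lam mu1 mu2 (lift_state (val al)) s0"
      by (intro tendsto_intros tendsto_next_sum viter_val al s0)
    show "\<exists>N. \<forall>n\<ge>N. (al + out_rate lam mu1 mu2 s0) * lift_state (viter al (Suc n)) s0
        \<le> real (jobs s0) + next_sum lam mu1 mu2 (lift_state (viter al n)) s0"
      using viter_le_decide[OF al s0 p(1)] unfolding p(2) by blast
  qed
  then have "lift_state (val al) s0
      \<le> (real (jobs s0) + next_sum lam mu1 mu2 (lift_state (val al)) s0) / (al + out_rate lam mu1 mu2 s0)"
    using al out_rate_pos[of s0] by (simp add: pos_le_divide_eq mult.commute)
  finally have "ennreal (val al 0 0)
      \<le> ennreal ((real (jobs s0) + next_sum lam mu1 mu2 (lift_state (val al)) s0) / (al + out_rate lam mu1 mu2 s0))"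
    by (rule ennreal_leI)
  also have "\<dots> \<le> weighted_cost (\<lambda>t. ennreal (exp (- al * t))) \<pi> s0"
    by (rule discounted_cost_ge[OF assms])
  finally show ?thesis .
qed

lemma discounted_threshold_optimal:
  assumes al: "0 < al"
  shows "\<exists>d qL qH. threshold_structure d qL qH \<and>
            optimal (discounted_cost lam mu1 mu2 al) (stationary_policy d)"
proof -
  define w where "w x y = bsum (val al) x y / (al + Lam)" for x y
  have "regular w"
    unfolding w_def[abs_def] by (rule regular_bsum_val[OF al])
  then obtain qL qH where q: "qL \<le> qH" and min: "\<And>n z y. (n, z, y) \<in> states \<Longrightarrow>
       relocate w (n + z) y = w (n + z - snd (threshold_rule qL qH (n, z, y))) (y + snd (threshold_rule qL qH (n, z, y)))"
    using threshold_rule_minimises by blast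
  define d where "d = threshold_rule qL qH"
  have adm: "admissible (stationary_policy d)"
    unfolding d_def by (intro stationary_admissible threshold_rule_feasible)
  have bell: "real (jobs (decide s (d s))) + next_sum lam mu1 mu2 (lift_state (val al)) (decide s (d s))
    = (al + out_rate lam mu1 mu2 (decide s (d s))) * lift_state (val al) s + 0" if "s \<in> states" for s
    unfolding d_def
  proof (rule threshold_rule_Bellman[OF _ _ min that])
    show "val al x y = relocate w x y" if "y \<le> 2" for x y
      unfolding w_def[abs_def] by (rule val_fixpoint[OF al that])
    show "(al + Lam) * w x y + 0 = bsum (val al) x y" for x y
      using al Lam_pos by (simp add: w_def)
  qed
  let ?w = "\<lambda>t. ennreal (exp (- al * t))"
  have w: "?w \<in> borel_measurable borel" by measurable
  have upper: "weighted_cost ?w (stationary_policy d) s0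
     \<le> ennreal ((real (jobs s0) + next_sum lam mu1 mu2 (lift_state (val al)) s0) / (al + out_rate lam mu1 mu2 s0))"
    if s0: "s0 \<in> states" for s0
  proof (rule weighted_cost_le[OF adm w s0])
    fix u n
    have "expected_cost (\<lambda>s. ennreal (real (jobs s))) ?w (stationary_policy d) u s0 n (start_config s0)
      \<le> ennreal (exp (- al * clock (start_config s0)) * ((real (jobs (config_state (start_config s0)))
         + next_sum lam mu1 mu2 (lift_state (val al)) (config_state (start_config s0)))
        / (al + out_rate lam mu1 mu2 (config_state (start_config s0)))))"
      using lift_state_nonneg[OF val_nonneg[OF al]] bell
      by (intro expected_cost_discounted_le[OF adm al] start_config_fields(3)[OF s0]) auto
    then show "expected_cost (\<lambda>s. ennreal (real (jobs s))) ?w (stationary_policy d) u s0 n (start_config s0)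
      \<le> ennreal ((real (jobs s0) + next_sum lam mu1 mu2 (lift_state (val al)) s0) / (al + out_rate lam mu1 mu2 s0))"
      by (simp add: start_config_fields[OF s0])
  qed
  have "optimal (discounted_cost lam mu1 mu2 al) (stationary_policy d)"
    unfolding optimal_def discounted_cost_eq
    using adm order.trans[OF upper discounted_cost_ge[OF _ al]] by blast
  then show ?thesis
    using threshold_structure_rule[OF q] d_def by blast
qed

lemma config_after_measurable:
  assumes "admissible \<pi>" "s0 \<in> states"
  shows "config_measurable (seed \<Otimes>\<^sub>M clocks.P) (\<lambda>x. config_after \<pi> s0 x n)"
proof (induction n)
  case 0
  have c: "(\<lambda>x. snd x i) \<in> borel_measurable (seed \<Otimes>\<^sub>M clocks.P)" for i
    by measurable
  have "config_after \<pi> s0 x 0 = fill (start_config s0) (snd x)" for x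
    by (simp add: config_after_def case_prod_beta start_config_fields(4)[OF assms(2)])
  then show ?case
    using fill_measurable[OF config_measurable_const c] by simp
next
  case (Suc n)
  have c: "(\<lambda>x. snd x i) \<in> borel_measurable (seed \<Otimes>\<^sub>M clocks.P)" for i
    by measurable
  have f: "fst \<in> borel_measurable (seed \<Otimes>\<^sub>M clocks.P)"
    by measurable
  have "config_after \<pi> s0 x (Suc n) = step \<pi> (fst x) s0 (snd x) (config_after \<pi> s0 x n)" for x
    by (simp add: config_after_def case_prod_beta)
  then show ?case
    using step_measurable[OF assms(1) f Suc c] by simp
qed

text \<open>\<open>m t\<close> is the expected number of jobs at time \<open>t\<close>. One density
  for all weights lets horizons be compared with discounting. It is built from the series \<phi>,
  jointly measurable by construction and almost surely equal to the number of jobs by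
  nonexplosion.\<close>

lemma weighted_cost_density:
  assumes \<pi>: "admissible \<pi>" and s0: "s0 \<in> states"
  obtains m where "m \<in> borel_measurable borel"
    "\<And>w. w \<in> borel_measurable borel \<Longrightarrow> weighted_cost w \<pi> s0 = (\<integral>\<^sup>+ t\<in>{0..}. w t * m t \<partial>lborel)"
proof -
  let ?M = "seed \<Otimes>\<^sub>M clocks.P"
  let ?T = "\<lambda>x i. clock (config_after \<pi> s0 x i)"
  let ?k = "\<lambda>x i. ennreal (real (jobs (config_state (config_after \<pi> s0 x i))))"
  define \<phi> where "\<phi> z = (\<Sum>i. ?k (fst z) i * (if ?T (fst z) i \<le> snd z \<and> snd z < ?T (fst z) (Suc i) then 1 else 0))"
    for z :: "(real \<times> (event \<times> nat \<Rightarrow> real)) \<times> real"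
  interpret PL: pair_sigma_finite ?M lborel ..
  have Tm [measurable]: "(\<lambda>x. ?T x i) \<in> borel_measurable ?M" for i
    by (rule config_measurableD(1)[OF config_after_measurable[OF assms]])
  have km [measurable]: "(\<lambda>x. ?k x i) \<in> borel_measurable ?M" for i
    by (rule measurable_compose[OF config_measurable_fields(1)[OF config_after_measurable[OF assms]]]) simp
  have \<phi>m [measurable]: "\<phi> \<in> borel_measurable (?M \<Otimes>\<^sub>M lborel)"
    unfolding \<phi>_def[abs_def] by measurable
  define m where "m t = (\<integral>\<^sup>+ x. \<phi> (x, t) \<partial>?M)" for t
  have mm: "m \<in> borel_measurable borel"
  proof -
    have "(\<lambda>t. \<integral>\<^sup>+ x. \<phi> (x, t) \<partial>?M) \<in> borel_measurable lborel"
      by (rule sp.borel_measurable_nn_integral) (use measurable_compose[OF measurable_pair_swap' \<phi>m] in \<open>simp add: case_prod_beta'\<close>)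
    then show ?thesis by (simp add: m_def[abs_def])
  qed
  have "weighted_cost w \<pi> s0 = (\<integral>\<^sup>+ t\<in>{0..}. w t * m t \<partial>lborel)" if w [measurable]: "w \<in> borel_measurable borel" for w
  proof -
    have "weighted_cost w \<pi> s0 = (\<integral>\<^sup>+ x. (\<integral>\<^sup>+ t. w t * indicator {0..} t * \<phi> (x, t) \<partial>lborel) \<partial>?M)"
      unfolding weighted_cost_def sample_space_eq
    proof (rule nn_integral_cong_AE)
      show "AE x in ?M. (\<integral>\<^sup>+ t\<in>{0..}. w t * ennreal (real (jobs (state_at \<pi> s0 x t))) \<partial>lborel)
        = (\<integral>\<^sup>+ t. w t * indicator {0..} t * \<phi> (x, t) \<partial>lborel)"
        using AE_sample_pos AE_nonexplosive[OF \<pi> s0]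
      proof eventually_elim
        fix x assume x: "\<forall>i. 0 < snd x i" "\<forall>t. \<exists>n. t < ?T x n"
        have "ennreal (real (jobs (state_at \<pi> s0 x t))) = \<phi> (x, t)" if "t \<ge> 0" for t
          unfolding cost_eq_suminf(1)[OF w s0 x that] \<phi>_def fst_conv snd_conv
          by (intro suminf_cong) (simp add: indicator_def)
        then show "(\<integral>\<^sup>+ t\<in>{0..}. w t * ennreal (real (jobs (state_at \<pi> s0 x t))) \<partial>lborel)
          = (\<integral>\<^sup>+ t. w t * indicator {0..} t * \<phi> (x, t) \<partial>lborel)"
          by (intro nn_integral_cong) (simp add: indicator_def)
      qed
    qed
    also have "\<dots> = (\<integral>\<^sup>+ t. (\<integral>\<^sup>+ x. w t * indicator {0..} t * \<phi> (x, t) \<partial>?M) \<partial>lborel)"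
      by (rule PL.Fubini'[symmetric]) measurable
    also have "\<dots> = (\<integral>\<^sup>+ t\<in>{0..}. w t * m t \<partial>lborel)"
    proof (rule nn_integral_cong)
      fix t :: real
      have "(\<lambda>x. \<phi> (x, t)) \<in> borel_measurable ?M"
        by (rule measurable_compose[OF _ \<phi>m]) simp
      then have "(\<integral>\<^sup>+ x. w t * indicator {0..} t * \<phi> (x, t) \<partial>?M) = w t * indicator {0..} t * m t"
        unfolding m_def by (rule nn_integral_cmult)
      then show "(\<integral>\<^sup>+ x. w t * indicator {0..} t * \<phi> (x, t) \<partial>?M) = w t * m t * indicator {0..} t"
        by (simp add: ac_simps)
    qed
    finally show ?thesis .
  qed
  then show thesis using that mm by blast
qed

text \<open>An Abelian estimate: \<open>e\<^sup>-\<^sup>a\<^sup>t\<close> is a mixture of the indicators of \<open>{..T}\<close>, so a linear bound on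
  the finite-horizon costs bounds the discounted cost.\<close>

lemma discounted_cost_le_of_linear:
  assumes \<pi>: "admissible \<pi>" and s0: "s0 \<in> states" and al: "0 < al" and b: "0 \<le> b" "0 \<le> T0"
    and linear: "\<And>T. T0 \<le> T \<Longrightarrow> weighted_cost (indicator {..T}) \<pi> s0 \<le> ennreal (b * T)"
  shows "weighted_cost (\<lambda>t. ennreal (exp (- al * t))) \<pi> s0 \<le> ennreal (b * T0 + b / al)"
proof -
  obtain m where m [measurable]: "m \<in> borel_measurable borel"
    and cost: "\<And>w. w \<in> borel_measurable borel \<Longrightarrow> weighted_cost w \<pi> s0 = (\<integral>\<^sup>+ t\<in>{0..}. w t * m t \<partial>lborel)"
    using weighted_cost_density[OF \<pi> s0] by blast
  have m1 [measurable]: "(\<lambda>x. mass (\<lambda>_. 1) 0 (0 + x)) \<in> borel_measurable borel"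
    by (rule mass_measurable) measurable
  note clocks.measurable_coord [measurable del]
  have lin: "(\<integral>\<^sup>+ x. c1 * f x + c2 * g x \<partial>lborel) = c1 * (\<integral>\<^sup>+ x. f x \<partial>lborel) + c2 * (\<integral>\<^sup>+ x. g x \<partial>lborel)"
    if [measurable]: "f \<in> borel_measurable borel" "g \<in> borel_measurable borel" for c1 c2 and f g :: "real \<Rightarrow> ennreal"
    by (subst nn_integral_add) (auto simp: nn_integral_cmult)
  \<comment> \<open>The linear bound is assumed only from \<open>T0\<close> on; shorter horizons are
    replaced by \<open>T0\<close>, which costs the additive constant \<open>b * T0\<close>.\<close>
  have mass_le: "mass m 0 (0 + x) \<le> ennreal (b * T0) + ennreal b * mass (\<lambda>_. 1) 0 (0 + x)" if "0 \<le> x" for x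
  proof -
    have "mass m 0 (0 + x) \<le> (\<integral>\<^sup>+ t\<in>{0..}. indicator {..max T0 x} t * m t \<partial>lborel)"
      unfolding mass_def by (intro nn_integral_mono) (auto simp: indicator_def)
    also have "\<dots> = weighted_cost (indicator {..max T0 x}) \<pi> s0"
      by (rule cost[symmetric]) measurable
    also have "\<dots> \<le> ennreal (b * max T0 x)"
      by (rule linear) simp
    also have "\<dots> \<le> ennreal (b * T0 + b * x)"
      using b that by (intro ennreal_leI) (auto simp: max_def distrib_left[symmetric] intro!: mult_left_mono)
    also have "\<dots> = ennreal (b * T0) + ennreal b * mass (\<lambda>_. 1) 0 (0 + x)"
      using b that by (simp add: mass_def ennreal_mult)
    finally show ?thesis .
  qed
  have "weighted_cost (\<lambda>t. ennreal (exp (- al * t))) \<pi> s0 = (\<integral>\<^sup>+ x\<in>{0..}. ennreal (exp (- al * x)) * m (0 + x) \<partial>lborel)"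
    by (subst cost) auto
  also have "\<dots> = (\<integral>\<^sup>+ x\<in>{0..}. ennreal (al * exp (- al * x)) * mass m 0 (0 + x) \<partial>lborel)"
    by (rule mass_exp[OF m al, symmetric])
  also have "\<dots> \<le> (\<integral>\<^sup>+ x. ennreal (b * T0) * (ennreal (al * exp (- al * x)) * indicator {0..} x)
      + ennreal b * (ennreal (al * exp (- al * x)) * mass (\<lambda>_. 1) 0 (0 + x) * indicator {0..} x) \<partial>lborel)"
  proof (rule nn_integral_mono)
    fix x :: real
    show "ennreal (al * exp (- al * x)) * mass m 0 (0 + x) * indicator {0..} x
      \<le> ennreal (b * T0) * (ennreal (al * exp (- al * x)) * indicator {0..} x)
      + ennreal b * (ennreal (al * exp (- al * x)) * mass (\<lambda>_. 1) 0 (0 + x) * indicator {0..} x)"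
    proof (cases "0 \<le> x")
      case True
      then show ?thesis
        using mult_left_mono[OF mass_le[OF True], of "ennreal (al * exp (- al * x))"]
        by (simp add: distrib_left ac_simps)
    qed simp
  qed
  also have "\<dots> = ennreal (b * T0) * (\<integral>\<^sup>+ x\<in>{0..}. ennreal (al * exp (- al * x)) \<partial>lborel)
      + ennreal b * (\<integral>\<^sup>+ x\<in>{0..}. ennreal (al * exp (- al * x)) * mass (\<lambda>_. 1) 0 (0 + x) \<partial>lborel)"
    by (rule lin) measurable
  also have "(\<integral>\<^sup>+ x\<in>{0..}. ennreal (al * exp (- al * x)) * mass (\<lambda>_. 1) 0 (0 + x) \<partial>lborel)
      = (\<integral>\<^sup>+ x\<in>{0..}. ennreal (1 * exp (- al * x)) \<partial>lborel)"
    by (subst mass_exp[OF _ al]) auto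
  also have "ennreal (b * T0) * (\<integral>\<^sup>+ x\<in>{0..}. ennreal (al * exp (- al * x)) \<partial>lborel)
      + ennreal b * (\<integral>\<^sup>+ x\<in>{0..}. ennreal (1 * exp (- al * x)) \<partial>lborel) = ennreal (b * T0 + b / al)"
    unfolding nn_integral_exp[OF al less_imp_le[OF al]] nn_integral_exp[OF al zero_le_one]
    using al b by (simp add: ennreal_mult[symmetric])
  finally show ?thesis .
qed

text \<open>An average cost below \<open>rho\<close> would bound the finite-horizon costs by
  \<open>b * T\<close> for some \<open>b < rho\<close> and all large \<open>T\<close>. The Abelian
  estimate multiplied by \<open>al k\<close> then forces \<open>rho \<le> b\<close> in the
  limit.\<close>

lemma average_cost_ge:
  assumes \<pi>: "admissible \<pi>" and s0: "s0 \<in> states"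
    and al: "\<And>k. 0 < al k" "al \<longlonglongrightarrow> 0" and rho: "(\<lambda>k::nat. al k * val (al k) 0 0) \<longlonglongrightarrow> rho"
  shows "ennreal rho \<le> average_cost lam mu1 mu2 \<pi> s0"
proof (rule ccontr)
  let ?C = "\<lambda>T. weighted_cost (indicator {..T}) \<pi> s0"
  assume "\<not> ennreal rho \<le> average_cost lam mu1 mu2 \<pi> s0"
  then obtain c where c: "average_cost lam mu1 mu2 \<pi> s0 < c" "c < ennreal rho"
    using dense[of "average_cost lam mu1 mu2 \<pi> s0" "ennreal rho"] by (auto simp: not_le)
  define b where "b = enn2real c"
  have "c < top" using c(2) by (rule order.strict_trans) simp
  then have b: "c = ennreal b" "0 \<le> b" by (simp_all add: b_def)
  then have b_rho: "b < rho" using c(2) by (simp add: ennreal_less_iff)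
  have "eventually (\<lambda>T. ?C T / ennreal T < c) at_top"
    using c(1) unfolding average_cost_eq by (rule Limsup_lessD)
  then obtain T1 where T1: "\<And>T. T1 \<le> T \<Longrightarrow> ?C T / ennreal T < c"
    by (auto simp: eventually_at_top_linorder)
  define T0 where "T0 = max T1 1"
  have linear: "?C T \<le> ennreal (b * T)" if "T0 \<le> T" for T
  proof -
    have T: "0 < T" "T1 \<le> T" using that by (auto simp: T0_def)
    have "?C T = ?C T / ennreal T * ennreal T"
      using T by (simp add: ennreal_divide_times mult_divide_eq_ennreal)
    also have "\<dots> \<le> c * ennreal T"
      using T1[OF T(2)] by (intro mult_right_mono) auto
    finally show ?thesis using b T by (simp add: ennreal_mult)
  qed
  have "al k * val (al k) 0 0 \<le> b * T0 * al k + b" for k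
  proof -
    have "0 \<le> T0" by (simp add: T0_def)
    then have "ennreal (val (al k) 0 0) \<le> ennreal (b * T0 + b / al k)"
      by (intro order.trans[OF val_le_discounted_cost[OF \<pi> al(1) s0]
          discounted_cost_le_of_linear[OF \<pi> s0 al(1) b(2) _ linear]])
    then have "val (al k) 0 0 \<le> b * T0 + b / al k"
      using b al(1)[of k] by (subst (asm) ennreal_le_iff) (auto simp: T0_def intro!: add_nonneg_nonneg mult_nonneg_nonneg divide_nonneg_pos)
    then have "al k * val (al k) 0 0 \<le> al k * (b * T0 + b / al k)"
      using al(1)[of k] by (intro mult_left_mono) auto
    also have "\<dots> = b * T0 * al k + b"
      using al(1)[of k] by (simp add: field_simps)
    finally show ?thesis .
  qed
  moreover have "(\<lambda>k. b * T0 * al k + b) \<longlonglongrightarrow> b * T0 * 0 + b"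
    by (intro tendsto_intros al)
  ultimately have "rho \<le> b * T0 * 0 + b"
    using LIMSEQ_le[OF rho] by blast
  then show False using b_rho by simp
qed

lemma average_threshold_optimal:
  assumes stable: "lam < mu1 + 2 * mu2"
  shows "\<exists>d qL qH. threshold_structure d qL qH \<and>
            optimal (average_cost lam mu1 mu2) (stationary_policy d)"
proof -
  obtain h w rho al where w: "regular w" and al: "\<And>k. 0 < al k" "al \<longlonglongrightarrow> 0" and rho: "0 \<le> rho"
    "(\<lambda>k::nat. al k * val (al k) 0 0) \<longlonglongrightarrow> rho"
    and h: "\<And>x y. y \<le> 2 \<Longrightarrow> 0 \<le> h x y" "\<And>x y. y \<le> 2 \<Longrightarrow> h x y = relocate w x y"
      "\<And>x y. y \<le> 2 \<Longrightarrow> Lam * w x y + rho = bsum h x y"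
    by (rule vanishing_discount[OF stable], rule that; assumption)
  obtain qL qH where q: "qL \<le> qH" and min: "\<And>n z y. (n, z, y) \<in> states \<Longrightarrow>
       relocate w (n + z) y = w (n + z - snd (threshold_rule qL qH (n, z, y))) (y + snd (threshold_rule qL qH (n, z, y)))"
    using threshold_rule_minimises[OF w] by blast
  define d where "d = threshold_rule qL qH"
  have feas: "d s \<in> feasible s" if "s \<in> states" for s
    unfolding d_def by (rule threshold_rule_feasible[OF that])
  then have adm: "admissible (stationary_policy d)"
    by (rule stationary_admissible)
  have bell: "real (jobs (decide s (d s))) + next_sum lam mu1 mu2 (lift_state h) (decide s (d s))
    = (0 + out_rate lam mu1 mu2 (decide s (d s))) * lift_state h s + rho" if "s \<in> states" for s
    unfolding d_def by (rule threshold_rule_Bellman[OF h(2) _ min that]) (use h(3) in simp_all)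
  have h0: "0 \<le> lift_state h s" if "s \<in> states" for s
    using h(1) that by (rule lift_state_nonneg)
  \<comment> \<open>Truncating at 0 gives the nonnegativity required of post-decision relative
    values. It preserves the inequality of \<open>H_step\<close>, and that of
    \<open>H_decide\<close> because \<open>h\<close> is nonnegative.\<close>
  define H where "H s = max 0 ((real (jobs s) + next_sum lam mu1 mu2 (lift_state h) s - rho) / out_rate lam mu1 mu2 s)" for s
  have H_step: "real (jobs s) + next_sum lam mu1 mu2 (lift_state h) s \<le> out_rate lam mu1 mu2 s * H s + rho" for s
  proof -
    have "(real (jobs s) + next_sum lam mu1 mu2 (lift_state h) s - rho) / out_rate lam mu1 mu2 s \<le> H s"
      by (simp add: H_def)
    then show ?thesis
      using out_rate_pos[of s] by (simp add: pos_divide_le_eq mult.commute)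
  qed
  have H_decide: "H (decide s (d s)) \<le> lift_state h s" if "s \<in> states" for s
    using bell[OF that] h0[OF that] out_rate_pos[of "decide s (d s)"] by (simp add: H_def)
  have upper: "average_cost lam mu1 mu2 (stationary_policy d) s0 \<le> ennreal rho" if s0: "s0 \<in> states" for s0
  proof -
    have C: "weighted_cost (indicator {..T}) (stationary_policy d) s0 \<le> ennreal (H s0 + rho * T)" if "0 < T" for T
    proof (rule weighted_cost_le[OF adm _ s0])
      fix u n
      have "expected_cost (\<lambda>s. ennreal (real (jobs s))) (indicator {..T}) (stationary_policy d) u s0 n (start_config s0)
        \<le> (if clock (start_config s0) \<le> T then ennreal (H (config_state (start_config s0)) + rho * (T - clock (start_config s0))) else 0)"
        by (rule expected_cost_average_le[OF adm _ h0 _ rho(1) H_step H_decide start_config_fields(3)[OF s0]])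
          (auto simp: H_def)
      then show "expected_cost (\<lambda>s. ennreal (real (jobs s))) (indicator {..T}) (stationary_policy d) u s0 n (start_config s0)
        \<le> ennreal (H s0 + rho * T)"
        using that by (simp add: start_config_fields[OF s0])
    qed simp
    have "average_cost lam mu1 mu2 (stationary_policy d) s0 \<le> Limsup at_top (\<lambda>T. ennreal (H s0 / T + rho))"
      unfolding average_cost_eq
    proof (rule Limsup_mono)
      show "eventually (\<lambda>T. weighted_cost (indicator {..T}) (stationary_policy d) s0 / ennreal T \<le> ennreal (H s0 / T + rho)) at_top"
        using eventually_gt_at_top[of "0::real"]
      proof eventually_elim
        fix T :: real assume T: "0 < T"
        have "weighted_cost (indicator {..T}) (stationary_policy d) s0 / ennreal T \<le> ennreal (H s0 + rho * T) / ennreal T"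
          by (rule divide_right_mono_ennreal[OF C[OF T]])
        also have "\<dots> = ennreal ((H s0 + rho * T) / T)"
          using T rho by (intro divide_ennreal) (auto simp: H_def)
        finally show "weighted_cost (indicator {..T}) (stationary_policy d) s0 / ennreal T \<le> ennreal (H s0 / T + rho)"
          using T by (simp add: field_simps)
      qed
    qed
    also have "\<dots> = ennreal (0 + rho)"
    proof (rule lim_imp_Limsup)
      show "((\<lambda>T. ennreal (H s0 / T + rho)) \<longlongrightarrow> ennreal (0 + rho)) at_top"
        by (intro tendsto_ennrealI tendsto_intros real_tendsto_divide_at_top[OF tendsto_const filterlim_ident])
    qed simp
    finally show ?thesis by simp
  qed
  have "optimal (average_cost lam mu1 mu2) (stationary_policy d)"
    unfolding optimal_def using adm order.trans[OF upper average_cost_ge[OF _ _ al rho(2)]] by blast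
  then show ?thesis
    using threshold_structure_rule[OF q] d_def by blast
qed

end

theorem theorem1:
  fixes lam mu1 mu2 :: real
  assumes "0 < lam" and "0 < mu2" and "mu2 < mu1"
  shows "(\<forall>\<alpha>>0. \<exists>d qL qH. threshold_structure d qL qH \<and>
            optimal (discounted_cost lam mu1 mu2 \<alpha>) (stationary_policy d)) \<and>
         (lam < mu1 + 2 * mu2 \<longrightarrow>
            (\<exists>d qL qH. threshold_structure d qL qH \<and>
               optimal (average_cost lam mu1 mu2) (stationary_policy d)))"
proof -
  interpret rates lam mu1 mu2
    by standard fact+
  show ?thesis
    using discounted_threshold_optimal average_threshold_optimal by blast
qed

end
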